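(* Let $\hat\pi\in(0,1)$. For any $t\ge0$ and $\epsilon>0$, $$E\left[\big((\pi^\epsilon-\pi^r)^*_t\big)^2\right]\le16te^{32t}\epsilon^2+\epsilon.$$ In particular, for every $t\ge 0$, $(\pi^\epsilon-\pi^r)^*_t\to0$ in $L^2$ as $\epsilon\to0$.
   Context: For a process $Z$, $Z^*_t=\sup_{0\le s\le t}|Z_s|$. Let $W$ be a standard Brownian motion. Reflected process: $\pi^r$ is the process with $\pi^r_0=\hat\pi$, $\pi^r\ge\hat\pi$, and $d\pi^r_t=\pi^r_t(1-\pi^r_t)\,dW_t+dA_t$, where $A$ is continuous, non-decreasing, $A_0=0$, and $A$ is flat off $\{\pi^r=\hat\pi\}$ (i.e. $\int_0^\infty(\pi^r_s-\hat\pi)\,dA_s=0$). Impulsed process: for $\epsilon>0$, $\pi^\epsilon$ is the process, driven by the same $W$, started at $\pi^\epsilon_0=\hat\pi$, which diffuses according to $d\pi^\epsilon_t=\pi^\epsilon_t(1-\pi^\epsilon_t)\,dW_t$ while in $(\hat\pi-\epsilon,1)$, and which, each time it reaches the level $\hat\pi-\epsilon$, is instantaneously brought back to $\hat\pi$ (right-continuous paths, so the value at such a time is $\hat\pi$). *)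

theory Defs
  imports "HOL-Probability.Probability"
begin

text \<open>
  Processes are functions \<open>Z :: real \<Rightarrow> 'a \<Rightarrow> real\<close> of which only the times \<open>t \<ge> 0\<close> matter.
  Regularity of paths (continuity, right-continuity with left limits) is required for every
  \<open>\<omega> \<in> space M\<close>, so that running suprema are finite and measurable even if the filtration is
  not complete; all other pathwise properties are required almost surely.
\<close>

text \<open>The running supremum \<open>Z\<^sup>*\<^sub>t = sup {\<bar>Z\<^sub>s\<bar> | 0 \<le> s \<le> t}\<close>.\<close>

definition running_sup :: "(real \<Rightarrow> 'a \<Rightarrow> real) \<Rightarrow> real \<Rightarrow> 'a \<Rightarrow> real" where
  "running_sup Z t \<omega> = (SUP s\<in>{0..t}. \<bar>Z s \<omega>\<bar>)"

text \<open>
  The library locale \<^locale>\<open>filtration\<close> indexes by the whole type; a filtration indexed by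
  \<open>[0,\<infinity>)\<close> is extended to negative times by \<open>F 0\<close>.
\<close>

definition filtration_of :: "'a measure \<Rightarrow> (real \<Rightarrow> 'a measure) \<Rightarrow> bool" where
  "filtration_of M F \<longleftrightarrow> filtration (space M) F \<and> (\<forall>t. subalgebra M (F t))"

definition adapted :: "(real \<Rightarrow> 'a measure) \<Rightarrow> (real \<Rightarrow> 'a \<Rightarrow> real) \<Rightarrow> bool" where
  "adapted F Z \<longleftrightarrow> (\<forall>t\<ge>0. Z t \<in> borel_measurable (F t))"

definition progressively_measurable ::
    "(real \<Rightarrow> 'a measure) \<Rightarrow> (real \<Rightarrow> 'a \<Rightarrow> real) \<Rightarrow> bool" where
  "progressively_measurable F Z \<longleftrightarrow>
     (\<forall>T\<ge>0. (\<lambda>(s, \<omega>). Z s \<omega>) \<in> borel_measurable (restrict_space borel {0..T} \<Otimes>\<^sub>M F T))"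

definition continuous_paths :: "'a measure \<Rightarrow> (real \<Rightarrow> 'a \<Rightarrow> real) \<Rightarrow> bool" where
  "continuous_paths M Z \<longleftrightarrow> (\<forall>\<omega>\<in>space M. continuous_on {0..} (\<lambda>t. Z t \<omega>))"

definition cadlag_paths :: "'a measure \<Rightarrow> (real \<Rightarrow> 'a \<Rightarrow> real) \<Rightarrow> bool" where
  "cadlag_paths M Z \<longleftrightarrow> (\<forall>\<omega>\<in>space M.
     (\<forall>t\<ge>0. continuous (at_right t) (\<lambda>s. Z s \<omega>)) \<and>
     (\<forall>t>0. \<exists>l. ((\<lambda>s. Z s \<omega>) \<longlongrightarrow> l) (at_left t)))"

definition brownian_motion ::
    "'a measure \<Rightarrow> (real \<Rightarrow> 'a measure) \<Rightarrow> (real \<Rightarrow> 'a \<Rightarrow> real) \<Rightarrow> bool" where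
  "brownian_motion M F W \<longleftrightarrow>
     adapted F W \<and> continuous_paths M W \<and> (AE \<omega> in M. W 0 \<omega> = 0) \<and>
     (\<forall>s t. 0 \<le> s \<and> s < t \<longrightarrow>
        distributed M lborel (\<lambda>\<omega>. W t \<omega> - W s \<omega>) (normal_density 0 (sqrt (t - s))) \<and>
        prob_space.indep_set M (sets (F s))
          (sets (vimage_algebra (space M) (\<lambda>\<omega>. W t \<omega> - W s \<omega>) borel)))"

text \<open>
  Simple integrands \<open>\<Sum>i<m. \<xi>\<^sub>i 1\<^bsub>(p i, p (i+1)]\<^esub>\<close> with \<open>\<xi>\<^sub>i\<close> bounded and \<open>F (p i)\<close>-measurable,
  and their elementary stochastic integrals.
\<close>

definition simple_integrand ::
    "(real \<Rightarrow> 'a measure) \<Rightarrow> nat \<Rightarrow> (nat \<Rightarrow> real) \<Rightarrow> (nat \<Rightarrow> 'a \<Rightarrow> real) \<Rightarrow> bool" where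
  "simple_integrand F m p \<xi> \<longleftrightarrow>
     0 \<le> p 0 \<and> (\<forall>i<m. p i \<le> p (Suc i)) \<and>
     (\<forall>i<m. \<xi> i \<in> borel_measurable (F (p i)) \<and> (\<exists>c. \<forall>\<omega>\<in>space (F (p i)). \<bar>\<xi> i \<omega>\<bar> \<le> c))"

definition simple_process ::
    "nat \<Rightarrow> (nat \<Rightarrow> real) \<Rightarrow> (nat \<Rightarrow> 'a \<Rightarrow> real) \<Rightarrow> real \<Rightarrow> 'a \<Rightarrow> real" where
  "simple_process m p \<xi> s \<omega> = (\<Sum>i<m. \<xi> i \<omega> * indicator {p i<..p (Suc i)} s)"

definition simple_integral ::
    "(real \<Rightarrow> 'a \<Rightarrow> real) \<Rightarrow> nat \<Rightarrow> (nat \<Rightarrow> real) \<Rightarrow> (nat \<Rightarrow> 'a \<Rightarrow> real) \<Rightarrow> real \<Rightarrow> 'a \<Rightarrow> real" where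
  "simple_integral W m p \<xi> t \<omega> =
     (\<Sum>i<m. \<xi> i \<omega> * (W (min (p (Suc i)) t) \<omega> - W (min (p i) t) \<omega>))"

definition tendsto_zero_in_prob :: "'a measure \<Rightarrow> (nat \<Rightarrow> 'a \<Rightarrow> ennreal) \<Rightarrow> bool" where
  "tendsto_zero_in_prob M Y \<longleftrightarrow>
     (\<forall>e>0. (\<lambda>k. measure M {\<omega>\<in>space M. ennreal e < Y k \<omega>}) \<longlonglongrightarrow> 0)"

text \<open>
  \<open>I\<close> is (a continuous version of) the It\^o integral process \<open>\<integral>\<^sub>0 H dW\<close>, for progressively
  measurable \<open>H\<close> with \<open>\<integral>\<^sub>0\<^sup>T H\<^sup>2 ds < \<infinity>\<close> almost surely: the limit, uniformly on compacts in
  probability, of the elementary integrals of simple integrands approximating \<open>H\<close> in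
  \<open>L\<^sup>2(ds)\<close> in probability. This determines \<open>I\<close> up to indistinguishability.
\<close>

definition is_ito_integral ::
    "'a measure \<Rightarrow> (real \<Rightarrow> 'a measure) \<Rightarrow> (real \<Rightarrow> 'a \<Rightarrow> real) \<Rightarrow>
     (real \<Rightarrow> 'a \<Rightarrow> real) \<Rightarrow> (real \<Rightarrow> 'a \<Rightarrow> real) \<Rightarrow> bool" where
  "is_ito_integral M F W H I \<longleftrightarrow>
     progressively_measurable F H \<and>
     (\<forall>T\<ge>0. AE \<omega> in M. (\<integral>\<^sup>+s\<in>{0..T}. ennreal ((H s \<omega>)\<^sup>2) \<partial>lborel) < \<infinity>) \<and>
     adapted F I \<and> continuous_paths M I \<and>
     (\<exists>m p \<xi>.
        (\<forall>k. simple_integrand F (m k) (p k) (\<xi> k)) \<and>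
        (\<forall>T\<ge>0.
           tendsto_zero_in_prob M (\<lambda>k \<omega>.
             \<integral>\<^sup>+s\<in>{0..T}. ennreal ((simple_process (m k) (p k) (\<xi> k) s \<omega> - H s \<omega>)\<^sup>2) \<partial>lborel) \<and>
           tendsto_zero_in_prob M (\<lambda>k \<omega>.
             ennreal (running_sup (\<lambda>s \<omega>. simple_integral W (m k) (p k) (\<xi> k) s \<omega> - I s \<omega>) T \<omega>))))"

text \<open>
  In the flatness condition, \<open>dA\<close> is the Lebesgue-Stieltjes measure of \<open>A\<close>, where \<open>A\<close> is extended
  by \<open>A\<^sub>0\<close> to negative times.
\<close>

definition reflected_process ::
    "'a measure \<Rightarrow> (real \<Rightarrow> 'a measure) \<Rightarrow> (real \<Rightarrow> 'a \<Rightarrow> real) \<Rightarrow> real \<Rightarrow> (real \<Rightarrow> 'a \<Rightarrow> real) \<Rightarrow> bool"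
  where
  "reflected_process M F W b X \<longleftrightarrow>
     adapted F X \<and> continuous_paths M X \<and>
     (AE \<omega> in M. X 0 \<omega> = b \<and> (\<forall>t\<ge>0. b \<le> X t \<omega>)) \<and>
     (\<exists>I A. is_ito_integral M F W (\<lambda>s \<omega>. X s \<omega> * (1 - X s \<omega>)) I \<and>
        adapted F A \<and> continuous_paths M A \<and>
        (AE \<omega> in M.
           A 0 \<omega> = 0 \<and> mono_on {0..} (\<lambda>t. A t \<omega>) \<and>
           (\<integral>\<^sup>+s\<in>{0..}. ennreal (X s \<omega> - b) \<partial>interval_measure (\<lambda>s. A (max 0 s) \<omega>)) = 0 \<and>
           (\<forall>t\<ge>0. X t \<omega> = b + I t \<omega> + A t \<omega>)))"

text \<open>
  The times in \<open>(0,t]\<close> at which a path reaches the level \<open>l\<close>, i.e. has left limit \<open>l\<close>: the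
  paths are right-continuous, and at such a time the value has already been reset.
\<close>

definition impulse_times :: "(real \<Rightarrow> 'a \<Rightarrow> real) \<Rightarrow> real \<Rightarrow> real \<Rightarrow> 'a \<Rightarrow> real set" where
  "impulse_times X l t \<omega> = {s. 0 < s \<and> s \<le> t \<and> ((\<lambda>u. X u \<omega>) \<longlongrightarrow> l) (at_left s)}"

text \<open>
  Each impulse moves the process from \<open>b - \<epsilon>\<close> to \<open>b\<close>, i.e. is a jump of size \<open>\<epsilon>\<close>; between impulses
  the process follows the diffusion.
\<close>

definition impulsed_process ::
    "'a measure \<Rightarrow> (real \<Rightarrow> 'a measure) \<Rightarrow> (real \<Rightarrow> 'a \<Rightarrow> real) \<Rightarrow> real \<Rightarrow> real \<Rightarrow>
     (real \<Rightarrow> 'a \<Rightarrow> real) \<Rightarrow> bool" where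
  "impulsed_process M F W b \<epsilon> X \<longleftrightarrow>
     adapted F X \<and> cadlag_paths M X \<and>
     (AE \<omega> in M. X 0 \<omega> = b \<and> (\<forall>t\<ge>0. X t \<omega> \<in> {b - \<epsilon><..<1})) \<and>
     (\<exists>I. is_ito_integral M F W (\<lambda>s \<omega>. X s \<omega> * (1 - X s \<omega>)) I \<and>
        (AE \<omega> in M. \<forall>t\<ge>0.
           finite (impulse_times X (b - \<epsilon>) t \<omega>) \<and>
           X t \<omega> = b + I t \<omega> + \<epsilon> * real (card (impulse_times X (b - \<epsilon>) t \<omega>))))"

end

theory Submission
  imports Defs
begin

text \<open>
  Write \<open>X = b + \<integral>\<sigma>(X)dW + A\<close> and \<open>Y = b + \<integral>\<sigma>(Y)dW + L\<close> for the reflected and the impulsed process,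
  \<open>\<sigma>(x) = x(1 - x)\<close>. By Skorokhod's argument \<open>A\<close> is the running maximum of \<open>-\<integral>\<sigma>(X)dW\<close>, and \<open>L\<close> is the
  running maximum of \<open>-\<integral>\<sigma>(Y)dW\<close> rounded down to a multiple of \<open>\<epsilon>\<close>. So \<open>\<bar>Y - X\<bar>\<^sup>* \<le> 2J\<^sup>* + \<epsilon>\<close> with
  \<open>J = \<integral>(\<sigma>(Y) - \<sigma>(X))dW\<close>, and Doob's inequality, the Lipschitz bound for \<open>\<sigma>\<close> on \<open>[0,1]\<close> and Gronwall's
  lemma give \<open>E(\<bar>Y - X\<bar>\<^sup>*)\<^sup>2 \<le> 3\<epsilon>\<^sup>2 exp(24t)\<close>. If \<open>\<epsilon>\<close> is not small compared with \<open>t\<close>, this is complemented by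
  the bound \<open>9t/4\<close>, which comes from \<open>\<sigma> \<le> 1/4\<close>; the smaller of the two is always below the claimed bound.

  That both processes stay in \<open>[0,1]\<close> also follows from this estimate: \<open>X \<le> 1\<close> because \<open>X\<close>, stopped at
  level \<open>2\<close>, is a limit of impulsed processes, and \<open>Y \<ge> 0\<close> because \<open>Y\<close> agrees with itself stopped at \<open>0\<close>.
\<close>

section \<open>Brownian increments\<close>

text \<open>The obstacle is that the equations alone do not confine the processes: X has no assumed
  upper bound, and for \<epsilon> > b nothing assumed keeps Y above 0, while \<sigma> is Lipschitz
  only on bounded sets. Moreover the integrands have energies that are finite only almost surely, so
  square integrability is never available beforehand. Hence Doob's inequality is proved with the
  energy truncated, and Gronwall is run up to a stopping time below which the paths are bounded.
  Constants: (2J + \<epsilon>)^2 \<le> 6 J^2 + 3 \<epsilon>^2 and Doob's factor 4 give the prefactor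
  3 and the exponent 24 = 6 * 4. The bound 9t/4 rests on a comparison without \<epsilon>, in which
  the running supremum of the integral of \<sigma>(Y) replaces it; both integrals have expected
  squared supremum at most 4 * t/16, and 6/4 + 3/4 = 9/4. A second bound is unavoidable: as t tends
  to 0 the Gronwall bound tends to 3 \<epsilon>^2 and the claimed one to \<epsilon>, which is
  smaller for \<epsilon> > 1/3.\<close>

locale brownian_setting = prob_space M for M :: "'a measure" +
  fixes F :: "real \<Rightarrow> 'a measure" and W :: "real \<Rightarrow> 'a \<Rightarrow> real"
  assumes filtration_F: "filtration_of M F"
    and brownian: "brownian_motion M F W"
begin

lemma space_F [simp]: "space (F t) = space M"
  using filtration_F by (auto simp: filtration_of_def subalgebra_def)

lemma sets_F_subset: "sets (F t) \<subseteq> sets M"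
  using filtration_F by (auto simp: filtration_of_def subalgebra_def)

lemma sets_F_mono: "s \<le> t \<Longrightarrow> sets (F s) \<subseteq> sets (F t)"
  using filtration_F by (auto simp: filtration_of_def dest: filtration.sets_F_mono)

lemma measurable_F_M: "f \<in> borel_measurable (F t) \<Longrightarrow> f \<in> borel_measurable M"
  using filtration_F unfolding filtration_of_def by (blast intro: measurable_from_subalg)

lemma measurable_F_mono:
  assumes "f \<in> borel_measurable (F s)" "s \<le> t"
  shows "f \<in> borel_measurable (F t)"
proof (rule measurable_from_subalg[OF _ assms(1)])
  show "subalgebra (F t) (F s)"
    using sets_F_mono[OF assms(2)] by (simp add: subalgebra_def)
qed

lemma W_measurable: "0 \<le> t \<Longrightarrow> W t \<in> borel_measurable (F t)"
  using brownian by (auto simp: brownian_motion_def adapted_def)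

lemma W_measurable_M [measurable]: "0 \<le> t \<Longrightarrow> W t \<in> borel_measurable M"
  using W_measurable measurable_F_M by blast

lemma W_continuous: "w \<in> space M \<Longrightarrow> continuous_on {0..} (\<lambda>t. W t w)"
  using brownian by (auto simp: brownian_motion_def continuous_paths_def)

lemma increment_moments:
  assumes "0 \<le> u" "u < v"
  shows "integrable M (\<lambda>w. W v w - W u w)" "expectation (\<lambda>w. W v w - W u w) = 0"
    "integrable M (\<lambda>w. (W v w - W u w)\<^sup>2)" "expectation (\<lambda>w. (W v w - W u w)\<^sup>2) = v - u"
proof -
  have D: "distributed M lborel (\<lambda>w. W v w - W u w) (normal_density 0 (sqrt (v - u)))"
    using brownian assms by (auto simp: brownian_motion_def)
  have pos: "0 < sqrt (v - u)" using assms by simp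
  show i1: "integrable M (\<lambda>w. W v w - W u w)"
    using distributed_integrable[OF D, of "\<lambda>x. x"] integrable_normal_moment[OF pos, of 0 1] by simp
  show e1: "expectation (\<lambda>w. W v w - W u w) = 0"
    using normal_distributed_expectation[OF pos D] by simp
  show "integrable M (\<lambda>w. (W v w - W u w)\<^sup>2)"
    using distributed_integrable[OF D, of "\<lambda>x. x\<^sup>2"] integrable_normal_moment[OF pos, of 0 2] by simp
  show "expectation (\<lambda>w. (W v w - W u w)\<^sup>2) = v - u"
    using normal_distributed_variance[OF pos D] e1 assms by simp
qed

text \<open>Independence is assumed between sigma-algebras; it passes to variables because preimages
  under \<open>Y\<close> lie in \<open>F u\<close> and preimages under \<open>f\<close> of the
  increment lie in the sigma-algebra of the increment. The free \<open>f\<close> serves the first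
  and the second moment alike.\<close>

lemma increment_indep_var:
  assumes "0 \<le> u" "u < v" and Y: "Y \<in> borel_measurable (F u)" and f: "f \<in> borel_measurable borel"
  shows "indep_var borel Y borel (\<lambda>w. f (W v w - W u w) :: real)"
proof -
  let ?D = "\<lambda>w. W v w - W u w"
  let ?V = "vimage_algebra (space M) ?D borel"
  have ind: "indep_set (sets (F u)) (sets ?V)"
    using brownian assms by (auto simp: brownian_motion_def)
  have DV: "?D \<in> borel_measurable ?V"
    by (rule measurable_vimage_algebra1) auto
  have fD: "(\<lambda>w. f (?D w)) \<in> borel_measurable ?V"
    using measurable_compose[OF DV f] .
  have D: "?D \<in> borel_measurable M" using assms by (intro borel_measurable_diff W_measurable_M) auto
  have 1: "sigma_sets (space M) {Y -` A \<inter> space M | A. A \<in> sets borel} \<subseteq> sets (F u)"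
    using measurable_sets[OF Y] by (intro sets.sigma_sets_subset[of _ "F u", simplified]) auto
  have 2: "sigma_sets (space M) {(\<lambda>w. f (?D w)) -` A \<inter> space M | A. A \<in> sets borel} \<subseteq> sets ?V"
    using measurable_sets[OF fD] by (intro sets.sigma_sets_subset[of _ "?V", simplified]) (auto)
  show ?thesis
    unfolding indep_var_eq
  proof (intro conjI)
    show "random_variable borel Y" by (rule measurable_F_M[OF Y])
    show "random_variable borel (\<lambda>w. f (?D w))" using measurable_compose[OF D f] .
    show "indep_set (sigma_sets (space M) {Y -` A \<inter> space M | A. A \<in> sets borel})
       (sigma_sets (space M) {(\<lambda>w. f (?D w)) -` A \<inter> space M | A. A \<in> sets borel})"
      using ind unfolding indep_set_def
      by (rule indep_sets_mono_sets) (use 1 2 in \<open>auto split: bool.split\<close>)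
  qed
qed

text \<open>Independence factorises the expectation and the increment is centred. This is the form
  in which the martingale property enters everywhere below, so conditional expectations do not
  appear.\<close>

lemma increment_orthogonal:
  assumes "0 \<le> u" "u < v" "Y \<in> borel_measurable (F u)" "integrable M Y"
  shows "integrable M (\<lambda>w. Y w * (W v w - W u w))"
    "expectation (\<lambda>w. Y w * (W v w - W u w)) = 0"
  using indep_var_integrable[OF increment_indep_var[of u v Y "\<lambda>x. x"]]
    indep_var_lebesgue_integral[OF increment_indep_var[of u v Y "\<lambda>x. x"]]
    increment_moments[of u v] assms by simp_all

text \<open>The Ito isometry over a single interval, with \<open>Y\<close> in the role of the
  squared integrand.\<close>

lemma increment_variance:
  assumes "0 \<le> u" "u < v" "Y \<in> borel_measurable (F u)" "integrable M Y"
  shows "integrable M (\<lambda>w. Y w * (W v w - W u w)\<^sup>2)"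
    "expectation (\<lambda>w. Y w * (W v w - W u w)\<^sup>2) = expectation Y * (v - u)"
  using indep_var_integrable[OF increment_indep_var[of u v Y "\<lambda>x. x\<^sup>2"]]
    indep_var_lebesgue_integral[OF increment_indep_var[of u v Y "\<lambda>x. x\<^sup>2"]]
    increment_moments[of u v] assms by simp_all

end

section \<open>Doob's maximal inequality in discrete time\<close>

fun running_max :: "(nat \<Rightarrow> real) \<Rightarrow> nat \<Rightarrow> real" where
  "running_max s 0 = \<bar>s 0\<bar>"
| "running_max s (Suc n) = max (running_max s n) \<bar>s (Suc n)\<bar>"

lemma running_max_ge: "i \<le> n \<Longrightarrow> \<bar>s i\<bar> \<le> running_max s n"
  by (induction n) (auto simp: le_Suc_eq)

lemma running_max_nonneg: "0 \<le> running_max s n"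
  using running_max_ge[of 0 n s] by linarith

lemma running_max_cong: "(\<And>i. i \<le> n \<Longrightarrow> s i = r i) \<Longrightarrow> running_max s n = running_max r n"
  by (induction n) auto

text \<open>A crude domination by a finite sum: it makes the squared maximum integrable, so that the
  sharp pathwise bound can be integrated.\<close>

lemma running_max_power2_le: "(running_max s n)\<^sup>2 \<le> (\<Sum>i\<le>n. (s i)\<^sup>2)"
proof (induction n)
  case (Suc n)
  have "(running_max s (Suc n))\<^sup>2 \<le> (running_max s n)\<^sup>2 + (s (Suc n))\<^sup>2"
    by (simp add: max_def)
  with Suc show ?case by simp
qed simp

text \<open>
  The pathwise form of Doob's \<open>L\<^sup>2\<close> inequality: the sum on the right is the transform of \<open>s\<close> by a
  predictable sequence, so it has zero expectation if \<open>s\<close> is a martingale.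
\<close>

lemma running_max_pathwise_doob:
  fixes s :: "nat \<Rightarrow> real"
  assumes "s 0 = 0"
  shows "(running_max s n)\<^sup>2 \<le>
    4 * (s n)\<^sup>2 - 4 * (\<Sum>i<n. running_max s i * sgn (s i) * (s (Suc i) - s i))"
proof -
  let ?S = "\<lambda>n. \<Sum>i<n. running_max s i * sgn (s i) * (s (Suc i) - s i)"
  have "(running_max s n)\<^sup>2 \<le> 2 * (\<bar>s n\<bar> * running_max s n) - 2 * ?S n"
  proof (induction n)
    case 0
    then show ?case using assms by simp
  next
    case (Suc n)
    let ?m = "running_max s n" and ?x = "s n" and ?y = "s (Suc n)"
    \<comment> \<open>\<open>sgn x\<close> is a subgradient of the absolute value at
      \<open>x\<close>.\<close>
    have sg: "sgn ?x * (?y - ?x) \<le> \<bar>?y\<bar> - \<bar>?x\<bar>"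
      by (cases "?x" "0::real" rule: linorder_cases) auto
    have tr: "?m * sgn ?x * (?y - ?x) \<le> ?m * (\<bar>?y\<bar> - \<bar>?x\<bar>)"
      using mult_left_mono[OF sg running_max_nonneg[of s n]] by (simp add: mult.assoc)
    \<comment> \<open>The maximum grows only when the new value attains it, and then the claim is
      \<open>0 \<le> (\<bar>y\<bar> - m)^2\<close>.\<close>
    have mx: "(max ?m \<bar>?y\<bar>)\<^sup>2 - ?m\<^sup>2 \<le> 2 * (\<bar>?y\<bar> * (max ?m \<bar>?y\<bar> - ?m))"
    proof (cases "\<bar>?y\<bar> \<le> ?m")
      case False
      then have m: "max ?m \<bar>?y\<bar> = \<bar>?y\<bar>" by simp
      have "0 \<le> (\<bar>?y\<bar> - ?m)\<^sup>2" by simp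
      then show ?thesis unfolding m by (simp add: power2_eq_square algebra_simps)
    qed simp
    have "2 * (\<bar>?y\<bar> * max ?m \<bar>?y\<bar>) - 2 * ?S (Suc n) \<ge>
       2 * (\<bar>?y\<bar> * max ?m \<bar>?y\<bar>) - 2 * ?S n - 2 * (?m * (\<bar>?y\<bar> - \<bar>?x\<bar>))"
      using tr by simp
    with Suc mx show ?case by (simp add: algebra_simps)
  qed
  \<comment> \<open>Young's inequality in the form 2 a m \<le> 2 a^2 + m^2 / 2; absorbing half of
    m^2 on the left produces Doob's constant 4.\<close>
  moreover have "2 * (\<bar>s n\<bar> * running_max s n) \<le> 2 * (s n)\<^sup>2 + (running_max s n)\<^sup>2 / 2"
    using sum_squares_bound[of "2 * \<bar>s n\<bar>" "running_max s n"] by (simp add: power_mult_distrib)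
  ultimately show ?thesis by simp
qed

context brownian_setting
begin

text \<open>The pathwise bound is integrated. Orthogonality of the increments turns the second
  moment of \<open>S n\<close> into the expected energy, and each correction term is a weight known
  at \<open>q i\<close> times a later increment, hence has mean zero. Boundedness of the
  \<open>\<eta> j\<close> supplies all integrability.\<close>

lemma discrete_doob:
  fixes q :: "nat \<Rightarrow> real" and \<eta> :: "nat \<Rightarrow> 'a \<Rightarrow> real"
  assumes q0: "0 \<le> q 0" and q: "\<And>j. j < n \<Longrightarrow> q j < q (Suc j)"
    and \<eta>: "\<And>j. j < n \<Longrightarrow> \<eta> j \<in> borel_measurable (F (q j))"
    and bdd: "\<And>j w. j < n \<Longrightarrow> w \<in> space M \<Longrightarrow> \<bar>\<eta> j w\<bar> \<le> c j"
  defines "S \<equiv> \<lambda>j w. \<Sum>i<j. \<eta> i w * (W (q (Suc i)) w - W (q i) w)"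
  shows "integrable M (\<lambda>w. (running_max (\<lambda>j. S j w) n)\<^sup>2)"
    and "expectation (\<lambda>w. (running_max (\<lambda>j. S j w) n)\<^sup>2)
      \<le> 4 * expectation (\<lambda>w. \<Sum>i<n. (\<eta> i w)\<^sup>2 * (q (Suc i) - q i))"
proof -
  let ?D = "\<lambda>j w. W (q (Suc j)) w - W (q j) w"
  have qpos: "0 \<le> q j" if "j \<le> n" for j
    using that
  proof (induction j)
    case (Suc j)
    then show ?case using q[of j] by simp
  qed (use q0 in simp)
  have int_\<eta>2: "integrable M (\<lambda>w. (\<eta> j w)\<^sup>2)" if "j < n" for j
  proof (rule integrable_const_bound[of _ "(c j)\<^sup>2"])
    show "AE x in M. norm ((\<eta> j x)\<^sup>2) \<le> (c j)\<^sup>2"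
    proof (rule AE_I2)
      fix x assume "x \<in> space M"
      then show "norm ((\<eta> j x)\<^sup>2) \<le> (c j)\<^sup>2"
        using power_mono[OF bdd[OF that] abs_ge_zero, of x 2] by simp
    qed
      show "(\<lambda>w. (\<eta> j w)\<^sup>2) \<in> borel_measurable M"
      using measurable_F_M[OF \<eta>[OF that]] by simp
  qed
  have SD: "S (Suc j) w = S j w + \<eta> j w * ?D j w" for j w
    by (simp add: S_def)
  have S: "S j \<in> borel_measurable (F (q j)) \<and> integrable M (\<lambda>w. (S j w)\<^sup>2) \<and>
      expectation (\<lambda>w. (S j w)\<^sup>2) = expectation (\<lambda>w. \<Sum>i<j. (\<eta> i w)\<^sup>2 * (q (Suc i) - q i))" if "j \<le> n" for j
    using that
  proof (induction j)
    case 0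
    then show ?case by (simp add: S_def)
  next
    case (Suc j)
    then have j: "j < n" and jle: "j \<le> n" by auto
    note IH = Suc.IH[OF jle]
    have S1: "S (Suc j) \<in> borel_measurable (F (q (Suc j)))"
    proof -
      have le: "q j \<le> q (Suc j)" using q[OF j] by simp
      have "S j \<in> borel_measurable (F (q j))" using IH by simp
      note [measurable] = measurable_F_mono[OF this le] measurable_F_mono[OF \<eta>[OF j] le]
        measurable_F_mono[OF W_measurable[OF qpos[OF jle]] le] W_measurable[OF qpos[OF Suc.prems]]
      show ?thesis unfolding SD by measurable
    qed
    have int_S\<eta>: "integrable M (\<lambda>w. S j w * \<eta> j w)"
    proof (rule Bochner_Integration.integrable_bound[of _ "\<lambda>w. (S j w)\<^sup>2 + (\<eta> j w)\<^sup>2"])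
      show "(\<lambda>w. S j w * \<eta> j w) \<in> borel_measurable M"
        using IH \<eta>[OF j] measurable_F_M by (intro borel_measurable_times) auto
      show "AE x in M. norm (S j x * \<eta> j x) \<le> norm ((S j x)\<^sup>2 + (\<eta> j x)\<^sup>2)"
      proof (rule AE_I2)
        fix x
        have "2 * (\<bar>S j x\<bar> * \<bar>\<eta> j x\<bar>) \<le> (S j x)\<^sup>2 + (\<eta> j x)\<^sup>2"
          using sum_squares_bound[of "\<bar>S j x\<bar>" "\<bar>\<eta> j x\<bar>"] by simp
        moreover have "0 \<le> \<bar>S j x\<bar> * \<bar>\<eta> j x\<bar>" by simp
        ultimately show "norm (S j x * \<eta> j x) \<le> norm ((S j x)\<^sup>2 + (\<eta> j x)\<^sup>2)"
          unfolding real_norm_def abs_mult by linarith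
      qed
    qed (use IH int_\<eta>2[OF j] in auto)
    have m1: "(\<lambda>w. S j w * \<eta> j w) \<in> borel_measurable (F (q j))" and m2: "(\<lambda>w. (\<eta> j w)\<^sup>2) \<in> borel_measurable (F (q j))"
      using IH \<eta>[OF j] by auto
    note O = increment_orthogonal[OF qpos[OF jle] q[OF j] m1 int_S\<eta>]
    note V = increment_variance[OF qpos[OF jle] q[OF j] m2 int_\<eta>2[OF j]]
    have eq: "(S (Suc j) w)\<^sup>2 = (S j w)\<^sup>2 + 2 * (S j w * \<eta> j w * ?D j w) + (\<eta> j w)\<^sup>2 * (?D j w)\<^sup>2" for w
      unfolding SD by (simp add: power2_eq_square algebra_simps)
    have "integrable M (\<lambda>w. (S (Suc j) w)\<^sup>2)"
      unfolding eq using IH O V by auto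
    moreover have "expectation (\<lambda>w. (S (Suc j) w)\<^sup>2) =
        expectation (\<lambda>w. (S j w)\<^sup>2) + expectation (\<lambda>w. (\<eta> j w)\<^sup>2) * (q (Suc j) - q j)"
      unfolding eq using IH O V by simp
    moreover have "integrable M (\<lambda>w. \<Sum>i<j. (\<eta> i w)\<^sup>2 * (q (Suc i) - q i))"
      using j by (intro Bochner_Integration.integrable_sum integrable_mult_left int_\<eta>2) auto
    ultimately show ?case using S1 IH int_\<eta>2[OF j] by simp
  qed
  let ?m = "\<lambda>j w. running_max (\<lambda>j. S j w) j"
  have m_meas: "?m j \<in> borel_measurable (F (q j))" if "j \<le> n" for j
    using that
  proof (induction j)
    case 0
    then show ?case by (simp add: S_def)
  next
    case (Suc j)
    then have "q j \<le> q (Suc j)" "?m j \<in> borel_measurable (F (q j))" using q[of j] by auto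
    then have [measurable]: "?m j \<in> borel_measurable (F (q (Suc j)))"
      by (blast intro: measurable_F_mono)
    have [measurable]: "S (Suc j) \<in> borel_measurable (F (q (Suc j)))"
      using S[OF Suc.prems] by blast
    show ?case by simp
  qed
  have m_int: "integrable M (\<lambda>w. (?m j w)\<^sup>2)" if "j \<le> n" for j
  proof (rule Bochner_Integration.integrable_bound[of _ "\<lambda>w. \<Sum>i\<le>j. (S i w)\<^sup>2"])
    show "integrable M (\<lambda>w. \<Sum>i\<le>j. (S i w)\<^sup>2)"
      using S that by (intro Bochner_Integration.integrable_sum) auto
    show "(\<lambda>w. (?m j w)\<^sup>2) \<in> borel_measurable M"
      using measurable_F_M[OF m_meas[OF that]] by simp
    show "AE x in M. norm ((?m j x)\<^sup>2) \<le> norm (\<Sum>i\<le>j. (S i x)\<^sup>2)"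
      using order_trans[OF running_max_power2_le abs_ge_self] by (intro AE_I2) simp
  qed
  then show "integrable M (\<lambda>w. (?m n w)\<^sup>2)" by simp
  \<comment> \<open>The full weight is the running maximum times the sign times
    \<open>\<eta> i\<close>; it is integrable because the product of two square integrable factors
    is dominated by the sum of their squares.\<close>
  have tr: "integrable M (\<lambda>w. ?m i w * sgn (S i w) * (S (Suc i) w - S i w)) \<and>
      expectation (\<lambda>w. ?m i w * sgn (S i w) * (S (Suc i) w - S i w)) = 0" if i: "i < n" for i
  proof -
    let ?Y = "\<lambda>w. ?m i w * sgn (S i w) * \<eta> i w"
    have Ym: "?Y \<in> borel_measurable (F (q i))"
      using m_meas[of i] S[of i] \<eta>[OF i] i by auto
    have "integrable M ?Y"
    proof (rule Bochner_Integration.integrable_bound[of _ "\<lambda>w. (?m i w)\<^sup>2 + (\<eta> i w)\<^sup>2"])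
      show "AE x in M. norm (?Y x) \<le> norm ((?m i x)\<^sup>2 + (\<eta> i x)\<^sup>2)"
      proof (rule AE_I2)
        fix x
        have "2 * (\<bar>?m i x\<bar> * \<bar>\<eta> i x\<bar>) \<le> (?m i x)\<^sup>2 + (\<eta> i x)\<^sup>2"
          using sum_squares_bound[of "\<bar>?m i x\<bar>" "\<bar>\<eta> i x\<bar>"] by simp
        moreover have "0 \<le> \<bar>?m i x\<bar> * \<bar>\<eta> i x\<bar>" by simp
        moreover have "\<bar>?m i x\<bar> * \<bar>sgn (S i x)\<bar> * \<bar>\<eta> i x\<bar> \<le> \<bar>?m i x\<bar> * \<bar>\<eta> i x\<bar>"
          by (auto simp: abs_sgn_eq)
        ultimately show "norm (?Y x) \<le> norm ((?m i x)\<^sup>2 + (\<eta> i x)\<^sup>2)"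
          unfolding real_norm_def abs_mult by linarith
      qed
      show "?Y \<in> borel_measurable M" using measurable_F_M[OF Ym] .
    qed (use m_int[of i] int_\<eta>2[OF i] i in auto)
    from increment_orthogonal[OF qpos q[OF i] Ym this] i
    show ?thesis by (simp add: SD mult_ac)
  qed
  have "expectation (\<lambda>w. (?m n w)\<^sup>2) \<le> expectation (\<lambda>w. 4 * (S n w)\<^sup>2 -
      4 * (\<Sum>i<n. ?m i w * sgn (S i w) * (S (Suc i) w - S i w)))"
  proof (rule integral_mono)
    show "integrable M (\<lambda>w. 4 * (S n w)\<^sup>2 -
      4 * (\<Sum>i<n. ?m i w * sgn (S i w) * (S (Suc i) w - S i w)))"
      using S[of n] tr by (intro Bochner_Integration.integrable_diff integrable_mult_right Bochner_Integration.integrable_sum) auto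
    show "(?m n w)\<^sup>2 \<le> 4 * (S n w)\<^sup>2 -
      4 * (\<Sum>i<n. ?m i w * sgn (S i w) * (S (Suc i) w - S i w))" for w
      by (rule running_max_pathwise_doob) (simp add: S_def)
  qed (use m_int[of n] in simp)
  also have "\<dots> = 4 * expectation (\<lambda>w. (S n w)\<^sup>2)"
    using S[of n] tr by (subst Bochner_Integration.integral_diff)
      (auto intro!: integrable_mult_right Bochner_Integration.integrable_sum simp: Bochner_Integration.integral_sum)
  finally show "expectation (\<lambda>w. (?m n w)\<^sup>2)
      \<le> 4 * expectation (\<lambda>w. \<Sum>i<n. (\<eta> i w)\<^sup>2 * (q (Suc i) - q i))"
    using S[of n] by simp
qed

text \<open>Truncating the integrand predictably makes the inequality usable without any integrability.\<close>

lemma discrete_doob_truncated: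
  fixes q :: "nat \<Rightarrow> real" and \<eta> :: "nat \<Rightarrow> 'a \<Rightarrow> real"
  assumes q0: "0 \<le> q 0" and q: "\<And>j. j < n \<Longrightarrow> q j < q (Suc j)"
    and \<eta>: "\<And>j. j < n \<Longrightarrow> \<eta> j \<in> borel_measurable (F (q j))"
    and bdd: "\<And>j w. j < n \<Longrightarrow> w \<in> space M \<Longrightarrow> \<bar>\<eta> j w\<bar> \<le> c j"
    and C: "0 \<le> C"
  defines "S \<equiv> \<lambda>j w. \<Sum>i<j. \<eta> i w * (W (q (Suc i)) w - W (q i) w)"
    and "N \<equiv> \<lambda>w. \<Sum>i<n. (\<eta> i w)\<^sup>2 * (q (Suc i) - q i)"
  shows "(\<integral>\<^sup>+w. ennreal ((running_max (\<lambda>j. S j w) n)\<^sup>2) * indicator {w. N w \<le> C} w \<partial>M)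
      \<le> 4 * (\<integral>\<^sup>+w. ennreal (min C (N w)) \<partial>M)"
proof -
  define N' where "N' j w = (\<Sum>i<j. (\<eta> i w)\<^sup>2 * (q (Suc i) - q i))" for j w
  \<comment> \<open>The test includes the energy of the current interval, hence the index
    \<open>Suc j\<close>. It is still known at time \<open>q j\<close>, since only
    \<open>\<eta> i\<close> with \<open>i \<le> j\<close> enter. So the truncated energy never
    exceeds \<open>C\<close>, and nothing is cut where the total energy is at most
    \<open>C\<close>.\<close>
  define \<eta>' where "\<eta>' j w = (if N' (Suc j) w \<le> C then \<eta> j w else 0)" for j w
  let ?S' = "\<lambda>j w. \<Sum>i<j. \<eta>' i w * (W (q (Suc i)) w - W (q i) w)"
  let ?N'' = "\<lambda>w. \<Sum>i<n. (\<eta>' i w)\<^sup>2 * (q (Suc i) - q i)"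
  have qmono: "q i \<le> q j" if "i \<le> j" "j \<le> n" for i j
    using that
  proof (induction j)
    case (Suc j)
    then show ?case using q[of j] by (cases "i = Suc j") auto
  qed simp
  have dq: "0 \<le> q (Suc i) - q i" if "i < n" for i
    using q[OF that] by simp
  have N'_mono: "N' i w \<le> N' j w" if "i \<le> j" "j \<le> n" for i j w
    unfolding N'_def using that dq by (intro sum_mono2 mult_nonneg_nonneg) auto
  have N'm: "N' (Suc j) \<in> borel_measurable (F (q j))" if "j < n" for j
    unfolding N'_def
    using that by (intro borel_measurable_sum borel_measurable_times borel_measurable_power measurable_F_mono[OF \<eta>] qmono) auto
  have \<eta>'m: "\<eta>' j \<in> borel_measurable (F (q j))" if "j < n" for j
  proof -
    note [measurable] = N'm[OF that] \<eta>[OF that]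
    show ?thesis unfolding \<eta>'_def by measurable
  qed
  have bdd': "\<bar>\<eta>' j w\<bar> \<le> c j" if "j < n" "w \<in> space M" for j w
    using bdd[OF that] by (auto simp: \<eta>'_def)
  note D = discrete_doob[OF q0 q \<eta>'m bdd']
  have N''_le: "?N'' w \<le> min C (N w)" for w
  proof -
    have "(\<Sum>i<j. (\<eta>' i w)\<^sup>2 * (q (Suc i) - q i)) \<le> min C (N' j w)" if "j \<le> n" for j
      using that
    proof (induction j)
      case 0
      then show ?case using C by (simp add: N'_def)
    next
      case (Suc j)
      have S: "N' (Suc j) w = N' j w + (\<eta> j w)\<^sup>2 * (q (Suc j) - q j)" by (simp add: N'_def)
      show ?case using Suc N'_mono[of j "Suc j" w] by (auto simp: \<eta>'_def S)
    qed
    from this[of n] show ?thesis by (simp add: N_def N'_def)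
  qed
  have eq: "running_max (\<lambda>j. S j w) n = running_max (\<lambda>j. ?S' j w) n" if "N w \<le> C" for w
  proof (rule running_max_cong)
    fix j assume j: "j \<le> n"
    have "\<eta>' i w = \<eta> i w" if "i < j" for i
      using N'_mono[of "Suc i" n w] that j \<open>N w \<le> C\<close> by (auto simp: \<eta>'_def N_def N'_def[of n])
    then show "S j w = ?S' j w" unfolding S_def by (intro sum.cong) auto
  qed
  have N''_nonneg: "0 \<le> ?N'' w" for w
    using dq by (intro sum_nonneg mult_nonneg_nonneg) auto
  have N''_meas: "?N'' \<in> borel_measurable M"
    using \<eta>'m[THEN measurable_F_M] by (intro borel_measurable_sum borel_measurable_times) auto
  have N''_int: "integrable M ?N''"
    by (rule integrable_const_bound[of _ C]) (use N''_le N''_nonneg N''_meas in \<open>auto intro!: AE_I2\<close>)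
  have "(\<integral>\<^sup>+w. ennreal ((running_max (\<lambda>j. S j w) n)\<^sup>2) * indicator {w. N w \<le> C} w \<partial>M)
      \<le> (\<integral>\<^sup>+w. ennreal ((running_max (\<lambda>j. ?S' j w) n)\<^sup>2) \<partial>M)"
    by (intro nn_integral_mono) (auto simp: indicator_def eq)
  also have "\<dots> = ennreal (expectation (\<lambda>w. (running_max (\<lambda>j. ?S' j w) n)\<^sup>2))"
    using D(1) by (intro nn_integral_eq_integral) auto
  also have "\<dots> \<le> ennreal (4 * expectation ?N'')"
    using D(2) by (intro ennreal_leI) auto
  also have "\<dots> = 4 * (\<integral>\<^sup>+w. ennreal (?N'' w) \<partial>M)"
    using N''_int N''_nonneg by (subst nn_integral_eq_integral) (auto simp: ennreal_mult)
  also have "\<dots> \<le> 4 * (\<integral>\<^sup>+w. ennreal (min C (N w)) \<partial>M)"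
    using N''_le by (intro mult_left_mono nn_integral_mono ennreal_leI) auto
  finally show ?thesis .
qed

end

section \<open>Elementary integrals\<close>

text \<open>A value above the supremum over the rationals would persist on a small interval to the
  right and so be met by a rational. The endpoint \<open>b\<close> has no such interval inside
  \<open>{a..b}\<close> and is therefore adjoined. This makes running suprema measurable without
  completing the filtration.\<close>

lemma SUP_right_continuous_eq:
  fixes f :: "real \<Rightarrow> ennreal"
  assumes rc: "\<And>s. a \<le> s \<Longrightarrow> s < b \<Longrightarrow> (f \<longlongrightarrow> f s) (at_right s)"
  shows "(SUP s\<in>{a..b}. f s) = (SUP s\<in>{a..b} \<inter> insert b \<rat>. f s)"
proof (rule antisym)
  let ?c = "SUP s\<in>{a..b} \<inter> insert b \<rat>. f s"
  show "(SUP s\<in>{a..b}. f s) \<le> ?c"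
  proof (rule SUP_least)
    fix s assume s: "s \<in> {a..b}"
    show "f s \<le> ?c"
    proof (cases "s = b")
      case True
      then show ?thesis using s by (intro SUP_upper) auto
    next
      case False
      then have "s < b" using s by auto
      show ?thesis
      proof (rule ccontr)
        assume "\<not> f s \<le> ?c"
        then have "eventually (\<lambda>r. ?c < f r) (at_right s)"
          using order_tendstoD(1)[OF rc[OF _ \<open>s < b\<close>], of ?c] s by (simp add: not_le)
        then obtain d where d: "s < d" "\<And>r. s < r \<Longrightarrow> r < d \<Longrightarrow> ?c < f r"
          unfolding eventually_at_right[OF \<open>s < b\<close>] by blast
        obtain r where r: "r \<in> \<rat>" "s < r" "r < min d b"
          using Rats_dense_in_real[of s "min d b"] d(1) \<open>s < b\<close> by auto
        have "f r \<le> ?c" using r s by (intro SUP_upper) auto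
        with d(2)[of r] r show False by auto
      qed
    qed
  qed
qed (auto intro!: SUP_subset_mono)

lemma borel_measurable_SUP_right_continuous:
  fixes Z :: "real \<Rightarrow> 'a \<Rightarrow> ennreal"
  assumes "\<And>s. a \<le> s \<Longrightarrow> s \<le> b \<Longrightarrow> Z s \<in> borel_measurable N"
    and "\<And>w s. w \<in> space N \<Longrightarrow> a \<le> s \<Longrightarrow> s < b \<Longrightarrow> ((\<lambda>s. Z s w) \<longlongrightarrow> Z s w) (at_right s)"
  shows "(\<lambda>w. SUP s\<in>{a..b}. Z s w) \<in> borel_measurable N"
proof -
  have "(\<lambda>w. SUP s\<in>{a..b} \<inter> insert b \<rat>. Z s w) \<in> borel_measurable N"
    using assms(1) by (intro borel_measurable_SUP) (auto intro: countable_rat)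
  then show ?thesis
    by (subst measurable_cong[OF SUP_right_continuous_eq]) (use assms in auto)
qed

lemma continuous_on_imp_tendsto_at_right:
  fixes f :: "real \<Rightarrow> real"
  assumes "continuous_on {a..} f" "a \<le> s"
  shows "(f \<longlongrightarrow> f s) (at_right s)"
proof -
  have "(f \<longlongrightarrow> f s) (at s within {a..})" using assms by (auto simp: continuous_on_def)
  then show ?thesis by (rule tendsto_within_subset) (use assms in auto)
qed

section \<open>Step integrands, their energies and running suprema\<close>

context brownian_setting
begin

abbreviation jointly_measurable :: "(real \<Rightarrow> 'a \<Rightarrow> real) \<Rightarrow> bool" where
  "jointly_measurable H \<equiv> (\<lambda>(s, w). H s w) \<in> borel_measurable (borel \<Otimes>\<^sub>M M)"

abbreviation step_by where
  "step_by \<eta> c u v H S \<equiv> \<eta> \<in> borel_measurable (F u) \<and> (\<forall>w\<in>space M. \<bar>\<eta> w\<bar> \<le> (c :: real)) \<and>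
    (\<forall>w\<in>space M. (\<forall>s\<in>{u<..v}. H s w = \<eta> w) \<and> S v w - S u w = \<eta> w * (W v w - W u w))"

text \<open>
  \<open>H\<close> is a step integrand with jumps in the finite set \<open>P\<close> only, and \<open>S\<close> is its stochastic
  integral. Quantifying over all intervals without interior points in \<open>P\<close> makes the notion
  monotone in \<open>P\<close>, so that differences need no common refinement.
\<close>

definition elementary :: "real set \<Rightarrow> (real \<Rightarrow> 'a \<Rightarrow> real) \<Rightarrow> (real \<Rightarrow> 'a \<Rightarrow> real) \<Rightarrow> bool" where
  "elementary P H S \<longleftrightarrow> finite P \<and> jointly_measurable H \<and>
    (\<forall>s\<ge>0. S s \<in> borel_measurable M) \<and>
    (\<forall>w\<in>space M. S 0 w = 0 \<and> continuous_on {0..} (\<lambda>s. S s w)) \<and>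
    (\<forall>u v. 0 \<le> u \<and> u < v \<and> P \<inter> {u<..<v} = {} \<longrightarrow>
      (\<exists>\<eta> c. step_by \<eta> c u v H S))"

abbreviation energy :: "(real \<Rightarrow> 'a \<Rightarrow> real) \<Rightarrow> real \<Rightarrow> 'a \<Rightarrow> ennreal" where
  "energy H T w \<equiv> \<integral>\<^sup>+s\<in>{0..T}. ennreal ((H s w)\<^sup>2) \<partial>lborel"

abbreviation sup_sq :: "(real \<Rightarrow> 'a \<Rightarrow> real) \<Rightarrow> real \<Rightarrow> 'a \<Rightarrow> ennreal" where
  "sup_sq Z T w \<equiv> SUP s\<in>{0..T}. ennreal ((Z s w)\<^sup>2)"

abbreviation expected_energy :: "(real \<Rightarrow> 'a \<Rightarrow> real) \<Rightarrow> real \<Rightarrow> ennreal" where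
  "expected_energy H T \<equiv> \<integral>\<^sup>+w. energy H T w \<partial>M"

abbreviation expected_sup :: "(real \<Rightarrow> 'a \<Rightarrow> real) \<Rightarrow> real \<Rightarrow> ennreal" where
  "expected_sup Z T \<equiv> \<integral>\<^sup>+w. sup_sq Z T w \<partial>M"

lemma path_measurable:
  assumes "jointly_measurable H" "w \<in> space M"
  shows "(\<lambda>s. H s w) \<in> borel_measurable borel"
  using measurable_compose[OF measurable_Pair2'[OF assms(2), of borel] assms(1)] by simp

lemma energy_measurable:
  assumes "(\<lambda>(s, w). H s w :: real) \<in> borel_measurable (borel \<Otimes>\<^sub>M M)"
  shows "energy H T \<in> borel_measurable M"
proof -
  have [measurable]: "(\<lambda>(w, s). H s w) \<in> borel_measurable (M \<Otimes>\<^sub>M lborel)"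
    using measurable_pair_swap[OF assms] by (simp add: case_prod_beta)
  show ?thesis by measurable
qed

lemma sup_sq_measurable:
  assumes "\<And>s. 0 \<le> s \<Longrightarrow> Z s \<in> borel_measurable M"
    "\<And>w. w \<in> space M \<Longrightarrow> continuous_on {0..} (\<lambda>s. Z s w)"
  shows "sup_sq Z T \<in> borel_measurable M"
  by (rule borel_measurable_SUP_right_continuous)
    (use assms in \<open>auto intro!: tendsto_ennrealI tendsto_power continuous_on_imp_tendsto_at_right\<close>)

text \<open>Once the grid contains the jump points, the integrand is constant on each cell, so the
  energy is exactly the discrete bracket and the truncated discrete inequality applies.\<close>

lemma elementary_grid_doob:
  assumes el: "elementary P H S" and Q: "finite Q" "{0, T} \<subseteq> Q" "Q \<subseteq> {0..T}" "P \<inter> {0..T} \<subseteq> Q"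
    and C: "0 \<le> C"
  shows "(\<integral>\<^sup>+w. (SUP s\<in>Q. ennreal ((S s w)\<^sup>2)) * indicator {w. energy H T w \<le> ennreal C} w \<partial>M)
    \<le> 4 * (\<integral>\<^sup>+w. min (ennreal C) (energy H T w) \<partial>M)"
proof -
  define n where "n = card Q - 1"
  define q where "q j = sorted_list_of_set Q ! j" for j
  have "card Q > 0" using Q by (auto simp: card_gt_0_iff)
  then have cQ: "card Q = Suc n" by (simp add: n_def)
  have len: "length (sorted_list_of_set Q) = Suc n" using cQ by simp
  have q_less: "q i < q j" if "i < j" "j \<le> n" for i j
    using that len sorted_wrt_nth_less[OF strict_sorted_list_of_set[of Q], of i j] by (auto simp: q_def)
  have q_in: "q j \<in> Q" if "j \<le> n" for j
    using nth_mem[of j "sorted_list_of_set Q"] that len Q(1) by (simp add: q_def)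
  have q_ex: "\<exists>j\<le>n. q j = s" if "s \<in> Q" for s
    using that Q(1) len in_set_conv_nth[of s "sorted_list_of_set Q"] by (auto simp: q_def less_Suc_eq_le)
  have q_le_iff: "q i \<le> q j \<longleftrightarrow> i \<le> j" if "i \<le> n" "j \<le> n" for i j
    using q_less[of i j] q_less[of j i] that by (cases i j rule: linorder_cases) auto
  have q0: "q 0 = 0"
  proof -
    obtain j where j: "j \<le> n" "q j = 0" using q_ex[of 0] Q by auto
    then have "q 0 \<le> 0" using q_le_iff[of 0 j] by auto
    then show ?thesis using q_in[of 0] Q by auto
  qed
  have qn: "q n = T"
  proof -
    obtain j where j: "j \<le> n" "q j = T" using q_ex[of T] Q by auto
    then have "T \<le> q n" using q_le_iff[of j n] by auto
    then show ?thesis using q_in[of n] Q by auto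
  qed
  \<comment> \<open>A jump point strictly between neighbours would itself be a grid point,
    contradicting the sorted enumeration.\<close>
  have gap: "P \<inter> {q j<..<q (Suc j)} = {}" if "j < n" for j
  proof -
    have False if "x \<in> P" "q j < x" "x < q (Suc j)" for x
    proof -
      have "x \<in> {0..T}" using q_in[of j] q_in[of "Suc j"] \<open>j < n\<close> that Q by fastforce
      then have "x \<in> Q" using Q that by auto
      then obtain i where i: "i \<le> n" "q i = x" using q_ex[of x] by auto
      then show False using q_le_iff[of i j] q_le_iff[of "Suc j" i] that \<open>j < n\<close> by auto
    qed
    then show ?thesis by auto
  qed
  have q_nonneg: "0 \<le> q j" if "j \<le> n" for j using q_in[OF that] Q by auto
  have "\<forall>j. \<exists>\<eta> c. j < n \<longrightarrow> \<eta> \<in> borel_measurable (F (q j)) \<and> (\<forall>w\<in>space M. \<bar>\<eta> w\<bar> \<le> c) \<and>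
        (\<forall>w\<in>space M. (\<forall>s\<in>{q j<..q (Suc j)}. H s w = \<eta> w) \<and>
          S (q (Suc j)) w - S (q j) w = \<eta> w * (W (q (Suc j)) w - W (q j) w))"
  proof
    fix j
    have "0 \<le> q j \<and> q j < q (Suc j) \<and> P \<inter> {q j<..<q (Suc j)} = {}" if "j < n"
      using q_nonneg[of j] q_less[of j "Suc j"] gap[OF that] that by simp
    with el show "\<exists>\<eta> c. j < n \<longrightarrow> \<eta> \<in> borel_measurable (F (q j)) \<and> (\<forall>w\<in>space M. \<bar>\<eta> w\<bar> \<le> c) \<and>
        (\<forall>w\<in>space M. (\<forall>s\<in>{q j<..q (Suc j)}. H s w = \<eta> w) \<and>
          S (q (Suc j)) w - S (q j) w = \<eta> w * (W (q (Suc j)) w - W (q j) w))"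
      unfolding elementary_def by blast
  qed
  then obtain \<eta> c where \<eta>c: "\<And>j. j < n \<Longrightarrow> \<eta> j \<in> borel_measurable (F (q j)) \<and>
        (\<forall>w\<in>space M. \<bar>\<eta> j w\<bar> \<le> c j) \<and>
        (\<forall>w\<in>space M. (\<forall>s\<in>{q j<..q (Suc j)}. H s w = \<eta> j w) \<and>
          S (q (Suc j)) w - S (q j) w = \<eta> j w * (W (q (Suc j)) w - W (q j) w))"
    unfolding choice_iff by blast
  have \<eta>: "\<eta> j \<in> borel_measurable (F (q j))" if "j < n" for j
    using \<eta>c[OF that] by blast
  have bdd: "\<bar>\<eta> j w\<bar> \<le> c j" if "j < n" "w \<in> space M" for j w
    using \<eta>c[OF that(1)] that(2) by blast
  have H\<eta>: "H s w = \<eta> j w" if "j < n" "w \<in> space M" "q j < s" "s \<le> q (Suc j)" for j w s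
    using \<eta>c[OF that(1)] that(2-) by simp
  have S\<eta>: "S (q (Suc j)) w = S (q j) w + \<eta> j w * (W (q (Suc j)) w - W (q j) w)"
    if "j < n" "w \<in> space M" for j w
  proof -
    have "S (q (Suc j)) w - S (q j) w = \<eta> j w * (W (q (Suc j)) w - W (q j) w)"
      using \<eta>c[OF that(1)] that(2) by blast
    then show ?thesis by linarith
  qed
  have Hm: "jointly_measurable H" using el by (simp add: elementary_def)
  have S_eq: "S (q j) w = (\<Sum>i<j. \<eta> i w * (W (q (Suc i)) w - W (q i) w))" if "j \<le> n" "w \<in> space M" for j w
    using that(1)
  proof (induction j)
    case 0
    then show ?case using el that(2) by (simp add: q0 elementary_def)
  next
    case (Suc j)
    then show ?case using S\<eta>[of j w] that(2) by simp
  qed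
  have N_eq: "energy H T w = ennreal (\<Sum>i<n. (\<eta> i w)\<^sup>2 * (q (Suc i) - q i))" if w: "w \<in> space M" for w
  proof -
    note [measurable] = path_measurable[OF Hm w]
    have "energy H (q j) w = ennreal (\<Sum>i<j. (\<eta> i w)\<^sup>2 * (q (Suc i) - q i))" if "j \<le> n" for j
      using that
    proof (induction j)
      case 0
      have "energy H (q 0) w = (\<integral>\<^sup>+s\<in>{0}. ennreal ((H s w)\<^sup>2) \<partial>lborel)" by (simp add: q0)
      also have "\<dots> = (\<integral>\<^sup>+s. ennreal ((H 0 w)\<^sup>2) * indicator {0::real} s \<partial>lborel)"
        by (intro nn_integral_cong) (auto simp: indicator_def)
      also have "\<dots> = 0" by (subst nn_integral_cmult_indicator) auto
      finally show ?case by simp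
    next
      case (Suc j)
      have j: "0 \<le> q j" "q j \<le> q (Suc j)" using q_nonneg[of j] q_less[of j "Suc j"] Suc.prems by auto
      have "energy H (q (Suc j)) w = (\<integral>\<^sup>+s. ennreal ((H s w)\<^sup>2) * indicator {0..q j} s
          + ennreal ((H s w)\<^sup>2) * indicator {q j<..q (Suc j)} s \<partial>lborel)"
        using j by (intro nn_integral_cong) (auto simp: indicator_def)
      also have "\<dots> = energy H (q j) w + (\<integral>\<^sup>+s. ennreal ((H s w)\<^sup>2) * indicator {q j<..q (Suc j)} s \<partial>lborel)"
        by (rule nn_integral_add) measurable
      also have "(\<integral>\<^sup>+s. ennreal ((H s w)\<^sup>2) * indicator {q j<..q (Suc j)} s \<partial>lborel)
         = (\<integral>\<^sup>+s. ennreal ((\<eta> j w)\<^sup>2) * indicator {q j<..q (Suc j)} s \<partial>lborel)"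
        using H\<eta>[of j w] Suc.prems w by (intro nn_integral_cong) (auto simp: indicator_def)
      also have "\<dots> = ennreal ((\<eta> j w)\<^sup>2 * (q (Suc j) - q j))"
        using j by (subst nn_integral_cmult_indicator) (auto simp: ennreal_mult)
      finally show ?case
        using Suc q_less[of _ "Suc _"] j
        by (simp add: Suc_le_eq) (subst ennreal_plus, auto intro!: sum_nonneg mult_nonneg_nonneg simp: less_imp_le)
    qed
    from this[of n] show ?thesis by (simp add: qn)
  qed
  let ?S = "\<lambda>j w. \<Sum>i<j. \<eta> i w * (W (q (Suc i)) w - W (q i) w)"
  let ?N = "\<lambda>w. \<Sum>i<n. (\<eta> i w)\<^sup>2 * (q (Suc i) - q i)"
  have "(\<integral>\<^sup>+w. (SUP s\<in>Q. ennreal ((S s w)\<^sup>2)) * indicator {w. energy H T w \<le> ennreal C} w \<partial>M)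
    \<le> (\<integral>\<^sup>+w. ennreal ((running_max (\<lambda>j. ?S j w) n)\<^sup>2) * indicator {w. ?N w \<le> C} w \<partial>M)"
  proof (rule nn_integral_mono)
    fix w assume w: "w \<in> space M"
    have "(SUP s\<in>Q. ennreal ((S s w)\<^sup>2)) \<le> ennreal ((running_max (\<lambda>j. ?S j w) n)\<^sup>2)"
    proof (rule SUP_least)
      fix s assume "s \<in> Q"
      then obtain j where j: "j \<le> n" "q j = s" using q_ex by blast
      have "\<bar>S s w\<bar> \<le> running_max (\<lambda>j. ?S j w) n"
        using running_max_ge[OF j(1), of "\<lambda>j. ?S j w"] S_eq[OF j(1) w] j(2) by simp
      from power_mono[OF this abs_ge_zero, of 2]
      show "ennreal ((S s w)\<^sup>2) \<le> ennreal ((running_max (\<lambda>j. ?S j w) n)\<^sup>2)"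
        by (intro ennreal_leI) simp
    qed
    moreover have "energy H T w \<le> ennreal C \<longleftrightarrow> ?N w \<le> C"
      unfolding N_eq[OF w] by (rule ennreal_le_iff[OF C])
    ultimately show "(SUP s\<in>Q. ennreal ((S s w)\<^sup>2)) * indicator {w. energy H T w \<le> ennreal C} w \<le>
      ennreal ((running_max (\<lambda>j. ?S j w) n)\<^sup>2) * indicator {w. ?N w \<le> C} w"
      by (cases "?N w \<le> C") simp_all
  qed
  also have "\<dots> \<le> 4 * (\<integral>\<^sup>+w. ennreal (min C (?N w)) \<partial>M)"
    using q0 by (intro discrete_doob_truncated[OF _ _ \<eta> bdd C]) (auto intro: q_less)
  also have "(\<integral>\<^sup>+w. ennreal (min C (?N w)) \<partial>M) = (\<integral>\<^sup>+w. min (ennreal C) (energy H T w) \<partial>M)"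
    by (intro nn_integral_cong, simp only: N_eq) (auto simp: min_def intro!: antisym ennreal_leI)
  finally show ?thesis .
qed

text \<open>Monotone convergence along finite grids that exhaust a countable dense set; by
  continuity of the paths the suprema over the grids increase to the full supremum, and the
  right-hand side does not depend on the grid.\<close>

lemma elementary_doob:
  assumes el: "elementary P H S" and T: "0 \<le> T" and C: "0 \<le> C"
  shows "(\<integral>\<^sup>+w. sup_sq S T w * indicator {w. energy H T w \<le> ennreal C} w \<partial>M)
    \<le> 4 * (\<integral>\<^sup>+w. min (ennreal C) (energy H T w) \<partial>M)"
proof -
  define D where "D = insert 0 ({0..T} \<inter> insert T \<rat>)"
  have cD: "countable D" "D \<noteq> {}" by (auto simp: D_def intro: countable_rat)
  define Q where "Q n = {0, T} \<union> (P \<inter> {0..T}) \<union> from_nat_into D ` {..n}" for n :: nat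
  have DT: "D \<subseteq> {0..T}" using T by (auto simp: D_def)
  have fin: "finite P" and Sm: "\<And>s. 0 \<le> s \<Longrightarrow> S s \<in> borel_measurable M"
    and Sc: "\<And>w. w \<in> space M \<Longrightarrow> continuous_on {0..} (\<lambda>s. S s w)"
    and Hm: "jointly_measurable H"
    using el by (auto simp: elementary_def)
  have Q: "finite (Q n)" "{0, T} \<subseteq> Q n" "Q n \<subseteq> {0..T}" "P \<inter> {0..T} \<subseteq> Q n" for n
    using fin T DT from_nat_into[OF cD(2)] by (auto simp: Q_def)
  have QD: "D \<subseteq> (\<Union>n. Q n)"
  proof
    fix x assume "x \<in> D"
    then obtain n where "from_nat_into D n = x" using from_nat_into_surj[OF cD(1)] by blast
    then show "x \<in> (\<Union>n. Q n)" by (auto simp: Q_def)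
  qed
  have Qm: "Q m \<subseteq> Q n" if "m \<le> n" for m n using that by (auto simp: Q_def)
  note [measurable] = energy_measurable[OF Hm]
  let ?I = "\<lambda>w. indicator {w\<in>space M. energy H T w \<le> ennreal C} w :: ennreal"
  have SUPm: "(\<lambda>w. SUP s\<in>Q n. ennreal ((S s w)\<^sup>2)) \<in> borel_measurable M" for n
    using Q[of n] Sm by (intro borel_measurable_SUP) (auto intro: countable_finite)
  have eq: "sup_sq S T w = (SUP n. SUP s\<in>Q n. ennreal ((S s w)\<^sup>2))" if w: "w \<in> space M" for w
  proof (rule antisym)
    have "sup_sq S T w = (SUP s\<in>{0..T} \<inter> insert T \<rat>. ennreal ((S s w)\<^sup>2))"
      by (rule SUP_right_continuous_eq)
        (auto intro!: tendsto_ennrealI tendsto_power continuous_on_imp_tendsto_at_right[OF Sc[OF w]])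
    also have "\<dots> \<le> (SUP n. SUP s\<in>Q n. ennreal ((S s w)\<^sup>2))"
    proof (rule SUP_least)
      fix s assume "s \<in> {0..T} \<inter> insert T \<rat>"
      then obtain n where "s \<in> Q n" using QD by (auto simp: D_def)
      then show "ennreal ((S s w)\<^sup>2) \<le> (SUP n. SUP s\<in>Q n. ennreal ((S s w)\<^sup>2))"
        by (intro SUP_upper2[of n] SUP_upper) auto
    qed
    finally show "sup_sq S T w \<le> (SUP n. SUP s\<in>Q n. ennreal ((S s w)\<^sup>2))" .
    show "(SUP n. SUP s\<in>Q n. ennreal ((S s w)\<^sup>2)) \<le> sup_sq S T w"
      using Q(3) by (intro SUP_least SUP_upper) blast
  qed
  have "(\<integral>\<^sup>+w. sup_sq S T w * indicator {w. energy H T w \<le> ennreal C} w \<partial>M) =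
      (\<integral>\<^sup>+w. (SUP n. (SUP s\<in>Q n. ennreal ((S s w)\<^sup>2)) * ?I w) \<partial>M)"
    by (intro nn_integral_cong) (simp only: eq, auto simp: indicator_def)
  also have "\<dots> = (SUP n. \<integral>\<^sup>+w. (SUP s\<in>Q n. ennreal ((S s w)\<^sup>2)) * ?I w \<partial>M)"
  proof (rule nn_integral_monotone_convergence_SUP)
    show "incseq (\<lambda>n w. (SUP s\<in>Q n. ennreal ((S s w)\<^sup>2)) * ?I w)"
      using Qm by (auto simp: incseq_def le_fun_def intro!: mult_right_mono SUP_subset_mono)
    show "(\<lambda>w. (SUP s\<in>Q n. ennreal ((S s w)\<^sup>2)) * ?I w) \<in> borel_measurable M" for n
      using SUPm[of n] by measurable
  qed
  also have "\<dots> \<le> 4 * (\<integral>\<^sup>+w. min (ennreal C) (energy H T w) \<partial>M)"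
  proof (rule SUP_least)
    fix n
    have "(\<integral>\<^sup>+w. (SUP s\<in>Q n. ennreal ((S s w)\<^sup>2)) * ?I w \<partial>M) =
       (\<integral>\<^sup>+w. (SUP s\<in>Q n. ennreal ((S s w)\<^sup>2)) * indicator {w. energy H T w \<le> ennreal C} w \<partial>M)"
      by (intro nn_integral_cong) (auto simp: indicator_def)
    also have "\<dots> \<le> 4 * (\<integral>\<^sup>+w. min (ennreal C) (energy H T w) \<partial>M)"
      by (rule elementary_grid_doob[OF el Q C])
    finally show "(\<integral>\<^sup>+w. (SUP s\<in>Q n. ennreal ((S s w)\<^sup>2)) * ?I w \<partial>M)
      \<le> 4 * (\<integral>\<^sup>+w. min (ennreal C) (energy H T w) \<partial>M)" .
  qed
  finally show ?thesis .
qed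

end

section \<open>Stochastic integrals as almost sure limits\<close>

text \<open>The difference of the two sides is the perfect square
  \<open>(c * y - (x - y))\<^sup>2 / c\<close>. The weight is free on purpose: small
  \<open>c\<close> costs almost nothing in front of \<open>y\<^sup>2\<close>, which keeps Doob's
  constant in the limit; \<open>c = 1\<close> gives the symmetric bound with 2;
  \<open>c = 1 / 2\<close> turns \<open>(2 * j + \<epsilon>)\<^sup>2\<close> into
  \<open>6 * j\<^sup>2 + 3 * \<epsilon>\<^sup>2\<close>.\<close>

lemma power2_le_weighted:
  fixes x y :: real
  assumes "0 < c"
  shows "x\<^sup>2 \<le> (1 + c) * y\<^sup>2 + (1 + 1 / c) * (x - y)\<^sup>2"
proof -
  have "(1 + c) * y\<^sup>2 + (1 + 1 / c) * (x - y)\<^sup>2 - x\<^sup>2 = (c * y - (x - y))\<^sup>2 / c"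
    using assms by (simp add: field_simps power2_eq_square)
  moreover have "0 \<le> (c * y - (x - y))\<^sup>2 / c" using assms by simp
  ultimately show ?thesis by linarith
qed

context brownian_setting
begin

text \<open>
  A pathwise variant of \<^const>\<open>is_ito_integral\<close> on \<open>[0,T]\<close>: convergence in probability is replaced by
  almost sure convergence (along a subsequence), which is preserved by the pathwise operations below.
\<close>

definition ito :: "real \<Rightarrow> (real \<Rightarrow> 'a \<Rightarrow> real) \<Rightarrow> (real \<Rightarrow> 'a \<Rightarrow> real) \<Rightarrow> bool" where
  "ito T H I \<longleftrightarrow> jointly_measurable H \<and>
    (\<forall>s\<ge>0. I s \<in> borel_measurable M) \<and>
    (\<forall>w\<in>space M. continuous_on {0..} (\<lambda>s. I s w)) \<and>
    (AE w in M. energy H T w < \<infinity>) \<and>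
    (\<exists>P H' S. (\<forall>k. elementary (P k) (H' k) (S k)) \<and>
      (AE w in M. (\<lambda>k. energy (\<lambda>s w. H' k s w - H s w) T w) \<longlonglongrightarrow> 0 \<and>
        uniform_limit {0..T} (\<lambda>k s. S k s w) (\<lambda>s. I s w) sequentially))"

lemma ito_measurable: "ito T H I \<Longrightarrow> 0 \<le> s \<Longrightarrow> I s \<in> borel_measurable M"
  by (simp add: ito_def)

lemma ito_continuous: "ito T H I \<Longrightarrow> w \<in> space M \<Longrightarrow> continuous_on {0..} (\<lambda>s. I s w)"
  by (simp add: ito_def)

lemma energy_weighted:
  assumes H: "(\<lambda>s. H s w) \<in> borel_measurable borel" and K: "(\<lambda>s. K s w) \<in> borel_measurable borel"
    and c: "0 < c"
  shows "energy H T w \<le> ennreal (1 + c) * energy K T w + ennreal (1 + 1 / c) * energy (\<lambda>s w. H s w - K s w) T w"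
proof -
  note [measurable] = H K
  have "energy H T w \<le> (\<integral>\<^sup>+s. ennreal (1 + c) * (ennreal ((K s w)\<^sup>2) * indicator {0..T} s) +
      ennreal (1 + 1 / c) * (ennreal ((H s w - K s w)\<^sup>2) * indicator {0..T} s) \<partial>lborel)"
    using power2_le_weighted[OF c] c
    by (intro nn_integral_mono) (auto simp: indicator_def ennreal_mult[symmetric] ennreal_plus[symmetric] simp del: ennreal_plus intro!: ennreal_leI)
  also have "\<dots> = ennreal (1 + c) * energy K T w + ennreal (1 + 1 / c) * energy (\<lambda>s w. H s w - K s w) T w"
    by (subst nn_integral_add) (auto simp: nn_integral_cmult)
  finally show ?thesis .
qed

lemma energy_diff_le:
  assumes H: "(\<lambda>s. H s w) \<in> borel_measurable borel" and K: "(\<lambda>s. K s w) \<in> borel_measurable borel"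
  shows "energy (\<lambda>s w. H s w - K s w) T w \<le> 2 * energy H T w + 2 * energy K T w"
proof -
  have "energy (\<lambda>s w. H s w - K s w) T w \<le> ennreal (1 + 1) * energy H T w +
      ennreal (1 + 1 / 1) * energy (\<lambda>s w. H s w - K s w - H s w) T w"
    using H K by (intro energy_weighted) auto
  then show ?thesis by simp
qed

text \<open>The energies of the approximants converge only almost surely, so expectations cannot be
  passed to the limit directly. On the event that (1 + c) times the limit energy is below
  \<open>C\<close>, the approximants eventually have energy at most \<open>C\<close>; there Fatou
  handles the left side, while the excess energy, cut at \<open>C\<close>, vanishes by dominated
  convergence. Then \<open>C\<close> tends to infinity and \<open>c\<close> to 0. Infinite expected
  energy makes the claim trivial.\<close>

lemma ito_doob:
  assumes ito: "ito T H I" and T: "0 \<le> T"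
  shows "expected_sup I T \<le> 4 * expected_energy H T"
proof -
  obtain P H' S where el: "\<And>k. elementary (P k) (H' k) (S k)"
    and lim: "AE w in M. (\<lambda>k. energy (\<lambda>s w. H' k s w - H s w) T w) \<longlonglongrightarrow> 0 \<and>
        uniform_limit {0..T} (\<lambda>k s. S k s w) (\<lambda>s. I s w) sequentially"
    using ito unfolding ito_def by blast
  have Hm: "jointly_measurable H"
    and fin: "AE w in M. energy H T w < \<infinity>"
    and Im: "\<And>s. 0 \<le> s \<Longrightarrow> I s \<in> borel_measurable M" "\<And>w. w \<in> space M \<Longrightarrow> continuous_on {0..} (\<lambda>s. I s w)"
    using ito by (auto simp: ito_def)
  have H'm: "jointly_measurable (H' k)" for k
    using el[of k] by (simp add: elementary_def)
  have Dm: "(\<lambda>(s, w). H' k s w - H s w) \<in> borel_measurable (borel \<Otimes>\<^sub>M M)" for k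
    using borel_measurable_diff[OF H'm[of k] Hm] by (simp add: case_prod_beta)
  let ?E = "energy H T" and ?E' = "\<lambda>k. energy (H' k) T"
  let ?R = "\<lambda>k. energy (\<lambda>s w. H' k s w - H s w) T"
  have Sm: "sup_sq (S k) T \<in> borel_measurable M" for k
    using el[of k] by (intro sup_sq_measurable) (auto simp: elementary_def)
  have Ism: "sup_sq I T \<in> borel_measurable M" using Im by (rule sup_sq_measurable)
  note [measurable] = energy_measurable[OF Hm, of T] energy_measurable[OF H'm, of _ T]
    energy_measurable[OF Dm, of _ T] Sm Ism
  have step1: "(\<integral>\<^sup>+w. sup_sq I T w * indicator {w\<in>space M. ennreal (1 + c) * ?E w < ennreal C} w \<partial>M)
      \<le> 4 * (ennreal (1 + c) * (\<integral>\<^sup>+w. ?E w \<partial>M))" if c: "0 < c" and C: "0 \<le> C" for c C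
  proof -
    have bound: "?E' k w \<le> ennreal (1 + c) * ?E w + ennreal (1 + 1 / c) * ?R k w" if "w \<in> space M" for k w
      using energy_weighted[of "H' k" w H c T] path_measurable[OF H'm that] path_measurable[OF Hm that] c by blast
    have Rlim: "AE w in M. (\<lambda>k. ennreal (1 + 1 / c) * ?R k w) \<longlonglongrightarrow> 0"
      using lim
    proof eventually_elim
      case (elim w)
      have "(\<lambda>k. ennreal (1 + 1 / c) * ?R k w) \<longlonglongrightarrow> ennreal (1 + 1 / c) * 0"
        using elim by (intro ennreal_tendsto_cmult) auto
      then show ?case by simp
    qed
    let ?L = "\<lambda>k w. sup_sq (S k) T w * indicator {w\<in>space M. ?E' k w \<le> ennreal C} w"
    let ?m = "\<lambda>k w. min (ennreal C) (ennreal (1 + 1 / c) * ?R k w)"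
    have "(\<integral>\<^sup>+w. sup_sq I T w * indicator {w\<in>space M. ennreal (1 + c) * ?E w < ennreal C} w \<partial>M)
        \<le> (\<integral>\<^sup>+w. liminf (\<lambda>k. ?L k w) \<partial>M)"
    proof (rule nn_integral_mono_AE)
      show "AE w in M. sup_sq I T w * indicator {w\<in>space M. ennreal (1 + c) * ?E w < ennreal C} w
        \<le> liminf (\<lambda>k. ?L k w)"
        using lim Rlim AE_space
      proof eventually_elim
        case (elim w)
        show ?case
        proof (cases "ennreal (1 + c) * ?E w < ennreal C")
          case True
          have "(\<lambda>k. ennreal (1 + c) * ?E w + ennreal (1 + 1 / c) * ?R k w) \<longlonglongrightarrow> ennreal (1 + c) * ?E w + 0"
            using elim by (intro tendsto_add tendsto_const) auto
          \<comment> \<open>The strict inequality in the event leaves room for the vanishing error,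
            so the truncation indicator of the approximants is eventually 1.\<close>
          then have "eventually (\<lambda>k. ennreal (1 + c) * ?E w + ennreal (1 + 1 / c) * ?R k w < ennreal C) sequentially"
            using order_tendstoD(2)[of _ "ennreal (1 + c) * ?E w"] True by simp
          then have ev: "eventually (\<lambda>k. ?L k w = sup_sq (S k) T w) sequentially"
          proof eventually_elim
            case (elim k)
            then show ?case
              using order_le_less_trans[OF bound[OF \<open>w \<in> space M\<close>] elim] \<open>w \<in> space M\<close> by (simp add: less_imp_le)
          qed
          have "sup_sq I T w \<le> liminf (\<lambda>k. ?L k w)"
          proof (rule SUP_least)
            fix s assume s: "s \<in> {0..T}"
            have "(\<lambda>k. S k s w) \<longlonglongrightarrow> I s w"
              using elim s by (auto intro: tendsto_uniform_limitI)
            then have "(\<lambda>k. ennreal ((S k s w)\<^sup>2)) \<longlonglongrightarrow> ennreal ((I s w)\<^sup>2)"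
              by (intro tendsto_ennrealI tendsto_power)
            then have "ennreal ((I s w)\<^sup>2) = liminf (\<lambda>k. ennreal ((S k s w)\<^sup>2))"
              by (rule lim_imp_Liminf[OF trivial_limit_sequentially, symmetric])
            also have "\<dots> \<le> liminf (\<lambda>k. ?L k w)"
            proof (rule Liminf_mono, use ev in eventually_elim)
              case (elim k)
              then show ?case using s by (simp only:) (rule SUP_upper)
            qed
            finally show "ennreal ((I s w)\<^sup>2) \<le> liminf (\<lambda>k. ?L k w)" .
          qed
          then show ?thesis using True elim by simp
        qed simp
      qed
    qed
    also have "\<dots> \<le> liminf (\<lambda>k. \<integral>\<^sup>+w. ?L k w \<partial>M)"
      by (intro nn_integral_liminf) measurable
    also have "\<dots> \<le> liminf (\<lambda>k. 4 * (ennreal (1 + c) * (\<integral>\<^sup>+w. ?E w \<partial>M) + (\<integral>\<^sup>+w. ?m k w \<partial>M)))"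
    proof (intro Liminf_mono always_eventually allI)
      fix k
      have "(\<integral>\<^sup>+w. ?L k w \<partial>M) = (\<integral>\<^sup>+w. sup_sq (S k) T w * indicator {w. ?E' k w \<le> ennreal C} w \<partial>M)"
        by (intro nn_integral_cong) (auto simp: indicator_def)
      also have "\<dots> \<le> 4 * (\<integral>\<^sup>+w. min (ennreal C) (?E' k w) \<partial>M)"
        by (rule elementary_doob[OF el T C])
      also have "\<dots> \<le> 4 * (\<integral>\<^sup>+w. ennreal (1 + c) * ?E w + ?m k w \<partial>M)"
      proof (intro mult_left_mono nn_integral_mono)
        fix w assume "w \<in> space M"
        from bound[OF this, of k]
        show "min (ennreal C) (?E' k w) \<le> ennreal (1 + c) * ?E w + ?m k w"
          by (auto simp: min_def add_increasing intro: order_trans)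
      qed simp
      also have "\<dots> = 4 * (ennreal (1 + c) * (\<integral>\<^sup>+w. ?E w \<partial>M) + (\<integral>\<^sup>+w. ?m k w \<partial>M))"
        by (subst nn_integral_add) (auto simp: nn_integral_cmult)
      finally show "(\<integral>\<^sup>+w. ?L k w \<partial>M) \<le> 4 * (ennreal (1 + c) * (\<integral>\<^sup>+w. ?E w \<partial>M) + (\<integral>\<^sup>+w. ?m k w \<partial>M))" .
    qed
    also have "\<dots> = 4 * (ennreal (1 + c) * (\<integral>\<^sup>+w. ?E w \<partial>M) + 0)"
    proof (rule lim_imp_Liminf)
      have "(\<lambda>k. \<integral>\<^sup>+w. ?m k w \<partial>M) \<longlonglongrightarrow> (\<integral>\<^sup>+w. 0 \<partial>M)"
      proof (rule nn_integral_dominated_convergence[where w="\<lambda>_. ennreal C"])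
        show "AE w in M. (\<lambda>k. ?m k w) \<longlonglongrightarrow> 0"
          using Rlim
        proof eventually_elim
          case (elim w)
          have "(\<lambda>k. ?m k w) \<longlonglongrightarrow> min (ennreal C) 0"
            using elim by (intro tendsto_min tendsto_const)
          then show ?case by simp
        qed
      qed (auto simp: emeasure_space_1)
      then show "(\<lambda>k. 4 * (ennreal (1 + c) * (\<integral>\<^sup>+w. ?E w \<partial>M) + (\<integral>\<^sup>+w. ?m k w \<partial>M)))
        \<longlonglongrightarrow> 4 * (ennreal (1 + c) * (\<integral>\<^sup>+w. ?E w \<partial>M) + 0)"
        by (intro ennreal_tendsto_cmult tendsto_add tendsto_const) auto
    qed simp
    finally show ?thesis by simp
  qed
  \<comment> \<open>Letting \<open>C\<close> run through the naturals exhausts the space up to a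
    null set, since the energy is almost surely finite.\<close>
  have step2: "expected_sup I T \<le> 4 * (ennreal (1 + c) * (\<integral>\<^sup>+w. ?E w \<partial>M))" if c: "0 < c" for c
  proof -
    let ?G = "\<lambda>n w. sup_sq I T w * indicator {w\<in>space M. ennreal (1 + c) * ?E w < ennreal (real n)} w"
    have "expected_sup I T \<le> (\<integral>\<^sup>+w. (SUP n. ?G n w) \<partial>M)"
    proof (rule nn_integral_mono_AE)
      show "AE w in M. sup_sq I T w \<le> (SUP n. ?G n w)"
        using fin AE_space
      proof eventually_elim
        case (elim w)
        then have "ennreal (1 + c) * ?E w < \<infinity>" by (simp add: ennreal_mult_less_top)
        then obtain n :: nat where "ennreal (1 + c) * ?E w < of_nat n"
          using ennreal_Ex_less_of_nat by (auto simp: less_top)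
        then show ?case using elim by (intro SUP_upper2[of n]) (auto simp: ennreal_of_nat_eq_real_of_nat)
      qed
    qed
    also have "\<dots> = (SUP n. \<integral>\<^sup>+w. ?G n w \<partial>M)"
    proof (rule nn_integral_monotone_convergence_SUP)
      show "incseq ?G"
      proof (intro incseq_SucI le_funI mult_left_mono)
        fix n w
        have le: "ennreal (real n) \<le> ennreal (real (Suc n))" by (intro ennreal_leI) simp
        show "indicator {w\<in>space M. ennreal (1 + c) * ?E w < ennreal (real n)} w
           \<le> (indicator {w\<in>space M. ennreal (1 + c) * ?E w < ennreal (real (Suc n))} w :: ennreal)"
          using order_less_le_trans[OF _ le, of "ennreal (1 + c) * ?E w"]
          by (auto simp: indicator_def simp del: of_nat_Suc)
      qed simp
    qed measurable
    also have "\<dots> \<le> 4 * (ennreal (1 + c) * (\<integral>\<^sup>+w. ?E w \<partial>M))"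
      by (intro SUP_least step1 c) simp
    finally show ?thesis .
  qed
  \<comment> \<open>Finally \<open>c = 1 / (n + 1)\<close> tends to 0.\<close>
  show ?thesis
  proof (cases "\<integral>\<^sup>+w. ?E w \<partial>M")
    case (real r)
    have "(\<lambda>n. ennreal (4 * ((1 + 1 / real (Suc n)) * r))) \<longlonglongrightarrow> ennreal (4 * ((1 + 0) * r))"
      by (intro tendsto_ennrealI tendsto_mult tendsto_add tendsto_const LIMSEQ_Suc[OF lim_1_over_n])
    moreover have "expected_sup I T \<le> ennreal (4 * ((1 + 1 / real (Suc n)) * r))" for n
    proof -
      have "expected_sup I T \<le> 4 * (ennreal (1 + 1 / real (Suc n)) * ennreal r)"
        using step2[of "1 / real (Suc n)"] real by simp
      also have "\<dots> = ennreal (4 * ((1 + 1 / real (Suc n)) * r))"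
        using real by (simp add: ennreal_mult)
      finally show ?thesis .
    qed
    ultimately have "expected_sup I T \<le> ennreal (4 * ((1 + 0) * r))"
      by (intro LIMSEQ_le_const) auto
    then show ?thesis using real by (simp add: ennreal_mult)
  qed simp
qed

end

section \<open>Stopping\<close>

lemma ceiling_grid_bounds:
  "\<bar>of_int \<lceil>real (Suc k) * x\<rceil> / real (Suc k) - x\<bar> \<le> 1 / real (Suc k)"
  "x \<le> of_int \<lceil>real (Suc k) * x\<rceil> / real (Suc k)"
proof -
  have 1: "real (Suc k) * x \<le> of_int \<lceil>real (Suc k) * x\<rceil>" "of_int \<lceil>real (Suc k) * x\<rceil> \<le> real (Suc k) * x + 1"
    by linarith+
  then show "x \<le> of_int \<lceil>real (Suc k) * x\<rceil> / real (Suc k)"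
    by (simp add: field_simps del: of_nat_Suc)
  moreover have "of_int \<lceil>real (Suc k) * x\<rceil> / real (Suc k) \<le> x + 1 / real (Suc k)"
    using 1 by (simp add: field_simps del: of_nat_Suc)
  ultimately show "\<bar>of_int \<lceil>real (Suc k) * x\<rceil> / real (Suc k) - x\<bar> \<le> 1 / real (Suc k)" by linarith
qed

text \<open>Rounding \<open>\<tau>\<close> up to a grid gives a countable patchwork of the variables
  \<open>Z s\<close>, which is measurable; continuity of the paths recovers \<open>Z\<close> at
  \<open>\<tau>\<close> as the mesh shrinks. Joint measurability of \<open>Z\<close> does not
  enter.\<close>

lemma measurable_continuous_random_time:
  fixes Z :: "real \<Rightarrow> 'a \<Rightarrow> real"
  assumes Z: "\<And>s. 0 \<le> s \<Longrightarrow> Z s \<in> borel_measurable N"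
    and cont: "\<And>w. w \<in> space N \<Longrightarrow> continuous_on {0..} (\<lambda>s. Z s w)"
    and \<tau>[measurable]: "\<tau> \<in> borel_measurable N" and nonneg: "\<And>w. w \<in> space N \<Longrightarrow> 0 \<le> \<tau> w"
  shows "(\<lambda>w. Z (\<tau> w) w) \<in> borel_measurable N"
proof -
  let ?g = "\<lambda>k w. of_int \<lceil>real (Suc k) * \<tau> w\<rceil> / real (Suc k)"
  have "(\<lambda>w. Z (real (nat \<lceil>real (Suc k) * \<tau> w\<rceil>) / real (Suc k)) w) \<in> borel_measurable N" for k
  proof (rule measurable_compose_countable[where f="\<lambda>i. Z (real i / real (Suc k))"])
    show "Z (real i / real (Suc k)) \<in> borel_measurable N" for i
      by (intro Z) simp
    show "(\<lambda>w. nat \<lceil>real (Suc k) * \<tau> w\<rceil>) \<in> N \<rightarrow>\<^sub>M count_space UNIV"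
      by measurable
  qed
  then have m: "(\<lambda>w. Z (max 0 (?g k w)) w) \<in> borel_measurable N" for k
  proof (rule measurable_cong[THEN iffD1, rotated])
    fix w assume "w \<in> space N"
    then have "0 \<le> real (Suc k) * \<tau> w" using nonneg by (intro mult_nonneg_nonneg) auto
    then have "0 \<le> \<lceil>real (Suc k) * \<tau> w\<rceil>" by linarith
    then show "Z (real (nat \<lceil>real (Suc k) * \<tau> w\<rceil>) / real (Suc k)) w = Z (max 0 (?g k w)) w"
      by (simp add: max_absorb2 del: of_nat_Suc)
  qed
  show ?thesis
  proof (rule borel_measurable_LIMSEQ_real[OF _ m])
    fix w assume w: "w \<in> space N"
    have "(\<lambda>k. ?g k w) \<longlonglongrightarrow> \<tau> w"
    proof (rule LIM_zero_cancel, rule Lim_null_comparison)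
      show "\<forall>\<^sub>F k in sequentially. norm (?g k w - \<tau> w) \<le> 1 / real (Suc k)"
        using ceiling_grid_bounds(1) by (auto intro: always_eventually)
      show "(\<lambda>k. 1 / real (Suc k)) \<longlonglongrightarrow> 0" by (rule LIMSEQ_Suc[OF lim_1_over_n])
    qed
    then have "(\<lambda>k. max 0 (?g k w)) \<longlonglongrightarrow> max 0 (\<tau> w)" by (intro tendsto_intros)
    then have "(\<lambda>k. max 0 (?g k w)) \<longlonglongrightarrow> \<tau> w" using nonneg[OF w] by simp
    then show "(\<lambda>k. Z (max 0 (?g k w)) w) \<longlonglongrightarrow> Z (\<tau> w) w"
      by (rule continuous_on_tendsto_compose[OF cont[OF w]]) (use nonneg[OF w] in auto)
  qed
qed

lemma continuous_on_stopped:
  fixes f :: "real \<Rightarrow> real"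
  assumes "continuous_on {0..} f" "0 \<le> \<tau>"
  shows "continuous_on {0..} (\<lambda>s. f (min s \<tau>))"
  by (rule continuous_on_compose2[OF assms(1)]) (use assms(2) in \<open>auto intro!: continuous_intros\<close>)

context brownian_setting
begin

lemma elementary_measurable:
  "elementary P H S \<Longrightarrow> jointly_measurable H"
  by (simp add: elementary_def)

lemma elementary_integral_measurable:
  "elementary P H S \<Longrightarrow> 0 \<le> s \<Longrightarrow> S s \<in> borel_measurable M"
  by (simp add: elementary_def)

lemma elementary_integral_continuous:
  "elementary P H S \<Longrightarrow> w \<in> space M \<Longrightarrow> continuous_on {0..} (\<lambda>s. S s w)"
  by (simp add: elementary_def)

lemma elementary_integral_0: "elementary P H S \<Longrightarrow> w \<in> space M \<Longrightarrow> S 0 w = 0"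
  by (simp add: elementary_def)

lemma elementary_diff:
  assumes 1: "elementary P1 H1 S1" and 2: "elementary P2 H2 S2"
  shows "elementary (P1 \<union> P2) (\<lambda>s w. H1 s w - H2 s w) (\<lambda>s w. S1 s w - S2 s w)"
  unfolding elementary_def
proof (intro conjI allI impI)
  note e = 1[unfolded elementary_def] 2[unfolded elementary_def]
  show "finite (P1 \<union> P2)" using e by blast
  have "(\<lambda>x. case_prod H1 x - case_prod H2 x) \<in> borel_measurable (borel \<Otimes>\<^sub>M M)"
    using e by (intro borel_measurable_diff) blast+
  then show "(\<lambda>(s, w). H1 s w - H2 s w) \<in> borel_measurable (borel \<Otimes>\<^sub>M M)"
    by (simp add: case_prod_beta')
  show "(\<lambda>w. S1 s w - S2 s w) \<in> borel_measurable M" if "0 \<le> s" for s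
    using elementary_integral_measurable[OF 1 that] elementary_integral_measurable[OF 2 that]
    by (rule borel_measurable_diff)
  show "\<forall>w\<in>space M. S1 0 w - S2 0 w = 0 \<and> continuous_on {0..} (\<lambda>s. S1 s w - S2 s w)"
    using elementary_integral_0[OF 1] elementary_integral_0[OF 2]
      elementary_integral_continuous[OF 1] elementary_integral_continuous[OF 2]
    by (auto intro!: continuous_on_diff)
  fix u v assume uv: "0 \<le> u \<and> u < v \<and> (P1 \<union> P2) \<inter> {u<..<v} = {}"
  then have i: "0 \<le> u \<and> u < v \<and> P1 \<inter> {u<..<v} = {}" "0 \<le> u \<and> u < v \<and> P2 \<inter> {u<..<v} = {}" by auto
  obtain \<eta>1 c1 where h1: "\<eta>1 \<in> borel_measurable (F u)" "\<forall>w\<in>space M. \<bar>\<eta>1 w\<bar> \<le> c1"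
    "\<forall>w\<in>space M. (\<forall>s\<in>{u<..v}. H1 s w = \<eta>1 w) \<and> S1 v w - S1 u w = \<eta>1 w * (W v w - W u w)"
    using e(1) i(1) by blast
  obtain \<eta>2 c2 where h2: "\<eta>2 \<in> borel_measurable (F u)" "\<forall>w\<in>space M. \<bar>\<eta>2 w\<bar> \<le> c2"
    "\<forall>w\<in>space M. (\<forall>s\<in>{u<..v}. H2 s w = \<eta>2 w) \<and> S2 v w - S2 u w = \<eta>2 w * (W v w - W u w)"
    using e(2) i(2) by blast
  show "\<exists>\<eta> c. step_by \<eta> c u v (\<lambda>s w. H1 s w - H2 s w) (\<lambda>s w. S1 s w - S2 s w)"
  proof (intro exI[of _ "\<lambda>w. \<eta>1 w - \<eta>2 w"] exI[of _ "c1 + c2"] conjI ballI)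
    show "(\<lambda>w. \<eta>1 w - \<eta>2 w) \<in> borel_measurable (F u)" using h1(1) h2(1) by simp
    fix w assume w: "w \<in> space M"
    show "\<bar>\<eta>1 w - \<eta>2 w\<bar> \<le> c1 + c2" using h1(2) h2(2) w by fastforce
    show "S1 v w - S2 v w - (S1 u w - S2 u w) = (\<eta>1 w - \<eta>2 w) * (W v w - W u w)"
      using h1(3) h2(3) w by (auto simp: algebra_simps)
    show "H1 s w - H2 s w = \<eta>1 w - \<eta>2 w" if "s \<in> {u<..v}" for s
      using h1(3) h2(3) w that by auto
  qed
qed

lemma ito_diff:
  assumes H: "ito T H I" and K: "ito T K J"
  shows "ito T (\<lambda>s w. H s w - K s w) (\<lambda>s w. I s w - J s w)"
proof -
  obtain P1 H' S1 where el1: "\<And>k. elementary (P1 k) (H' k) (S1 k)"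
    and lim1: "AE w in M. (\<lambda>k. energy (\<lambda>s w. H' k s w - H s w) T w) \<longlonglongrightarrow> 0 \<and>
        uniform_limit {0..T} (\<lambda>k s. S1 k s w) (\<lambda>s. I s w) sequentially"
    using H unfolding ito_def by blast
  obtain P2 K' S2 where el2: "\<And>k. elementary (P2 k) (K' k) (S2 k)"
    and lim2: "AE w in M. (\<lambda>k. energy (\<lambda>s w. K' k s w - K s w) T w) \<longlonglongrightarrow> 0 \<and>
        uniform_limit {0..T} (\<lambda>k s. S2 k s w) (\<lambda>s. J s w) sequentially"
    using K unfolding ito_def by blast
  have Hm: "jointly_measurable H" "jointly_measurable K"
    and fin: "AE w in M. energy H T w < \<infinity>" "AE w in M. energy K T w < \<infinity>"
    and Im: "\<And>s. 0 \<le> s \<Longrightarrow> I s \<in> borel_measurable M" "\<And>w. w \<in> space M \<Longrightarrow> continuous_on {0..} (\<lambda>s. I s w)"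
      "\<And>s. 0 \<le> s \<Longrightarrow> J s \<in> borel_measurable M" "\<And>w. w \<in> space M \<Longrightarrow> continuous_on {0..} (\<lambda>s. J s w)"
    using H K by (auto simp: ito_def)
  have pm: "(\<lambda>s. H s w) \<in> borel_measurable borel" "(\<lambda>s. K s w) \<in> borel_measurable borel"
      "(\<lambda>s. H' k s w) \<in> borel_measurable borel" "(\<lambda>s. K' k s w) \<in> borel_measurable borel"
    if "w \<in> space M" for k w
    by (intro path_measurable[OF _ that] Hm elementary_measurable[OF el1] elementary_measurable[OF el2])+
  show ?thesis
    unfolding ito_def
  proof (intro conjI allI impI ballI exI)
    have "(\<lambda>x. case_prod H x - case_prod K x) \<in> borel_measurable (borel \<Otimes>\<^sub>M M)"
      using Hm by (intro borel_measurable_diff)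
    then show "(\<lambda>(s, w). H s w - K s w) \<in> borel_measurable (borel \<Otimes>\<^sub>M M)"
      by (simp add: case_prod_beta')
    show "(\<lambda>w. I s w - J s w) \<in> borel_measurable M" if "0 \<le> s" for s
      using Im that by auto
    show "continuous_on {0..} (\<lambda>s. I s w - J s w)" if "w \<in> space M" for w
      using Im that by (auto intro!: continuous_on_diff)
    show "AE w in M. energy (\<lambda>s w. H s w - K s w) T w < \<infinity>"
      using fin AE_space
    proof eventually_elim
      case (elim w)
      have "2 * energy H T w + 2 * energy K T w < \<infinity>"
        using elim by (simp add: ennreal_mult_less_top)
      with energy_diff_le[of H w K T] pm(1,2) elim show ?case by (meson order_le_less_trans)
    qed
    show "elementary (P1 k \<union> P2 k) (\<lambda>s w. H' k s w - K' k s w) (\<lambda>s w. S1 k s w - S2 k s w)" for k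
      by (rule elementary_diff[OF el1 el2])
    show "AE w in M. (\<lambda>k. energy (\<lambda>s w. (H' k s w - K' k s w) - (H s w - K s w)) T w) \<longlonglongrightarrow> 0 \<and>
        uniform_limit {0..T} (\<lambda>k s. S1 k s w - S2 k s w) (\<lambda>s. I s w - J s w) sequentially"
      using lim1 lim2 AE_space
    proof eventually_elim
      case (elim w)
      let ?a = "\<lambda>k. energy (\<lambda>s w. H' k s w - H s w) T w" and ?b = "\<lambda>k. energy (\<lambda>s w. K' k s w - K s w) T w"
      have "(\<lambda>k. 2 * ?a k + 2 * ?b k) \<longlonglongrightarrow> 2 * 0 + 2 * 0"
        using elim by (intro tendsto_add ennreal_tendsto_cmult) auto
      then have l: "(\<lambda>k. 2 * ?a k + 2 * ?b k) \<longlonglongrightarrow> 0" by simp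
      have "(\<lambda>k. energy (\<lambda>s w. (H' k s w - K' k s w) - (H s w - K s w)) T w) \<longlonglongrightarrow> 0"
      proof (rule tendsto_sandwich[OF _ _ tendsto_const l])
        show "\<forall>\<^sub>F k in sequentially. energy (\<lambda>s w. (H' k s w - K' k s w) - (H s w - K s w)) T w
            \<le> 2 * ?a k + 2 * ?b k"
        proof (intro always_eventually allI)
          fix k
          have "energy (\<lambda>s w. (H' k s w - K' k s w) - (H s w - K s w)) T w =
              energy (\<lambda>s w. (H' k s w - H s w) - (K' k s w - K s w)) T w"
            by (simp add: algebra_simps)
          also have "\<dots> \<le> 2 * ?a k + 2 * ?b k"
            using pm elim by (intro energy_diff_le[where H = "\<lambda>s w. H' k s w - H s w" and K = "\<lambda>s w. K' k s w - K s w"]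
              borel_measurable_diff) blast+
          finally show "energy (\<lambda>s w. (H' k s w - K' k s w) - (H s w - K s w)) T w \<le> 2 * ?a k + 2 * ?b k" .
        qed
      qed simp
      then show ?case using elim by (auto intro: uniform_limit_minus)
    qed
  qed
qed

lemma ito_le_horizon:
  assumes "ito T H I" "t \<le> T"
  shows "ito t H I"
proof -
  obtain P H' S where el: "\<And>k. elementary (P k) (H' k) (S k)"
    and lim: "AE w in M. (\<lambda>k. energy (\<lambda>s w. H' k s w - H s w) T w) \<longlonglongrightarrow> 0 \<and>
        uniform_limit {0..T} (\<lambda>k s. S k s w) (\<lambda>s. I s w) sequentially"
    using assms(1) unfolding ito_def by blast
  have le: "energy K t w \<le> energy K T w" for K w
    using assms(2) by (intro nn_integral_mono) (auto simp: indicator_def)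
  have "AE w in M. energy H T w < \<infinity>" using assms(1) by (simp add: ito_def)
  then have fin: "AE w in M. energy H t w < \<infinity>"
    by eventually_elim (rule order_le_less_trans[OF le])
  have "AE w in M. (\<lambda>k. energy (\<lambda>s w. H' k s w - H s w) t w) \<longlonglongrightarrow> 0 \<and>
        uniform_limit {0..t} (\<lambda>k s. S k s w) (\<lambda>s. I s w) sequentially"
    using lim
  proof eventually_elim
    case (elim w)
    have "(\<lambda>k. energy (\<lambda>s w. H' k s w - H s w) t w) \<longlonglongrightarrow> 0"
      by (rule tendsto_sandwich[OF _ _ tendsto_const conjunct1[OF elim]])
        (auto intro!: always_eventually le[of "\<lambda>s w. H' _ s w - H s w"])
    then show ?case using elim assms(2) by (auto intro: uniform_limit_on_subset)
  qed
  with el fin assms(1) show ?thesis unfolding ito_def by blast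
qed

definition is_stopping :: "real \<Rightarrow> ('a \<Rightarrow> real) \<Rightarrow> bool" where
  "is_stopping T \<tau> \<longleftrightarrow> (\<forall>w\<in>space M. 0 \<le> \<tau> w \<and> \<tau> w \<le> T) \<and>
     (\<forall>u\<ge>0. {w\<in>space M. \<tau> w \<le> u} \<in> sets (F u))"

lemma is_stopping_measurable:
  assumes "is_stopping T \<tau>"
  shows "\<tau> \<in> borel_measurable M"
proof (rule borel_measurableI_le)
  fix u
  show "{w \<in> space M. \<tau> w \<le> u} \<in> sets M"
  proof (cases "0 \<le> u")
    case True
    then have "{w \<in> space M. \<tau> w \<le> u} \<in> sets (F u)" using assms by (simp add: is_stopping_def)
    then show ?thesis using sets_F_subset by blast
  next
    case False
    then have "{w \<in> space M. \<tau> w \<le> u} = {}" using assms by (auto simp: is_stopping_def)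
    then show ?thesis by (simp only: sets.empty_sets)
  qed
qed

lemma stopped_integrand_measurable:
  fixes H :: "real \<Rightarrow> 'a \<Rightarrow> real" and \<tau> :: "'a \<Rightarrow> real"
  assumes "(\<lambda>(s, w). H s w :: real) \<in> borel_measurable (borel \<Otimes>\<^sub>M M)" "\<tau> \<in> borel_measurable M"
  shows "(\<lambda>(s, w). if s \<le> \<tau> w then H s w else 0) \<in> borel_measurable (borel \<Otimes>\<^sub>M M)"
proof -
  have "(\<lambda>x. \<tau> (snd x)) \<in> borel_measurable ((borel :: real measure) \<Otimes>\<^sub>M M)"
    using measurable_compose[OF measurable_snd assms(2)] .
  from borel_measurable_le[OF measurable_fst this]
  have "{x \<in> space (borel \<Otimes>\<^sub>M M). fst x \<le> \<tau> (snd x)} \<in> sets (borel \<Otimes>\<^sub>M M)" .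
  then have "(\<lambda>x. if fst x \<le> \<tau> (snd x) then H (fst x) (snd x) else 0) \<in> borel_measurable (borel \<Otimes>\<^sub>M M)"
    using assms(1)[unfolded case_prod_beta'] by (intro measurable_If) auto
  then show ?thesis by (simp add: case_prod_beta')
qed

text \<open>With all values of \<open>\<tau>\<close> adjoined to the jump set, an interval from
  \<open>u\<close> to \<open>v\<close> without interior jump points lies entirely before or entirely
  after \<open>\<tau>\<close>. Which of the two holds is decided by the event
  \<open>\<tau> w \<le> u\<close>, known at time \<open>u\<close>, so stopping merely sets the
  coefficient to zero there.\<close>

lemma elementary_stop:
  assumes el: "elementary P H S" and \<tau>: "is_stopping T \<tau>"
    and R: "finite R" "\<And>w. w \<in> space M \<Longrightarrow> \<tau> w \<in> R"
  shows "elementary (P \<union> R) (\<lambda>s w. if s \<le> \<tau> w then H s w else 0) (\<lambda>s w. S (min s (\<tau> w)) w)"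
  unfolding elementary_def
proof (intro conjI allI impI)
  note e = el[unfolded elementary_def]
  note [measurable] = is_stopping_measurable[OF \<tau>]
  have nonneg: "0 \<le> \<tau> w" if "w \<in> space M" for w using \<tau> that by (auto simp: is_stopping_def)
  show "finite (P \<union> R)" using e R by blast
  show "(\<lambda>(s, w). if s \<le> \<tau> w then H s w else 0) \<in> borel_measurable (borel \<Otimes>\<^sub>M M)"
    using e by (intro stopped_integrand_measurable) auto
  show "(\<lambda>w. S (min s (\<tau> w)) w) \<in> borel_measurable M" if "0 \<le> s" for s
    by (rule measurable_continuous_random_time[OF elementary_integral_measurable[OF el]
          elementary_integral_continuous[OF el]]) (use that nonneg in auto)
  show "\<forall>w\<in>space M. S (min 0 (\<tau> w)) w = 0 \<and> continuous_on {0..} (\<lambda>s. S (min s (\<tau> w)) w)"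
    using nonneg elementary_integral_0[OF el] continuous_on_stopped[OF elementary_integral_continuous[OF el]]
    by (simp add: min_absorb1)
  fix u v assume uv: "0 \<le> u \<and> u < v \<and> (P \<union> R) \<inter> {u<..<v} = {}"
  then have i: "0 \<le> u \<and> u < v \<and> P \<inter> {u<..<v} = {}" by auto
  obtain \<eta> c where h: "\<eta> \<in> borel_measurable (F u)" "\<forall>w\<in>space M. \<bar>\<eta> w\<bar> \<le> c"
    "\<forall>w\<in>space M. (\<forall>s\<in>{u<..v}. H s w = \<eta> w) \<and> S v w - S u w = \<eta> w * (W v w - W u w)"
    using e i by blast
  have gap: "\<tau> w \<le> u \<or> v \<le> \<tau> w" if "w \<in> space M" for w
    using R(2)[OF that] uv by fastforce
  have set: "{w\<in>space (F u). \<tau> w \<le> u} \<in> sets (F u)" using \<tau> uv by (auto simp: is_stopping_def)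
  show "\<exists>\<eta> c. step_by \<eta> c u v (\<lambda>s w. if s \<le> \<tau> w then H s w else 0) (\<lambda>s w. S (min s (\<tau> w)) w)"
  proof (intro exI[of _ "\<lambda>w. if \<tau> w \<le> u then 0 else \<eta> w"] exI[of _ c] conjI ballI)
    show "(\<lambda>w. if \<tau> w \<le> u then 0 else \<eta> w) \<in> borel_measurable (F u)"
      using set h(1) by (intro measurable_If) auto
    fix w assume w: "w \<in> space M"
    have "0 \<le> c" using h(2) w by (meson abs_ge_zero order_trans)
    then show "\<bar>if \<tau> w \<le> u then 0 else \<eta> w\<bar> \<le> c" using h(2) w by auto
    show "S (min v (\<tau> w)) w - S (min u (\<tau> w)) w = (if \<tau> w \<le> u then 0 else \<eta> w) * (W v w - W u w)"
      using gap[OF w] uv h(3) w by (auto simp: min_def)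
    show "(if s \<le> \<tau> w then H s w else 0) = (if \<tau> w \<le> u then 0 else \<eta> w)" if "s \<in> {u<..v}" for s
      using gap[OF w] h(3) w that by auto
  qed
qed

text \<open>Rounding up does not anticipate: the rounded time is at most \<open>u\<close> exactly
  when \<open>\<tau>\<close> is at most the largest grid point not exceeding \<open>u\<close>. The
  horizon \<open>T + 1\<close> absorbs the overshoot of at most one mesh, and boundedness leaves
  finitely many values.\<close>

lemma is_stopping_ceiling:
  fixes k :: nat
  assumes "is_stopping T \<tau>"
  defines "\<tau>' \<equiv> \<lambda>w. of_int \<lceil>real (Suc k) * \<tau> w\<rceil> / real (Suc k)"
  shows "is_stopping (T + 1) \<tau>'"
    and "\<exists>R. finite R \<and> (\<forall>w\<in>space M. \<tau>' w \<in> R)"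
proof -
  have b: "0 \<le> \<tau> w" "\<tau> w \<le> T" if "w \<in> space M" for w using assms that by (auto simp: is_stopping_def)
  have k: "1 / real (Suc k) \<le> 1" by simp
  show "is_stopping (T + 1) \<tau>'"
    unfolding is_stopping_def
  proof (intro conjI ballI allI impI)
    fix w assume w: "w \<in> space M"
    show "0 \<le> \<tau>' w" using b(1)[OF w] ceiling_grid_bounds(2)[where x = "\<tau> w" and k = k] by (simp add: \<tau>'_def)
    show "\<tau>' w \<le> T + 1" using b(2)[OF w] k ceiling_grid_bounds(1)[of k "\<tau> w"] unfolding \<tau>'_def by linarith
  next
    fix u :: real assume u: "0 \<le> u"
    let ?u = "of_int \<lfloor>real (Suc k) * u\<rfloor> / real (Suc k)"
    have "?u \<le> u" using of_int_floor_le[of "real (Suc k) * u"] by (simp add: field_simps del: of_nat_Suc)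
    have "\<tau>' w \<le> u \<longleftrightarrow> \<tau> w \<le> ?u" for w
    proof -
      have "\<tau>' w \<le> u \<longleftrightarrow> of_int \<lceil>real (Suc k) * \<tau> w\<rceil> \<le> real (Suc k) * u"
        by (simp add: \<tau>'_def field_simps del: of_nat_Suc)
      also have "\<dots> \<longleftrightarrow> real (Suc k) * \<tau> w \<le> of_int \<lfloor>real (Suc k) * u\<rfloor>"
        by (simp add: le_floor_iff[symmetric] ceiling_le_iff del: of_nat_Suc)
      also have "\<dots> \<longleftrightarrow> \<tau> w \<le> ?u" by (simp add: field_simps del: of_nat_Suc)
      finally show ?thesis .
    qed
    moreover have "{w\<in>space M. \<tau> w \<le> ?u} \<in> sets (F ?u)"
      using assms(1) u by (auto simp: is_stopping_def)
    ultimately show "{w\<in>space M. \<tau>' w \<le> u} \<in> sets (F u)"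
      using sets_F_mono[OF \<open>?u \<le> u\<close>] by auto
  qed
  let ?R = "(\<lambda>i::int. of_int i / real (Suc k)) ` {0..\<lceil>real (Suc k) * T\<rceil>}"
  have "\<tau>' w \<in> ?R" if "w \<in> space M" for w
  proof -
    have "real (Suc k) * \<tau> w \<le> real (Suc k) * T" "0 \<le> real (Suc k) * \<tau> w"
      using b[OF that] by (auto intro!: mult_left_mono mult_nonneg_nonneg simp del: of_nat_Suc)
    then have "\<lceil>real (Suc k) * \<tau> w\<rceil> \<in> {0..\<lceil>real (Suc k) * T\<rceil>}"
      using ceiling_mono by (simp only: atLeastAtMost_iff) (linarith)
    then show ?thesis unfolding \<tau>'_def by (rule imageI)
  qed
  then show "\<exists>R. finite R \<and> (\<forall>w\<in>space M. \<tau>' w \<in> R)"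
    by (intro exI[of _ ?R]) blast
qed

text \<open>Elementary integrals can be stopped at finitely valued times, so \<open>\<tau>\<close>
  is approximated from above by its roundings. The energy error consists of the old approximation
  error and the energy of \<open>H\<close> between \<open>\<tau>\<close> and its rounding, which
  vanishes by dominated convergence; uniform convergence of the stopped paths follows from uniform
  continuity of \<open>I\<close> on \<open>{0..T}\<close>.\<close>

lemma ito_stop:
  assumes ito: "ito T H I" and \<tau>: "is_stopping T \<tau>"
  shows "ito T (\<lambda>s w. if s \<le> \<tau> w then H s w else 0) (\<lambda>s w. I (min s (\<tau> w)) w)"
proof -
  obtain P H' S where el: "\<And>k. elementary (P k) (H' k) (S k)"
    and lim: "AE w in M. (\<lambda>k. energy (\<lambda>s w. H' k s w - H s w) T w) \<longlonglongrightarrow> 0 \<and>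
        uniform_limit {0..T} (\<lambda>k s. S k s w) (\<lambda>s. I s w) sequentially"
    using ito unfolding ito_def by blast
  have Hm: "jointly_measurable H"
    and fin: "AE w in M. energy H T w < \<infinity>"
    and Im: "\<And>s. 0 \<le> s \<Longrightarrow> I s \<in> borel_measurable M" "\<And>w. w \<in> space M \<Longrightarrow> continuous_on {0..} (\<lambda>s. I s w)"
    using ito by (auto simp: ito_def)
  have b: "0 \<le> \<tau> w" "\<tau> w \<le> T" if "w \<in> space M" for w using \<tau> that by (auto simp: is_stopping_def)
  note \<tau>m = is_stopping_measurable[OF \<tau>]
  define \<tau>' where "\<tau>' k w = of_int \<lceil>real (Suc k) * \<tau> w\<rceil> / real (Suc k)" for k :: nat and w
  have \<tau>'_le: "\<tau>' k w \<le> \<tau> w + 1 / real (Suc k)" and \<tau>'_ge: "\<tau> w \<le> \<tau>' k w" for k w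
    using ceiling_grid_bounds[where k = k and x = "\<tau> w"] unfolding \<tau>'_def by linarith+
  have st: "is_stopping (T + 1) (\<tau>' k)" and "\<exists>R. finite R \<and> (\<forall>w\<in>space M. \<tau>' k w \<in> R)" for k
    using is_stopping_ceiling[OF \<tau>, of k] unfolding \<tau>'_def by blast+
  then obtain R where R: "\<And>k. finite (R k)" "\<And>k w. w \<in> space M \<Longrightarrow> \<tau>' k w \<in> R k" by metis
  show ?thesis
    unfolding ito_def
  proof (intro conjI allI impI ballI exI)
    show "(\<lambda>(s, w). if s \<le> \<tau> w then H s w else 0) \<in> borel_measurable (borel \<Otimes>\<^sub>M M)"
      by (rule stopped_integrand_measurable[OF Hm \<tau>m])
    show "(\<lambda>w. I (min s (\<tau> w)) w) \<in> borel_measurable M" if "0 \<le> s" for s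
      by (rule measurable_continuous_random_time) (use Im \<tau>m b that in auto)
    show "continuous_on {0..} (\<lambda>s. I (min s (\<tau> w)) w)" if "w \<in> space M" for w
      using Im(2)[OF that] b(1)[OF that] by (rule continuous_on_stopped)
    show "AE w in M. energy (\<lambda>s w. if s \<le> \<tau> w then H s w else 0) T w < \<infinity>"
      using fin
    proof eventually_elim
      case (elim w)
      have "energy (\<lambda>s w. if s \<le> \<tau> w then H s w else 0) T w \<le> energy H T w"
        by (intro nn_integral_mono) (auto simp: indicator_def)
      then show ?case using elim by (rule order_le_less_trans)
    qed
    show "elementary (P k \<union> R k) (\<lambda>s w. if s \<le> \<tau>' k w then H' k s w else 0)
        (\<lambda>s w. S k (min s (\<tau>' k w)) w)" for k
      by (rule elementary_stop[OF el st R])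
    show "AE w in M. (\<lambda>k. energy (\<lambda>s w. (if s \<le> \<tau>' k w then H' k s w else 0) - (if s \<le> \<tau> w then H s w else 0)) T w)
          \<longlonglongrightarrow> 0 \<and>
        uniform_limit {0..T} (\<lambda>k s. S k (min s (\<tau>' k w)) w) (\<lambda>s. I (min s (\<tau> w)) w) sequentially"
      using lim fin AE_space
    proof eventually_elim
      case (elim w)
      then have w: "w \<in> space M" by simp
      let ?a = "\<lambda>k. energy (\<lambda>s w. H' k s w - H s w) T w"
      let ?h = "\<lambda>k s. ennreal ((H s w)\<^sup>2) * indicator {0..T} s * indicator {\<tau> w<..\<tau>' k w} s"
      note [measurable] = path_measurable[OF Hm w] path_measurable[OF elementary_measurable[OF el] w]
      have ennreal_split: "ennreal (x + y * 2 + x) = ennreal x + ennreal y * 2 + ennreal x"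
        if "0 \<le> x" "0 \<le> y" for x y :: real
      proof -
        have "ennreal (x + y * 2 + x) = ennreal (x + y * 2) + ennreal x"
          using that by (intro ennreal_plus) auto
        also have "ennreal (x + y * 2) = ennreal x + ennreal (y * 2)"
          using that by (intro ennreal_plus) auto
        finally show ?thesis using that by (simp add: ennreal_mult)
      qed
      let ?e = "\<lambda>k. energy (\<lambda>s w. (if s \<le> \<tau>' k w then H' k s w else 0) - (if s \<le> \<tau> w then H s w else 0)) T w"
      \<comment> \<open>Up to \<open>\<tau>\<close> the integrand of the error is that of the
        unstopped approximation; between \<open>\<tau>\<close> and \<open>\<tau>'\<close> only
        \<open>H' k\<close> survives, bounded by 2 (H' - H)^2 + 2 H^2; afterwards both
        vanish.\<close>
      have bound: "?e k
          \<le> ?a k + (\<integral>\<^sup>+s. ?h k s \<partial>lborel) * 2 + ?a k" for k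
      proof -
        have "?e k \<le> (\<integral>\<^sup>+s. ennreal ((H' k s w - H s w)\<^sup>2) * indicator {0..T} s + ?h k s * 2
            + ennreal ((H' k s w - H s w)\<^sup>2) * indicator {0..T} s \<partial>lborel)"
        proof (rule nn_integral_mono)
          fix s
          have "(H' k s w)\<^sup>2 \<le> (H' k s w - H s w)\<^sup>2 + (H s w)\<^sup>2 * 2 + (H' k s w - H s w)\<^sup>2"
            using power2_le_weighted[of 1 "H' k s w" "H s w"] by simp
          from ennreal_leI[OF this]
          have "ennreal ((H' k s w)\<^sup>2) \<le> ennreal ((H' k s w - H s w)\<^sup>2) + ennreal ((H s w)\<^sup>2) * 2
             + ennreal ((H' k s w - H s w)\<^sup>2)"
            unfolding ennreal_split[OF zero_le_power2 zero_le_power2] .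
          moreover have "ennreal x \<le> ennreal x + y + ennreal x" for x y
            by (simp add: add.assoc)
          ultimately show "ennreal (((if s \<le> \<tau>' k w then H' k s w else 0) - (if s \<le> \<tau> w then H s w else 0))\<^sup>2) * indicator {0..T} s
             \<le> ennreal ((H' k s w - H s w)\<^sup>2) * indicator {0..T} s + ?h k s * 2
            + ennreal ((H' k s w - H s w)\<^sup>2) * indicator {0..T} s"
            using \<tau>'_ge[of w k]
            by (cases "s \<in> {0..T}"; cases "s \<le> \<tau> w"; cases "s \<le> \<tau>' k w") simp_all
        qed
        also have "\<dots> = ?a k + (\<integral>\<^sup>+s. ?h k s \<partial>lborel) * 2 + ?a k"
          by (simp add: nn_integral_add nn_integral_multc)
        finally show ?thesis .
      qed
      have "(\<lambda>k. \<integral>\<^sup>+s. ?h k s \<partial>lborel) \<longlonglongrightarrow> (\<integral>\<^sup>+s. 0 \<partial>(lborel :: real measure))"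
      proof (rule nn_integral_dominated_convergence[where w="\<lambda>s. ennreal ((H s w)\<^sup>2) * indicator {0..T} s"])
        show "AE s in lborel. (\<lambda>k. ?h k s) \<longlonglongrightarrow> 0"
        proof (rule AE_I2)
          fix s
          have "eventually (\<lambda>k. ?h k s = 0) sequentially"
          proof (cases "\<tau> w < s")
            case True
            have "eventually (\<lambda>k. 1 / real (Suc k) < s - \<tau> w) sequentially"
              using True by (intro order_tendstoD(2)[OF LIMSEQ_Suc[OF lim_1_over_n]]) simp
            then show ?thesis
            proof eventually_elim
              case (elim k)
              then have "\<not> s \<le> \<tau>' k w" using \<tau>'_le[of k w] by linarith
              then show ?case by simp
            qed
          qed simp
          then show "(\<lambda>k. ?h k s) \<longlonglongrightarrow> 0" by (rule tendsto_eventually)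
        qed
        show "AE s in lborel. ?h k s \<le> ennreal ((H s w)\<^sup>2) * indicator {0..T} s" for k
          by (auto simp: indicator_def)
      qed (use elim in auto)
      then have "(\<lambda>k. 2 * (\<integral>\<^sup>+s. ?h k s \<partial>lborel)) \<longlonglongrightarrow> 2 * 0"
        by (intro ennreal_tendsto_cmult) auto
      then have "(\<lambda>k. (\<integral>\<^sup>+s. ?h k s \<partial>lborel) * 2) \<longlonglongrightarrow> 0"
        by (simp add: mult.commute)
      then have "(\<lambda>k. ?a k + (\<integral>\<^sup>+s. ?h k s \<partial>lborel) * 2 + ?a k) \<longlonglongrightarrow> 0 + 0 + 0"
        using elim by (intro tendsto_add) auto
      then have l: "(\<lambda>k. ?a k + (\<integral>\<^sup>+s. ?h k s \<partial>lborel) * 2 + ?a k) \<longlonglongrightarrow> 0" by simp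
      have 1: "(\<lambda>k. ?e k)
          \<longlonglongrightarrow> 0"
        by (rule tendsto_sandwich[OF _ _ tendsto_const l]) (intro always_eventually allI zero_le, intro always_eventually allI bound)
      have 2: "uniform_limit {0..T} (\<lambda>k s. S k (min s (\<tau>' k w)) w) (\<lambda>s. I (min s (\<tau> w)) w) sequentially"
      proof (rule uniform_limitI)
        fix e :: real assume e: "0 < e"
        have "uniformly_continuous_on {0..T} (\<lambda>s. I s w)"
          by (rule compact_uniformly_continuous) (auto intro: continuous_on_subset[OF Im(2)[OF w]])
        then obtain d where d: "0 < d" "\<And>x y. x \<in> {0..T} \<Longrightarrow> y \<in> {0..T} \<Longrightarrow> dist y x < d \<Longrightarrow> dist (I y w) (I x w) < e / 2"
          unfolding uniformly_continuous_on_def using e by (metis half_gt_zero)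
        have ev1: "eventually (\<lambda>k. \<forall>s\<in>{0..T}. dist (S k s w) (I s w) < e / 2) sequentially"
          using elim e by (intro uniform_limitD) auto
        have ev2: "eventually (\<lambda>k. 1 / real (Suc k) < d) sequentially"
          using d(1) by (rule order_tendstoD(2)[OF LIMSEQ_Suc[OF lim_1_over_n]])
        show "\<forall>\<^sub>F k in sequentially. \<forall>s\<in>{0..T}. dist (S k (min s (\<tau>' k w)) w) (I (min s (\<tau> w)) w) < e"
          using ev1 ev2
        proof eventually_elim
          case (elim k)
          show ?case
          proof
            fix s assume s: "s \<in> {0..T}"
            have in1: "min s (\<tau>' k w) \<in> {0..T}" "min s (\<tau> w) \<in> {0..T}"
              using s b[OF w] \<tau>'_ge[of w k] by auto
            have "dist (min s (\<tau>' k w)) (min s (\<tau> w)) < d"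
              using elim(2) \<tau>'_ge[of w k] \<tau>'_le[of k w] by (auto simp: dist_real_def min_def)
            from d(2)[OF in1(2,1) this] elim(1) in1(1)
            show "dist (S k (min s (\<tau>' k w)) w) (I (min s (\<tau> w)) w) < e"
              using dist_triangle_half_r[of "I (min s (\<tau>' k w)) w" "S k (min s (\<tau>' k w)) w" e "I (min s (\<tau> w)) w"]
              by (simp add: dist_commute)
          qed
        qed
      qed
      show ?case using 1 2 by blast
    qed
  qed
qed

end

section \<open>Path regularity and hitting times\<close>

lemma running_sup_upper:
  assumes "bdd_above ((\<lambda>s. \<bar>Z s w\<bar>) ` {0..T})" "0 \<le> s" "s \<le> T"
  shows "\<bar>Z s w\<bar> \<le> running_sup Z T w"
  unfolding running_sup_def by (rule cSUP_upper[OF _ assms(1)]) (use assms in auto)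

text \<open>The bridge between the real supremum of the final statement and the extended-real
  supremum used in the integrals. Boundedness is essential, because a real supremum carries no
  information on an unbounded set.\<close>

lemma SUP_power2_eq_running_sup:
  assumes bdd: "bdd_above ((\<lambda>s. \<bar>Z s w\<bar>) ` {0..T})" and T: "0 \<le> T"
  shows "(SUP s\<in>{0..T}. ennreal ((Z s w)\<^sup>2)) = ennreal ((running_sup Z T w)\<^sup>2)"
    and "0 \<le> running_sup Z T w"
proof -
  show nn: "0 \<le> running_sup Z T w"
    using running_sup_upper[of Z w T 0, OF bdd] T by simp
  let ?c = "SUP s\<in>{0..T}. ennreal ((Z s w)\<^sup>2)"
  have le: "?c \<le> ennreal ((running_sup Z T w)\<^sup>2)"
  proof (rule SUP_least)
    fix s assume "s \<in> {0..T}"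
    then have "\<bar>Z s w\<bar> \<le> running_sup Z T w" by (intro running_sup_upper[of Z, OF bdd]) auto
    from power_mono[OF this abs_ge_zero, of 2]
    show "ennreal ((Z s w)\<^sup>2) \<le> ennreal ((running_sup Z T w)\<^sup>2)" by (intro ennreal_leI) simp
  qed
  then obtain x where x: "0 \<le> x" "?c = ennreal x"
    by (cases ?c) (auto simp: top_unique)
  have "running_sup Z T w \<le> sqrt x"
    unfolding running_sup_def
  proof (rule cSUP_least)
    fix s assume s: "s \<in> {0..T}"
    have "ennreal ((Z s w)\<^sup>2) \<le> ?c" using s by (rule SUP_upper)
    then have "(Z s w)\<^sup>2 \<le> x" using x by simp
    then show "\<bar>Z s w\<bar> \<le> sqrt x" using real_sqrt_le_mono by fastforce
  qed (use T in auto)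
  then have "(running_sup Z T w)\<^sup>2 \<le> x"
    using power_mono[OF _ nn, of "sqrt x" 2] x by simp
  then show "?c = ennreal ((running_sup Z T w)\<^sup>2)" using le unfolding x by (simp add: antisym)
qed

lemma bdd_above_continuous_path:
  fixes Z :: "real \<Rightarrow> 'a \<Rightarrow> real"
  assumes "continuous_on {0..} (\<lambda>s. Z s w)"
  shows "bdd_above ((\<lambda>s. \<bar>Z s w\<bar>) ` {0..T})"
proof -
  have "compact ((\<lambda>s. \<bar>Z s w\<bar>) ` {0..T})"
    by (rule compact_continuous_image) (auto intro!: continuous_on_rabs continuous_on_subset[OF assms])
  then show ?thesis by (intro bounded_imp_bdd_above compact_imp_bounded)
qed

text \<open>One-sided limits bound the path near every point, and bisection joins the local bounds.
  The local condition admits intervals that reach below 0, where nothing is known about the path;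
  hence the clause \<open>0 \<le> y\<close> in the predicate.\<close>

lemma bdd_above_cadlag_path:
  fixes f :: "real \<Rightarrow> real"
  assumes right: "\<And>t. 0 \<le> t \<Longrightarrow> (f \<longlongrightarrow> f t) (at_right t)"
    and left: "\<And>t. 0 < t \<Longrightarrow> \<exists>l. (f \<longlongrightarrow> l) (at_left t)"
    and T: "0 \<le> T"
  shows "bdd_above ((\<lambda>s. \<bar>f s\<bar>) ` {0..T})"
proof -
  have "\<exists>B. \<forall>y. 0 \<le> y \<and> y \<in> {0..T} \<longrightarrow> \<bar>f y\<bar> \<le> B"
  proof (rule Bolzano[where P = "\<lambda>a b. \<exists>B. \<forall>y. 0 \<le> y \<and> y \<in> {a..b} \<longrightarrow> \<bar>f y\<bar> \<le> B", OF T])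
    fix a b c :: real
    assume "\<exists>B. \<forall>y. 0 \<le> y \<and> y \<in> {a..b} \<longrightarrow> \<bar>f y\<bar> \<le> B" "\<exists>B. \<forall>y. 0 \<le> y \<and> y \<in> {b..c} \<longrightarrow> \<bar>f y\<bar> \<le> B"
    then obtain B B' where "\<forall>y. 0 \<le> y \<and> y \<in> {a..b} \<longrightarrow> \<bar>f y\<bar> \<le> B" "\<forall>y. 0 \<le> y \<and> y \<in> {b..c} \<longrightarrow> \<bar>f y\<bar> \<le> B'"
      by blast
    then have "\<bar>f y\<bar> \<le> max B B'" if "0 \<le> y \<and> y \<in> {a..c}" for y
      using that by (cases "y \<le> b") (auto simp: le_max_iff_disj)
    then show "\<exists>B. \<forall>y. 0 \<le> y \<and> y \<in> {a..c} \<longrightarrow> \<bar>f y\<bar> \<le> B" by blast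
  next
    fix x assume x: "0 \<le> x" "x \<le> T"
    have "eventually (\<lambda>y. dist (f y) (f x) < 1) (at_right x)"
      by (rule tendstoD[OF right[OF x(1)]]) simp
    then obtain r where r: "x < r" "\<And>y. x < y \<Longrightarrow> y < r \<Longrightarrow> dist (f y) (f x) < 1"
      unfolding eventually_at_right_field by blast
    obtain q l where q: "q < x" "\<And>y. 0 \<le> y \<Longrightarrow> q < y \<Longrightarrow> y < x \<Longrightarrow> \<bar>f y\<bar> \<le> \<bar>l\<bar> + 1"
    proof (cases "x = 0")
      case True
      \<comment> \<open>At the origin there is no admissible \<open>y\<close> to the left, so the
        values -1 and 0 are placeholders.\<close>
      then show ?thesis using that[of "-1" 0] by simp
    next
      case False
      then obtain l where "(f \<longlongrightarrow> l) (at_left x)" using left x by force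
      then have "eventually (\<lambda>y. dist (f y) l < 1) (at_left x)" by (rule tendstoD) simp
      then obtain q where "q < x" "\<And>y. q < y \<Longrightarrow> y < x \<Longrightarrow> dist (f y) l < 1"
        unfolding eventually_at_left_field by blast
      then show ?thesis using that[of q l] by (fastforce simp: dist_real_def)
    qed
    have "\<bar>f y\<bar> \<le> \<bar>l\<bar> + \<bar>f x\<bar> + 1"
      if ab: "a \<le> x \<and> x \<le> b \<and> b - a < min (r - x) (x - q)" and y: "0 \<le> y \<and> y \<in> {a..b}" for a b y
    proof -
      consider "y < x" | "y = x" | "x < y" by linarith
      then show ?thesis
      proof cases
        case 1
        then have "q < y" using ab y by auto
        then show ?thesis using q(2)[of y] y 1 by auto
      next
        case 3
        then have "y < r" using ab y by auto
        then show ?thesis using r(2)[of y] 3 by (auto simp: dist_real_def)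
      qed auto
    qed
    moreover have "0 < min (r - x) (x - q)" using r q by simp
    ultimately show "\<exists>d>0. \<forall>a b. a \<le> x \<and> x \<le> b \<and> b - a < d \<longrightarrow> (\<exists>B. \<forall>y. 0 \<le> y \<and> y \<in> {a..b} \<longrightarrow> \<bar>f y\<bar> \<le> B)"
      by blast
  qed
  then obtain B where "\<forall>y. 0 \<le> y \<and> y \<in> {0..T} \<longrightarrow> \<bar>f y\<bar> \<le> B" by blast
  then show ?thesis by (intro bdd_aboveI2[of _ _ B]) auto
qed

text \<open>At stage \<open>n\<close> an index is chosen for which both variables exceed 2^-n with
  probability below 2^-n; Borel-Cantelli does the rest. Treating the two sequences together provides
  one choice of indices for energies and paths.\<close>

lemma tendsto_zero_in_prob_AE_subsequence:
  assumes "prob_space M"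
    and Y: "tendsto_zero_in_prob M Y" "\<And>k. Y k \<in> borel_measurable M"
    and Z: "tendsto_zero_in_prob M Z" "\<And>k. Z k \<in> borel_measurable M"
  shows "\<exists>r :: nat \<Rightarrow> nat. AE w in M. (\<lambda>k. Y (r k) w) \<longlonglongrightarrow> 0 \<and> (\<lambda>k. Z (r k) w) \<longlonglongrightarrow> 0"
proof -
  interpret prob_space M by fact
  note [measurable] = Y(2) Z(2)
  let ?A = "\<lambda>X n k. {w\<in>space M. ennreal ((1/2)^n) < X k w}"
  have "\<exists>k. measure M (?A Y n k) < (1/2)^n \<and> measure M (?A Z n k) < (1/2)^n" for n
  proof -
    have "eventually (\<lambda>k. measure M (?A X n k) < (1/2)^n) sequentially" if "tendsto_zero_in_prob M X" for X
      using that by (intro order_tendstoD(2)[where y = "0::real"]) (simp_all add: tendsto_zero_in_prob_def)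
    from this[OF Y(1)] this[OF Z(1)]
    have "eventually (\<lambda>k. measure M (?A Y n k) < (1/2)^n \<and> measure M (?A Z n k) < (1/2)^n) sequentially"
      by (rule eventually_conj)
    then show ?thesis by (rule eventually_happens'[OF sequentially_bot])
  qed
  then have "\<forall>n. \<exists>k. measure M (?A Y n k) < (1/2)^n \<and> measure M (?A Z n k) < (1/2)^n" by blast
  from choice[OF this] obtain r
    where r: "\<And>n. measure M (?A Y n (r n)) < (1/2)^n" "\<And>n. measure M (?A Z n (r n)) < (1/2)^n"
    by blast
  let ?B = "\<lambda>n. ?A Y n (r n) \<union> ?A Z n (r n)"
  have "AE w in M. eventually (\<lambda>n. w \<in> space M - ?B n) sequentially"
  proof (rule borel_cantelli_AE1)
    show "?B n \<in> sets M" for n by measurable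
    show "emeasure M (?B n) < \<infinity>" for n by (simp add: less_top[symmetric])
    show "summable (\<lambda>n. measure M (?B n))"
    proof (rule summable_comparison_test')
      show "summable (\<lambda>n. 2 * (1/2)^n :: real)" by (intro summable_mult summable_geometric) simp
      fix n
      have "measure M (?B n) \<le> measure M (?A Y n (r n)) + measure M (?A Z n (r n))"
        by (rule measure_Un_le) measurable
      then show "norm (measure M (?B n)) \<le> 2 * (1/2)^n" using r[of n] by simp
    qed
  qed
  then have "AE w in M. (\<lambda>k. Y (r k) w) \<longlonglongrightarrow> 0 \<and> (\<lambda>k. Z (r k) w) \<longlonglongrightarrow> 0"
  proof eventually_elim
    case (elim w)
    have l: "(\<lambda>n. ennreal ((1/2)^n)) \<longlonglongrightarrow> 0"
      using tendsto_ennrealI[OF LIMSEQ_realpow_zero[of "1/2"]] by simp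
    have "eventually (\<lambda>n. Y (r n) w \<le> ennreal ((1/2)^n)) sequentially"
      "eventually (\<lambda>n. Z (r n) w \<le> ennreal ((1/2)^n)) sequentially"
      using elim by (auto elim!: eventually_mono simp: not_less)
    then show ?case
      by (intro conjI tendsto_sandwich[OF _ _ tendsto_const l]) auto
  qed
  then show ?thesis by blast
qed

section \<open>From integrals in probability to almost sure limits; hitting times\<close>

context brownian_setting
begin

text \<open>An interval without partition points in its interior is either covered by a cell or
  misses it, so the step value is the sum of the coefficients of the covering cells. Degenerate
  cells with equal endpoints are allowed and cover nothing.\<close>

lemma simple_integrand_elementary:
  assumes "simple_integrand F m p \<xi>"
  shows "elementary (p ` {..m}) (simple_process m p \<xi>) (simple_integral W m p \<xi>)"
proof -
  have p0: "0 \<le> p 0" and pS: "\<And>i. i < m \<Longrightarrow> p i \<le> p (Suc i)"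
    and \<xi>m: "\<And>i. i < m \<Longrightarrow> \<xi> i \<in> borel_measurable (F (p i))"
    and ex: "\<And>i. i < m \<Longrightarrow> \<exists>c. \<forall>w\<in>space M. \<bar>\<xi> i w\<bar> \<le> c"
    using assms by (auto simp: simple_integrand_def)
  obtain c where c: "\<And>i w. i < m \<Longrightarrow> w \<in> space M \<Longrightarrow> \<bar>\<xi> i w\<bar> \<le> c i" using ex by metis
  have pn: "0 \<le> p i" if "i \<le> m" for i
    using that
  proof (induction i)
    case (Suc i)
    then show ?case using pS[of i] by simp
  qed (use p0 in simp)
  have \<xi>M: "\<xi> i \<in> borel_measurable M" if "i < m" for i
    using \<xi>m[OF that] by (rule measurable_F_M)
  show ?thesis
    unfolding elementary_def
  proof (intro conjI allI impI ballI)
    show "(\<lambda>(s, w). simple_process m p \<xi> s w) \<in> borel_measurable (borel \<Otimes>\<^sub>M M)"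
      unfolding simple_process_def case_prod_beta'
      by (intro borel_measurable_sum borel_measurable_times measurable_compose[OF measurable_snd \<xi>M]
          measurable_compose[OF measurable_fst borel_measurable_indicator]) auto
    show "simple_integral W m p \<xi> s \<in> borel_measurable M" if "0 \<le> s" for s
    proof -
      have "(\<lambda>w. \<Sum>i<m. \<xi> i w * (W (min (p (Suc i)) s) w - W (min (p i) s) w)) \<in> borel_measurable M"
        using that pn by (intro borel_measurable_sum borel_measurable_times borel_measurable_diff \<xi>M W_measurable_M) auto
      then show ?thesis by (simp add: simple_integral_def[abs_def])
    qed
    fix w assume w: "w \<in> space M"
    show "simple_integral W m p \<xi> 0 w = 0"
      using pn by (simp add: simple_integral_def min_absorb2)
    have "continuous_on {0..} (\<lambda>s. W (min (p i) s) w)" if "i \<le> m" for i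
      using continuous_on_stopped[OF W_continuous[OF w] pn[OF that]] by (simp add: min.commute)
    then show "continuous_on {0..} (\<lambda>s. simple_integral W m p \<xi> s w)"
      unfolding simple_integral_def by (intro continuous_on_sum continuous_on_mult continuous_on_diff continuous_on_const) auto
  next
    fix u v assume uv: "0 \<le> u \<and> u < v \<and> p ` {..m} \<inter> {u<..<v} = {}"
    have cases: "p (Suc i) \<le> u \<or> v \<le> p i \<or> (p i \<le> u \<and> v \<le> p (Suc i))" if "i < m" for i
    proof -
      have "p i \<in> p ` {..m}" "p (Suc i) \<in> p ` {..m}" using that by auto
      then have "p i \<notin> {u<..<v}" "p (Suc i) \<notin> {u<..<v}" using uv by blast+
      then show ?thesis using pS[OF that] by auto
    qed
    let ?b = "\<lambda>i. p i \<le> u \<and> v \<le> p (Suc i)"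
    let ?\<eta> = "\<lambda>w. \<Sum>i<m. if ?b i then \<xi> i w else 0"
    have "?\<eta> \<in> borel_measurable (F u)"
    proof (intro borel_measurable_sum)
      fix i assume i: "i \<in> {..<m}"
      show "(\<lambda>w. if ?b i then \<xi> i w else 0) \<in> borel_measurable (F u)"
        using measurable_F_mono[OF \<xi>m, of i u] i by (cases "?b i") auto
    qed
    moreover have "\<forall>w\<in>space M. \<bar>?\<eta> w\<bar> \<le> (\<Sum>i<m. \<bar>c i\<bar>)"
    proof
      fix w assume w: "w \<in> space M"
      have "\<bar>?\<eta> w\<bar> \<le> (\<Sum>i<m. \<bar>if ?b i then \<xi> i w else 0\<bar>)" by (rule sum_abs)
      also have "\<dots> \<le> (\<Sum>i<m. \<bar>c i\<bar>)"
        using order_trans[OF c[OF _ w] abs_ge_self] by (intro sum_mono) auto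
      finally show "\<bar>?\<eta> w\<bar> \<le> (\<Sum>i<m. \<bar>c i\<bar>)" .
    qed
    moreover have "\<forall>w\<in>space M. (\<forall>s\<in>{u<..v}. simple_process m p \<xi> s w = ?\<eta> w) \<and>
      simple_integral W m p \<xi> v w - simple_integral W m p \<xi> u w = ?\<eta> w * (W v w - W u w)"
    proof (intro ballI conjI)
      fix w s assume "w \<in> space M" and s: "s \<in> {u<..v}"
      show "simple_process m p \<xi> s w = ?\<eta> w"
        unfolding simple_process_def
      proof (intro sum.cong refl)
        fix i assume "i \<in> {..<m}"
        then have "i < m" by simp
        from cases[OF this] show "\<xi> i w * indicator {p i<..p (Suc i)} s = (if ?b i then \<xi> i w else 0)"
          using s uv by (auto simp: indicator_def)
      qed
    next
      fix w assume "w \<in> space M"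
      show "simple_integral W m p \<xi> v w - simple_integral W m p \<xi> u w = ?\<eta> w * (W v w - W u w)"
        unfolding simple_integral_def sum_subtractf[symmetric] sum_distrib_right
      proof (intro sum.cong refl)
        fix i assume "i \<in> {..<m}"
        then have i: "i < m" by simp
        from cases[OF i] show "\<xi> i w * (W (min (p (Suc i)) v) w - W (min (p i) v) w) -
          \<xi> i w * (W (min (p (Suc i)) u) w - W (min (p i) u) w) = (if ?b i then \<xi> i w else 0) * (W v w - W u w)"
          using uv pS[OF i] by (auto simp: min_def algebra_simps)
      qed
    qed
    ultimately show "\<exists>\<eta> c. step_by \<eta> c u v (simple_process m p \<xi>) (simple_integral W m p \<xi>)"
      by blast
  qed simp
qed

text \<open>Clamping the time into \<open>{0..T}\<close> extends measurability from the strip to the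
  whole line, and the indicator removes the artificial values outside.\<close>

lemma progressively_measurable_joint:
  assumes "progressively_measurable F H" "0 \<le> T"
  shows "(\<lambda>(s, w). H s w * indicator {0..T} s) \<in> borel_measurable (borel \<Otimes>\<^sub>M M)"
proof -
  let ?g = "\<lambda>s::real. max 0 (min T s)"
  have H: "(\<lambda>(s, w). H s w) \<in> borel_measurable (restrict_space borel {0..T} \<Otimes>\<^sub>M F T)"
    using assms by (auto simp: progressively_measurable_def)
  have id: "(\<lambda>w. w) \<in> measurable M (F T)"
    using sets_F_subset[of T] sets.sets_into_space[of _ M] by (intro measurableI) (auto simp: Int_absorb2)
  have g: "?g \<in> measurable borel (restrict_space borel {0..T})"
    using assms(2) by (intro measurable_restrict_space2) auto
  have "(\<lambda>x. (?g (fst x), snd x)) \<in> measurable (borel \<Otimes>\<^sub>M M) (restrict_space borel {0..T} \<Otimes>\<^sub>M F T)"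
    by (rule measurable_Pair[OF measurable_compose[OF measurable_fst g] measurable_compose[OF measurable_snd id]])
  from measurable_compose[OF this H]
  have [measurable]: "(\<lambda>x. H (?g (fst x)) (snd x)) \<in> borel_measurable (borel \<Otimes>\<^sub>M M)" by simp
  have "(\<lambda>x. H (?g (fst x)) (snd x) * indicator {0..T} (fst x)) \<in> borel_measurable (borel \<Otimes>\<^sub>M M)"
    by measurable
  then show ?thesis
    by (rule measurable_cong[THEN iffD1, rotated]) (auto simp: indicator_def)
qed

text \<open>Both convergences in probability become almost sure along common indices. The integrand
  is cut to \<open>{0..T}\<close> because progressive measurability controls it only there, whereas
  \<open>ito\<close> asks for joint measurability at all times; energies up to \<open>T\<close> do
  not see the cut.\<close>

lemma ito_of_is_ito_integral:
  assumes ito: "is_ito_integral M F W H I" and T: "0 \<le> T"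
  shows "ito T (\<lambda>s w. H s w * indicator {0..T} s) I"
proof -
  let ?H = "\<lambda>s w. H s w * indicator {0..T} s"
  obtain m p \<xi> where si: "\<And>k. simple_integrand F (m k) (p k) (\<xi> k)"
    and l1: "tendsto_zero_in_prob M (\<lambda>k. energy (\<lambda>s w. simple_process (m k) (p k) (\<xi> k) s w - H s w) T)"
    and l2: "tendsto_zero_in_prob M (\<lambda>k w.
             ennreal (running_sup (\<lambda>s w. simple_integral W (m k) (p k) (\<xi> k) s w - I s w) T w))"
    using ito T unfolding is_ito_integral_def by blast
  let ?S = "\<lambda>k. simple_integral W (m k) (p k) (\<xi> k)" and ?K = "\<lambda>k. simple_process (m k) (p k) (\<xi> k)"
  note el = simple_integrand_elementary[OF si]
  have Hm: "jointly_measurable ?H"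
    using ito T by (intro progressively_measurable_joint) (auto simp: is_ito_integral_def)
  have I: "I s \<in> borel_measurable M" if "0 \<le> s" for s
    using ito that measurable_F_M[of "I s" s] by (auto simp: is_ito_integral_def adapted_def)
  have Ic: "continuous_on {0..} (\<lambda>s. I s w)" if "w \<in> space M" for w
    using ito that by (auto simp: is_ito_integral_def continuous_paths_def)
  have en_eq: "energy (\<lambda>s w. ?K k s w - H s w) T = energy (\<lambda>s w. ?K k s w - ?H s w) T" for k
    by (intro ext nn_integral_cong) (auto simp: indicator_def)
  have en_eq2: "energy H T w = energy ?H T w" for w
    by (intro nn_integral_cong) (auto simp: indicator_def)
  have Dm: "(\<lambda>(s, w). ?K k s w - ?H s w) \<in> borel_measurable (borel \<Otimes>\<^sub>M M)" for k
    using borel_measurable_diff[OF elementary_measurable[OF el[of k]] Hm] by (simp add: case_prod_beta')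
  have Dc: "continuous_on {0..} (\<lambda>s. ?S k s w - I s w)" if "w \<in> space M" for k w
    by (intro continuous_on_diff elementary_integral_continuous[OF el] Ic that)
  have Dbdd: "bdd_above ((\<lambda>s. \<bar>?S k s w - I s w\<bar>) ` {0..T})" if "w \<in> space M" for k w
    using bdd_above_continuous_path[of "\<lambda>s w. ?S k s w - I s w", OF Dc[OF that]] .
  note rs_eq = SUP_power2_eq_running_sup[where Z = "\<lambda>s w. ?S k s w - I s w" for k, OF Dbdd T]
  \<comment> \<open>Borel-Cantelli needs measurable exceedance events; the running supremum is
    measurable as the root of the extended-real supremum of squares.\<close>
  have rs: "(\<lambda>w. ennreal (running_sup (\<lambda>s w. ?S k s w - I s w) T w)) \<in> borel_measurable M" for k
  proof -
    have [measurable]: "sup_sq (\<lambda>s w. ?S k s w - I s w) T \<in> borel_measurable M"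
      by (intro sup_sq_measurable borel_measurable_diff elementary_integral_measurable[OF el] I Dc)
    have "(\<lambda>w. ennreal (sqrt (enn2real (sup_sq (\<lambda>s w. ?S k s w - I s w) T w)))) \<in> borel_measurable M"
      by measurable
    then show ?thesis
      by (rule measurable_cong[THEN iffD1, rotated])
        (simp add: rs_eq)
  qed
  obtain r where r: "AE w in M. (\<lambda>k. energy (\<lambda>s w. ?K (r k) s w - ?H s w) T w) \<longlonglongrightarrow> 0 \<and>
       (\<lambda>k. ennreal (running_sup (\<lambda>s w. ?S (r k) s w - I s w) T w)) \<longlonglongrightarrow> 0"
    using tendsto_zero_in_prob_AE_subsequence[OF prob_space_axioms l1[unfolded en_eq] _ l2 rs]
      energy_measurable[OF Dm] by blast
  show ?thesis
    unfolding ito_def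
  proof (intro conjI allI impI ballI exI)
    have "AE w in M. energy H T w < \<infinity>" using ito T by (auto simp: is_ito_integral_def)
    then show "AE w in M. energy ?H T w < \<infinity>" by (simp only: en_eq2)
    show "elementary (p (r k) ` {..m (r k)}) (?K (r k)) (?S (r k))" for k by (rule el)
    show "AE w in M. (\<lambda>k. energy (\<lambda>s w. ?K (r k) s w - ?H s w) T w) \<longlonglongrightarrow> 0 \<and>
       uniform_limit {0..T} (\<lambda>k s. ?S (r k) s w) (\<lambda>s. I s w) sequentially"
      using r AE_space
    proof eventually_elim
      case (elim w)
      have "uniform_limit {0..T} (\<lambda>k s. ?S (r k) s w) (\<lambda>s. I s w) sequentially"
      proof (rule uniform_limitI)
        fix e :: real assume e: "0 < e"
        then have "eventually (\<lambda>k. ennreal (running_sup (\<lambda>s w. ?S (r k) s w - I s w) T w) < ennreal e) sequentially"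
          using elim by (intro order_tendstoD(2)) auto
        then show "\<forall>\<^sub>F k in sequentially. \<forall>s\<in>{0..T}. dist (?S (r k) s w) (I s w) < e"
        proof eventually_elim
          case (elim k)
          then have lt: "running_sup (\<lambda>s w. ?S (r k) s w - I s w) T w < e"
            using e by (simp add: ennreal_less_iff rs_eq(2)[OF \<open>w \<in> space M\<close>])
          show ?case
          proof
            fix s assume "s \<in> {0..T}"
            then have "\<bar>?S (r k) s w - I s w\<bar> \<le> running_sup (\<lambda>s w. ?S (r k) s w - I s w) T w"
              using running_sup_upper[of "\<lambda>s w. ?S (r k) s w - I s w", OF Dbdd[OF \<open>w \<in> space M\<close>]] by simp
            with lt show "dist (?S (r k) s w) (I s w) < e" by (simp add: dist_real_def)
          qed
        qed
      qed
      with elim show ?case by blast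
    qed
  qed (use Hm I Ic in auto)
qed

text \<open>Inserting \<open>T\<close> keeps the set nonempty and the time bounded. The value
  \<open>T\<close> may mean that the level is never reached, which is why statements about the value
  at the hitting time assume that it is smaller than \<open>T\<close>.\<close>

definition hitting :: "(real \<Rightarrow> 'a \<Rightarrow> real) \<Rightarrow> real \<Rightarrow> real \<Rightarrow> 'a \<Rightarrow> real" where
  "hitting Z a T w = Inf (insert T {s\<in>{0..T}. a \<le> Z s w})"

lemma hitting_bounds:
  assumes "0 \<le> T"
  shows "0 \<le> hitting Z a T w" "hitting Z a T w \<le> T"
  unfolding hitting_def using assms by (auto intro!: cInf_greatest cInf_lower bdd_belowI[of _ 0])

lemma hitting_less:
  assumes "0 \<le> s" "s < hitting Z a T w" "0 \<le> T"
  shows "Z s w < a"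
proof (rule ccontr)
  assume "\<not> Z s w < a"
  moreover have "s \<le> T" using assms hitting_bounds(2)[of T Z a w] by simp
  ultimately have "hitting Z a T w \<le> s"
    unfolding hitting_def using assms by (intro cInf_lower) (auto intro!: bdd_belowI[of _ 0])
  with assms show False by simp
qed

lemma hitting_value:
  assumes c: "continuous_on {0..} (\<lambda>s. Z s w)" and T: "0 \<le> T" and less: "hitting Z a T w < T"
  shows "a \<le> Z (hitting Z a T w) w"
proof -
  let ?A = "{s\<in>{0..T}. a \<le> Z s w}"
  have ne: "?A \<noteq> {}"
  proof
    assume e: "?A = {}"
    from less show False unfolding hitting_def e by simp
  qed
  have bd: "bdd_below ?A" by (auto intro!: bdd_belowI[of _ 0])
  have "hitting Z a T w = inf T (Inf ?A)"
    unfolding hitting_def by (rule cInf_insert_If[THEN trans]) (use ne bd in auto)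
  then have eq: "hitting Z a T w = Inf ?A" using less by (auto simp: inf_real_def min_def split: if_splits)
  have "closed ?A"
    using continuous_closed_preimage[of "{0..T}" "\<lambda>s. Z s w" "{a..}"] continuous_on_subset[OF c, of "{0..T}"]
    by (auto simp: vimage_def Int_def)
  then have "Inf ?A \<in> ?A" using ne bd by (intro closed_contains_Inf) auto
  then show ?thesis by (simp add: eq)
qed

text \<open>For a continuous path the closed level is reached by time \<open>u < T\<close> exactly
  when the maximum over \<open>{0..u}\<close> is at least \<open>a\<close>, and this maximum is a
  countable supremum of variables known at \<open>u\<close>. So the filtration itself suffices,
  without right-continuity.\<close>

lemma is_stopping_hitting:
  assumes Zm: "\<And>s. 0 \<le> s \<Longrightarrow> Z s \<in> borel_measurable (F s)"
    and c: "\<And>w. w \<in> space M \<Longrightarrow> continuous_on {0..} (\<lambda>s. Z s w)" and T: "0 \<le> T"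
  shows "is_stopping T (hitting Z a T)"
  unfolding is_stopping_def
proof (intro conjI ballI allI impI)
  fix u :: real assume u: "0 \<le> u"
  show "{w\<in>space M. hitting Z a T w \<le> u} \<in> sets (F u)"
  proof (cases "T \<le> u")
    case True
    then have "{w\<in>space M. hitting Z a T w \<le> u} = space (F u)"
      using hitting_bounds(2)[OF T] by (auto intro: order_trans)
    then show ?thesis by (simp only: sets.top)
  next
    case False
    \<comment> \<open>The exponential carries the order of the reals into \<open>ennreal\<close>,
      where the measurability of suprema was proved.\<close>
    let ?X = "\<lambda>w. SUP s\<in>{0..u}. ennreal (exp (Z s w))"
    have X: "?X \<in> borel_measurable (F u)"
    proof (rule borel_measurable_SUP_right_continuous)
      fix s assume "0 \<le> s" "s \<le> u"
      then have [measurable]: "Z s \<in> borel_measurable (F u)" using measurable_F_mono[OF Zm] by blast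
      show "(\<lambda>w. ennreal (exp (Z s w))) \<in> borel_measurable (F u)" by measurable
    next
      fix w and s :: real assume "w \<in> space (F u)" "0 \<le> s"
      then show "((\<lambda>s. ennreal (exp (Z s w))) \<longlongrightarrow> ennreal (exp (Z s w))) (at_right s)"
        by (intro tendsto_ennrealI tendsto_exp continuous_on_imp_tendsto_at_right[OF c]) auto
    qed
    have "hitting Z a T w \<le> u \<longleftrightarrow> ennreal (exp a) \<le> ?X w" if w: "w \<in> space M" for w
    proof
      assume h: "hitting Z a T w \<le> u"
      have "a \<le> Z (hitting Z a T w) w"
        using h False by (intro hitting_value[of Z, OF c[OF w] T]) auto
      then show "ennreal (exp a) \<le> ?X w"
        using h hitting_bounds(1)[OF T] by (intro SUP_upper2[of "hitting Z a T w"] ennreal_leI) auto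
    next
      assume x: "ennreal (exp a) \<le> ?X w"
      obtain s where s: "s \<in> {0..u}" "\<And>r. r \<in> {0..u} \<Longrightarrow> Z r w \<le> Z s w"
        using continuous_attains_sup[of "{0..u}" "\<lambda>s. Z s w"] u continuous_on_subset[OF c[OF w], of "{0..u}"] by auto
      have "?X w \<le> ennreal (exp (Z s w))" using s(2) by (intro SUP_least ennreal_leI) auto
      with x have "ennreal (exp a) \<le> ennreal (exp (Z s w))" by (rule order_trans)
      then have "a \<le> Z s w" by simp
      then show "hitting Z a T w \<le> u" using hitting_less[of s Z a T w] s(1) T by force
    qed
    then have "{w\<in>space M. hitting Z a T w \<le> u} = {w\<in>space (F u). ennreal (exp a) \<le> ?X w}" by auto
    also have "\<dots> \<in> sets (F u)" using X by measurable
    finally show ?thesis .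
  qed
qed (use hitting_bounds[OF T] in auto)

end

section \<open>Gronwall and Skorokhod lemmas\<close>

text \<open>The inequality is iterated, starting from the a priori bound \<open>B\<close>. That
  finite bound is what makes the remainder vanish.\<close>

lemma gronwall_nn_integral:
  fixes f :: "real \<Rightarrow> ennreal"
  assumes a: "0 \<le> a" and k: "0 \<le> k" and B: "0 \<le> B"
    and bound: "\<And>t. 0 \<le> t \<Longrightarrow> t \<le> T \<Longrightarrow> f t \<le> ennreal B"
    and ineq: "\<And>t. 0 \<le> t \<Longrightarrow> t \<le> T \<Longrightarrow> f t \<le> ennreal a + ennreal k * (\<integral>\<^sup>+s\<in>{0..t}. f s \<partial>lborel)"
    and t: "0 \<le> t" "t \<le> T"
  shows "f t \<le> ennreal (a * exp (k * t))"
proof -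
  \<comment> \<open>The Picard iterates of the constant \<open>B\<close>: a partial exponential sum
    plus a remainder of order \<open>n\<close>. The derivative of \<open>P (Suc n)\<close> is
    \<open>k * P n\<close>, so each iteration is an exact integration.\<close>
  define P where "P n t = a * (\<Sum>i<n. (k * t) ^ i / fact i) + B * (k * t) ^ n / fact n" for n and t :: real
  have P_nonneg: "0 \<le> P n t" if "0 \<le> t" for n t
    using that a k B unfolding P_def by (intro add_nonneg_nonneg mult_nonneg_nonneg sum_nonneg divide_nonneg_nonneg zero_le_power) auto
  have P_deriv: "(P (Suc n) has_real_derivative k * P n t) (at t within S)" for n t S
  proof -
    have "((\<lambda>t. \<Sum>i<Suc n. (k * t) ^ i / fact i) has_real_derivative k * (\<Sum>i<n. (k * t) ^ i / fact i)) (at t within S)"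
    proof (induction n)
      case (Suc n)
      have "((\<lambda>t. (k * t) ^ Suc n / fact (Suc n)) has_real_derivative k * ((k * t) ^ n / fact n)) (at t within S)"
        by (rule derivative_eq_intros refl | simp add: field_simps del: of_nat_Suc)+
      from DERIV_add[OF Suc this] show ?case by (simp add: algebra_simps)
    qed simp
    from DERIV_cmult[OF this, of a]
    have 1: "((\<lambda>t. a * (\<Sum>i<Suc n. (k * t) ^ i / fact i)) has_real_derivative a * (k * (\<Sum>i<n. (k * t) ^ i / fact i))) (at t within S)" .
    have 2: "((\<lambda>t. B * (k * t) ^ Suc n / fact (Suc n)) has_real_derivative k * (B * (k * t) ^ n / fact n)) (at t within S)"
      by (rule derivative_eq_intros refl | simp add: field_simps del: of_nat_Suc)+
    from DERIV_add[OF 1 2] show ?thesis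
      unfolding P_def[abs_def] by (simp add: algebra_simps)
  qed
  have le_P: "f t \<le> ennreal (P n t)" if "0 \<le> t" "t \<le> T" for n t
    using that
  proof (induction n arbitrary: t)
    case 0
    then show ?case using bound[of t] by (simp add: P_def)
  next
    case (Suc n)
    have meas: "(\<lambda>s. k * P n s) \<in> borel_measurable borel"
      unfolding P_def by (intro borel_measurable_continuous_onI continuous_intros) auto
    have "f t \<le> ennreal a + ennreal k * (\<integral>\<^sup>+s\<in>{0..t}. f s \<partial>lborel)"
      using Suc.prems by (rule ineq)
    also have "\<dots> \<le> ennreal a + ennreal k * (\<integral>\<^sup>+s\<in>{0..t}. ennreal (P n s) \<partial>lborel)"
      using Suc by (intro add_left_mono mult_left_mono nn_integral_mono) (auto simp: indicator_def)
    also have "ennreal k * (\<integral>\<^sup>+s\<in>{0..t}. ennreal (P n s) \<partial>lborel) =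
        (\<integral>\<^sup>+s. ennreal (k * P n s) * indicator {0..t} s \<partial>lborel)"
    proof -
      have [measurable]: "P n \<in> borel_measurable borel"
        unfolding P_def[abs_def] by (intro borel_measurable_continuous_onI continuous_intros) auto
      show ?thesis
        using k by (subst nn_integral_cmult[symmetric])
          (auto intro!: nn_integral_cong simp: indicator_def ennreal_mult' )
    qed
    also have "\<dots> = ennreal (P (Suc n) t - P (Suc n) 0)"
      using meas P_deriv P_nonneg k Suc.prems by (intro nn_integral_FTC_Icc) auto
    also have "ennreal a + \<dots> = ennreal (P (Suc n) t)"
    proof -
      have "P (Suc n) 0 = a" by (simp add: P_def sum.lessThan_Suc_shift del: sum.lessThan_Suc)
      moreover have "P (Suc n) 0 \<le> P (Suc n) t"
        using Suc.prems P_deriv P_nonneg k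
        by (intro DERIV_nonneg_imp_nondecreasing[of 0 t "P (Suc n)"]) (auto intro!: exI mult_nonneg_nonneg)
      ultimately show ?thesis using a by (simp flip: ennreal_plus)
    qed
    finally show ?case .
  qed
  have "(\<lambda>n. \<Sum>i<n. (k * t) ^ i / fact i) \<longlonglongrightarrow> exp (k * t)"
    using exp_converges[of "k * t"] by (simp add: sums_def scaleR_conv_of_real divide_inverse mult.commute)
  moreover have "(\<lambda>n. (k * t) ^ n / fact n) \<longlonglongrightarrow> 0"
    using summable_LIMSEQ_zero[OF summable_exp[of "k * t"]] by (simp add: divide_inverse mult.commute)
  ultimately have "(\<lambda>n. a * (\<Sum>i<n. (k * t) ^ i / fact i) + B * ((k * t) ^ n / fact n)) \<longlonglongrightarrow> a * exp (k * t) + B * 0"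
    by (intro tendsto_intros)
  then have "(\<lambda>n. ennreal (P n t)) \<longlonglongrightarrow> ennreal (a * exp (k * t))"
    unfolding P_def by (intro tendsto_ennrealI) simp
  then show ?thesis
    by (rule LIMSEQ_le_const) (use le_P[OF t] in auto)
qed

text \<open>With v = exp(8t) and u = 6 t v^2 it reads 9/8 * u * v \<le> 1 + u^2. While v \<le> 16/9
  this follows from 2u \<le> 1 + u^2; beyond that t is bounded below, so u is at least a fixed
  multiple of v^2 and the quadratic in u has passed its minimum.\<close>

lemma exp_growth_inequality:
  fixes t :: real
  assumes "0 \<le> t"
  shows "27 / 4 * t * exp (24 * t) \<le> 1 + 36 * t\<^sup>2 * exp (32 * t)"
proof -
  define v where "v = exp (8 * t)"
  define u where "u = 6 * t * v\<^sup>2"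
  have v1: "1 \<le> v" using assms by (simp add: v_def)
  have u0: "0 \<le> u" using assms by (simp add: u_def)
  have e24: "exp (24 * t) = v ^ 3" and e32: "exp (32 * t) = v ^ 4"
    by (simp_all add: v_def flip: exp_of_nat_mult)
  have "9 / 8 * u * v \<le> 1 + u\<^sup>2"
  proof (cases "v \<le> 16 / 9")
    case True
    have "9 / 8 * u * v \<le> 9 / 8 * u * (16 / 9)"
      using True u0 by (intro mult_left_mono) auto
    also have "\<dots> \<le> 1 + u\<^sup>2" using sum_squares_bound[of 1 u] by simp
    finally show ?thesis .
  next
    case False
    \<comment> \<open>exp(8 * 0.07) = exp(0.56) is still below 16/9; this is certified by the 16th
      power of exp(7/200) \<le> 1 / (1 - 7/200) = 200/193. The resulting bound on \<open>u\<close>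
      has the factor 6 * 7/100 = 21/50.\<close>
    have t: "7 / 100 \<le> t"
    proof (rule ccontr)
      assume "\<not> 7 / 100 \<le> t"
      then have "v \<le> exp (16 * (7 / 200))" unfolding v_def by simp
      also have "\<dots> = exp (7 / 200) ^ 16"
        using exp_of_nat_mult[of 16 "7 / 200 :: real"] by simp
      also have "\<dots> \<le> (200 / 193) ^ 16"
      proof (rule power_mono)
        have "193 / 200 \<le> exp (- (7 / 200) :: real)"
          using exp_ge_add_one_self[of "- (7 / 200) :: real"] by simp
        then show "exp (7 / 200 :: real) \<le> 200 / 193"
          by (simp add: exp_minus field_simps)
      qed simp
      also have "\<dots> \<le> 16 / 9" by (simp add: field_simps)
      finally show False using False by simp
    qed
    text \<open>
      \<open>x\<^sup>2 - 9/8 * x * v + 1\<close> is increasing in \<open>x \<ge> ?w\<close> and, as a sum of squares, positive at \<open>x = ?w\<close>.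
    \<close>
    let ?w = "21 / 50 * v\<^sup>2"
    have uw: "?w \<le> u" unfolding u_def using t by (intro mult_right_mono) auto
    have wv: "9 / 16 * v \<le> ?w"
    proof -
      have "21 / 50 * (16 / 9) * v \<le> 21 / 50 * v * v"
        using False v1 by (intro mult_mono) auto
      then show ?thesis using v1 by (simp add: power2_eq_square)
    qed
    \<comment> \<open>Completing the square: 10800/6003 is the minimiser of this quadratic, and
      6003/32000 equals 63/125 - 81/256.\<close>
    have "0 < 16 / 25 - 27 / 40 * v + 6003 / 32000 * v\<^sup>2"
    proof -
      have "16 / 25 - 27 / 40 * v + 6003 / 32000 * v\<^sup>2 =
        6003 / 32000 * (v - 10800 / 6003)\<^sup>2 + (16 / 25 - 6003 / 32000 * (10800 / 6003)\<^sup>2)"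
        by (simp add: power2_eq_square field_simps)
      also have "\<dots> > 0" by (intro add_nonneg_pos) (simp_all add: power2_eq_square)
      finally show ?thesis .
    qed
    moreover have "6003 / 32000 * v\<^sup>2 \<le> (63 / 125 - 81 / 256) * v\<^sup>2" by simp
    moreover have "?w\<^sup>2 - 9 / 8 * ?w * v + 1 =
        (21 / 50 * v\<^sup>2 - 9 / 16 * v - 3 / 5)\<^sup>2 + (16 / 25 - 27 / 40 * v + (63 / 125 - 81 / 256) * v\<^sup>2)"
      by (simp add: power2_eq_square algebra_simps)
    ultimately have w: "0 \<le> ?w\<^sup>2 - 9 / 8 * ?w * v + 1" by (simp add: add_nonneg_nonneg)
    have "0 \<le> (u - ?w) * (u + ?w - 9 / 8 * v)"
      using uw wv by (intro mult_nonneg_nonneg) auto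
    with w show ?thesis by (simp add: power2_eq_square algebra_simps)
  qed
  then show ?thesis
    unfolding e24 e32 u_def by (simp add: power2_eq_square eval_nat_numeral algebra_simps)
qed

text \<open>If 9t/4 \<le> \<epsilon>, the first bound suffices. Otherwise, after division by
  \<epsilon>, it remains to see that \<open>?x * \<epsilon> \<le> 1\<close>; when the factor is
  positive, \<epsilon> may be enlarged to 9t/4, which gives \<open>exp_growth_inequality\<close>
  with 27/4 = 3 * 9/4 and 36 = 16 * 9/4.\<close>

lemma combined_bound:
  fixes t \<epsilon> \<phi> :: real
  assumes "0 \<le> t" "0 < \<epsilon>" "\<phi> \<le> 9 / 4 * t" "\<phi> \<le> 3 * \<epsilon>\<^sup>2 * exp (24 * t)"
  shows "\<phi> \<le> 16 * t * exp (32 * t) * \<epsilon>\<^sup>2 + \<epsilon>"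
proof (cases "9 / 4 * t \<le> \<epsilon>")
  case True
  moreover have "0 \<le> 16 * t * exp (32 * t) * \<epsilon>\<^sup>2" using assms by simp
  ultimately show ?thesis using assms by linarith
next
  case False
  let ?x = "3 * exp (24 * t) - 16 * t * exp (32 * t)"
  have "?x * \<epsilon> \<le> 1"
  proof (cases "?x \<le> 0")
    case True
    then have "?x * \<epsilon> \<le> 0" using assms by (intro mult_nonpos_nonneg) auto
    then show ?thesis by linarith
  next
    case pos: False
    have "?x * \<epsilon> \<le> ?x * (9 / 4 * t)" using False pos by (intro mult_left_mono) auto
    also have "\<dots> \<le> 1" using exp_growth_inequality[OF assms(1)] by (simp add: power2_eq_square algebra_simps)
    finally show ?thesis .
  qed
  then have "?x * \<epsilon> * \<epsilon> \<le> 1 * \<epsilon>" using assms by (intro mult_right_mono) auto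
  then show ?thesis using assms(4) by (simp add: power2_eq_square algebra_simps)
qed

text \<open>Consider the last time \<open>s \<le> t\<close> with \<open>X s = b\<close>. On
  \<open>{s<..t}\<close> the path is above \<open>b\<close>, so flatness gives this interval no mass
  and \<open>A t = A s\<close>, while \<open>X s = b\<close> means \<open>A s = - I s\<close>. The
  lower bound uses only \<open>b \<le> X\<close> and monotonicity of \<open>A\<close>.\<close>

lemma skorokhod_reflection:
  fixes X I A :: "real \<Rightarrow> real"
  assumes X: "continuous_on {0..} X" "X 0 = b" "\<And>t. 0 \<le> t \<Longrightarrow> b \<le> X t"
    and A: "continuous_on {0..} A" "A 0 = 0" "mono_on {0..} A"
    and flat: "(\<integral>\<^sup>+s\<in>{0..}. ennreal (X s - b) \<partial>interval_measure (\<lambda>s. A (max 0 s))) = 0"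
    and eq: "\<And>t. 0 \<le> t \<Longrightarrow> X t = b + I t + A t"
    and t: "0 \<le> t"
  shows "\<And>r. 0 \<le> r \<Longrightarrow> r \<le> t \<Longrightarrow> - I r \<le> A t" and "\<exists>r. 0 \<le> r \<and> r \<le> t \<and> A t = - I r"
proof -
  have Amono: "A r \<le> A s" if "0 \<le> r" "r \<le> s" for r s
    using A(3) that by (auto simp: mono_on_def)
  show "- I r \<le> A t" if "0 \<le> r" "r \<le> t" for r
    using Amono[OF that] X(3)[OF that(1)] eq[OF that(1)] by simp
  let ?S = "{r\<in>{0..t}. X r = b}"
  have "closed ?S"
    using continuous_closed_preimage[of "{0..t}" X "{b}"] continuous_on_subset[OF X(1), of "{0..t}"]
    by (auto simp: vimage_def Int_def)
  moreover have ne: "0 \<in> ?S" using t X by simp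
  moreover have bdd: "bdd_above ?S" by (auto intro!: bdd_aboveI[of _ t])
  ultimately have sS: "Sup ?S \<in> ?S" by (intro closed_contains_Sup) auto
  define s where "s = Sup ?S"
  have s: "0 \<le> s" "s \<le> t" "X s = b" using sS by (auto simp: s_def)
  have above: "b < X r" if "s < r" "r \<le> t" for r
  proof (rule ccontr)
    assume "\<not> b < X r"
    then have "r \<in> ?S" using that s X(3)[of r] by auto
    then have "r \<le> s" unfolding s_def using bdd by (rule cSup_upper)
    with that show False by simp
  qed
  let ?\<mu> = "interval_measure (\<lambda>s. A (max 0 s))"
  have "(\<lambda>r. indicator {0..} r *\<^sub>R (X r - b)) \<in> borel_measurable borel"
    by (intro borel_measurable_continuous_on_indicator continuous_intros X) auto
  from measurable_compose[OF this measurable_ennreal]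
  have "(\<lambda>r. ennreal (indicator {0..} r *\<^sub>R (X r - b))) \<in> borel_measurable borel" .
  moreover have "(\<lambda>r. ennreal (indicator {0..} r *\<^sub>R (X r - b))) = (\<lambda>r. ennreal (X r - b) * indicator {0..} r)"
    by (auto simp: indicator_def fun_eq_iff)
  ultimately have "(\<lambda>r. ennreal (X r - b) * indicator {0..} r) \<in> borel_measurable ?\<mu>"
    by (simp only: measurable_cong_sets[OF sets_interval_measure refl])
  then have "AE r in ?\<mu>. ennreal (X r - b) * indicator {0..} r = 0"
    using flat nn_integral_0_iff_AE[of "\<lambda>r. ennreal (X r - b) * indicator {0..} r" ?\<mu>] by simp
  then have "AE r in ?\<mu>. \<not> r \<in> {s<..t}"
  proof eventually_elim
    case (elim r)
    then show ?case using above[of r] s by (auto simp: indicator_def split: if_splits)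
  qed
  from emeasure_eq_0_AE[OF this] have "emeasure ?\<mu> {s<..t} = 0"
    by (simp add: greaterThanAtMost_def greaterThan_def atMost_def Collect_conj_eq)
  moreover have "emeasure ?\<mu> {s<..t} = A (max 0 t) - A (max 0 s)"
  proof (rule emeasure_interval_measure_Ioc[OF s(2)])
    show "A (max 0 x) \<le> A (max 0 y)" if "x \<le> y" for x y using that by (intro Amono) auto
    have "continuous_on UNIV (\<lambda>s. A (max 0 s))"
      by (rule continuous_on_compose2[OF A(1)]) (auto intro!: continuous_intros)
    then show "continuous (at_right a) (\<lambda>s. A (max 0 s))" for a
      by (auto simp: continuous_on_eq_continuous_at intro: continuous_at_imp_continuous_at_within)
  qed
  ultimately have "A t \<le> A s" using s t by (simp add: ennreal_eq_0_iff)
  then have "A t = A s" using Amono[OF s(1,2)] by simp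
  moreover have "A s = - I s" using eq[OF s(1)] s by simp
  ultimately show "\<exists>r. 0 \<le> r \<and> r \<le> t \<and> A t = - I r" using s by auto
qed

text \<open>At the last impulse time \<open>s \<le> t\<close> the left limit of the path is
  \<open>b - \<epsilon>\<close>, and just before \<open>s\<close> the counter is one lower than at
  \<open>t\<close>. Passing to the left limit in the equation gives
  \<open>b - \<epsilon> = b + I s + L t - \<epsilon>\<close>, that is \<open>L t = - I s\<close>.
  The lower bound loses one \<epsilon> because the path may approach
  \<open>b - \<epsilon>\<close>.\<close>

lemma impulse_reflection:
  fixes Y :: "real \<Rightarrow> 'a \<Rightarrow> real" and I :: "real \<Rightarrow> real"
  assumes \<epsilon>: "0 < \<epsilon>" and I: "continuous_on {0..} I" 
    and Y: "\<And>t. 0 \<le> t \<Longrightarrow> b - \<epsilon> < Y t w"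
    and fin: "\<And>t. 0 \<le> t \<Longrightarrow> finite (impulse_times Y (b - \<epsilon>) t w)"
    and eq: "\<And>t. 0 \<le> t \<Longrightarrow> Y t w = b + I t + \<epsilon> * real (card (impulse_times Y (b - \<epsilon>) t w))"
    and t: "0 \<le> t"
  defines "L \<equiv> \<lambda>t. \<epsilon> * real (card (impulse_times Y (b - \<epsilon>) t w))"
  shows "\<And>r. 0 \<le> r \<Longrightarrow> r \<le> t \<Longrightarrow> - I r - \<epsilon> \<le> L t"
    and "L t = 0 \<or> (\<exists>r. 0 \<le> r \<and> r \<le> t \<and> L t = - I r)"
proof -
  let ?N = "\<lambda>t. impulse_times Y (b - \<epsilon>) t w"
  show "- I r - \<epsilon> \<le> L t" if "0 \<le> r" "r \<le> t" for r
  proof -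
    have "?N r \<subseteq> ?N t" using that by (auto simp: impulse_times_def)
    then have "card (?N r) \<le> card (?N t)" using fin[OF t] by (rule card_mono[rotated])
    then have "L r \<le> L t" using \<epsilon> by (simp add: L_def)
    then show ?thesis using Y[OF that(1)] eq[OF that(1)] by (simp add: L_def)
  qed
  show "L t = 0 \<or> (\<exists>r. 0 \<le> r \<and> r \<le> t \<and> L t = - I r)"
  proof (cases "?N t = {}")
    case True
    then show ?thesis by (simp add: L_def)
  next
    case False
    define s where "s = Max (?N t)"
    have sN: "s \<in> ?N t" unfolding s_def using fin[OF t] False by (rule Max_in)
    then have s: "0 < s" "s \<le> t" and lim: "((\<lambda>u. Y u w) \<longlongrightarrow> b - \<epsilon>) (at_left s)"
      by (auto simp: impulse_times_def)
    \<comment> \<open>The previous impulse, or 0 if there is none: between \<open>s'\<close> and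
      \<open>s\<close> the counter is constant.\<close>
    define s' where "s' = Max (insert 0 (?N t - {s}))"
    have fin': "finite (insert 0 (?N t - {s}))" using fin[OF t] by simp
    have "s' \<in> insert 0 (?N t - {s})" unfolding s'_def using fin' by (rule Max_in) simp
    moreover have "r \<le> s" if "r \<in> ?N t" for r unfolding s_def using fin[OF t] that by (rule Max_ge)
    ultimately have s's: "s' < s" using s by (auto simp: less_le)
    have s'_ge: "r \<le> s'" if "r \<in> insert 0 (?N t - {s})" for r
      unfolding s'_def using fin' that by (rule Max_ge)
    have Nu: "?N u = ?N t - {s}" if "s' < u" "u < s" for u
    proof (rule set_eqI)
      fix r
      have "r \<in> ?N u \<longleftrightarrow> r \<in> ?N t \<and> r \<le> u" using that s by (auto simp: impulse_times_def)
      also have "\<dots> \<longleftrightarrow> r \<in> ?N t - {s}" using s'_ge[of r] that by auto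
      finally show "r \<in> ?N u \<longleftrightarrow> r \<in> ?N t - {s}" .
    qed
    have c: "real (card (?N t - {s})) = real (card (?N t)) - 1"
    proof -
      have "0 < card (?N t)" using sN fin[OF t] by (auto simp: card_gt_0_iff)
      then show ?thesis using sN by (simp add: card_Diff_singleton of_nat_diff Suc_le_eq)
    qed
    have "eventually (\<lambda>u. b + I u + (L t - \<epsilon>) = Y u w) (at_left s)"
      unfolding eventually_at_left_field
    proof (intro exI[of _ s'] conjI allI impI s's)
      fix u assume u: "u > s'" "u < s"
      then have "0 \<le> u" using s'_ge[of 0] by simp
      then show "b + I u + (L t - \<epsilon>) = Y u w"
        using eq[of u] Nu[OF u] c by (simp add: L_def algebra_simps)
    qed
    moreover have "((\<lambda>u. b + I u + (L t - \<epsilon>)) \<longlongrightarrow> b + I s + (L t - \<epsilon>)) (at_left s)"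
    proof -
      have "isCont I s" using I s by (intro continuous_on_interior[OF I]) auto
      then have "(I \<longlongrightarrow> I s) (at_left s)" by (auto simp: isCont_def intro: filterlim_mono at_le)
      then show ?thesis by (intro tendsto_intros)
    qed
    ultimately have "((\<lambda>u. Y u w) \<longlongrightarrow> b + I s + (L t - \<epsilon>)) (at_left s)"
      by (rule Lim_transform_eventually[rotated])
    from tendsto_unique[OF trivial_limit_at_left_real this lim]
    have "L t = - I s" by simp
    then show ?thesis using s by (auto intro!: exI[of _ s])
  qed
qed

text \<open>
  By the Skorokhod representation both regulators are running maxima of \<open>-I\<close>, the impulsive one up
  to \<open>\<epsilon>\<close>; hence they differ by at most the running supremum of \<open>\<bar>IY - IX\<bar>\<close>, up to \<open>\<epsilon>\<close>.
\<close>

lemma regulator_comparison: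
  fixes IX IY :: "real \<Rightarrow> real"
  assumes s: "0 \<le> s"
    and A: "\<And>r. 0 \<le> r \<Longrightarrow> r \<le> s \<Longrightarrow> - IX r \<le> A" "\<exists>r. 0 \<le> r \<and> r \<le> s \<and> A = - IX r" "0 \<le> A"
    and L: "\<And>r. 0 \<le> r \<Longrightarrow> r \<le> s \<Longrightarrow> - IY r - \<epsilon> \<le> L" "L = 0 \<or> (\<exists>r. 0 \<le> r \<and> r \<le> s \<and> L = - IY r)" "0 \<le> L"
    and \<epsilon>: "0 \<le> \<epsilon>"
    and j: "\<And>r. r \<in> {0..s} \<Longrightarrow> \<bar>IY r - IX r\<bar> \<le> j"
  shows "\<bar>(b + IY s + L) - (b + IX s + A)\<bar> \<le> 2 * j + \<epsilon>"
    and "(\<And>r. r \<in> {0..s} \<Longrightarrow> \<bar>IY r\<bar> \<le> i) \<Longrightarrow> \<bar>(b + IY s + L) - (b + IX s + A)\<bar> \<le> 2 * j + i"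
proof -
  obtain r where r: "0 \<le> r" "r \<le> s" "A = - IX r" using A(2) by blast
  have j0: "0 \<le> j" using j[of s] s by auto
  have LA: "L - A \<le> j"
    using L(2)
  proof
    assume "L = 0"
    then show ?thesis using A(3) j0 by linarith
  next
    assume "\<exists>r. 0 \<le> r \<and> r \<le> s \<and> L = - IY r"
    then obtain q where q: "0 \<le> q" "q \<le> s" "L = - IY q" by blast
    then show ?thesis using A(1)[of q] j[of q] by auto
  qed
  have js: "\<bar>IY s - IX s\<bar> \<le> j" and jr: "\<bar>IY r - IX r\<bar> \<le> j" using j s r by auto
  have AL: "A - L \<le> j + \<epsilon>" using L(1)[of r] r jr by auto
  show "\<bar>(b + IY s + L) - (b + IX s + A)\<bar> \<le> 2 * j + \<epsilon>" using LA AL js \<epsilon> by linarith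
  \<comment> \<open>The variant without \<epsilon>: \<open>A = - IX r\<close> is at most
    \<open>j + i\<close>, and \<open>L\<close> is nonnegative.\<close>
  assume i: "\<And>r. r \<in> {0..s} \<Longrightarrow> \<bar>IY r\<bar> \<le> i"
  have "\<bar>IY r\<bar> \<le> i" using i r by auto
  then have "A - L \<le> j + i" using r jr L(3) by auto
  moreover have "0 \<le> i" using i[of s] s by auto
  ultimately show "\<bar>(b + IY s + L) - (b + IX s + A)\<bar> \<le> 2 * j + i" using LA js by linarith
qed

section \<open>The main estimate\<close>

context brownian_setting
begin

lemma borel_measurable_mono_ennreal:
  fixes f :: "real \<Rightarrow> ennreal"
  assumes "mono f"
  shows "f \<in> borel_measurable borel"
proof (rule borel_measurableI_greater)
  fix y
  have "is_interval {x \<in> space borel. y < f x}"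
    using monoD[OF assms] by (auto simp: is_interval_1 intro: order_less_le_trans)
  then show "{x \<in> space borel. y < f x} \<in> sets borel"
    by (rule real_interval_borel_measurable)
qed

lemma strictly_stopped_integrand_measurable:
  fixes H :: "real \<Rightarrow> 'a \<Rightarrow> real" and \<tau> :: "'a \<Rightarrow> real"
  assumes "jointly_measurable H" "\<tau> \<in> borel_measurable M"
  shows "(\<lambda>(s, w). if s < \<tau> w then H s w else 0) \<in> borel_measurable (borel \<Otimes>\<^sub>M M)"
proof -
  have "(\<lambda>x. \<tau> (snd x)) \<in> borel_measurable ((borel :: real measure) \<Otimes>\<^sub>M M)"
    using measurable_compose[OF measurable_snd assms(2)] .
  from borel_measurable_less[OF measurable_fst this]
  have "{x \<in> space (borel \<Otimes>\<^sub>M M). fst x < \<tau> (snd x)} \<in> sets (borel \<Otimes>\<^sub>M M)" .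
  then have "(\<lambda>x. if fst x < \<tau> (snd x) then H (fst x) (snd x) else 0) \<in> borel_measurable (borel \<Otimes>\<^sub>M M)"
    using assms(1)[unfolded case_prod_beta'] by (intro measurable_If) auto
  then show ?thesis by (simp add: case_prod_beta')
qed

text \<open>The inequality is strict so that the killed path stays right-continuous, which the
  measurability of its running supremum requires. A statement about it concerns times strictly
  before \<open>\<tau>\<close> only.\<close>

abbreviation killed :: "('a \<Rightarrow> real) \<Rightarrow> (real \<Rightarrow> 'a \<Rightarrow> real) \<Rightarrow> real \<Rightarrow> 'a \<Rightarrow> real" where
  "killed \<tau> D s w \<equiv> if s < \<tau> w then D s w else 0"

lemma killed_sup_sq_measurable:
  assumes Dm: "\<And>s. 0 \<le> s \<Longrightarrow> D s \<in> borel_measurable M"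
    and Dr: "\<And>w s. w \<in> space M \<Longrightarrow> 0 \<le> s \<Longrightarrow> ((\<lambda>s. D s w) \<longlongrightarrow> D s w) (at_right s)"
    and \<tau>: "\<tau> \<in> borel_measurable M"
  shows "sup_sq (killed \<tau> D) t \<in> borel_measurable M"
proof (rule borel_measurable_SUP_right_continuous)
  fix s :: real assume "0 \<le> s" "s \<le> t"
  note [measurable] = Dm[OF \<open>0 \<le> s\<close>] \<tau>
  show "(\<lambda>w. ennreal ((killed \<tau> D s w)\<^sup>2)) \<in> borel_measurable M" by measurable
next
  fix w and s :: real assume w: "w \<in> space M" and s: "0 \<le> s" "s < t"
  have "((\<lambda>s. killed \<tau> D s w) \<longlongrightarrow> killed \<tau> D s w) (at_right s)"
  proof (cases "s < \<tau> w")
    case True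
    have "eventually (\<lambda>r. D r w = killed \<tau> D r w) (at_right s)"
      unfolding eventually_at_right_field using True by (intro exI[of _ "\<tau> w"]) auto
    with Dr[OF w s(1)] show ?thesis using True by (simp add: Lim_transform_eventually)
  next
    case False
    have "eventually (\<lambda>r. 0 = killed \<tau> D r w) (at_right s)"
      unfolding eventually_at_right_field using False by (intro exI[of _ "s + 1"]) auto
    then have "((\<lambda>s. killed \<tau> D s w) \<longlongrightarrow> 0) (at_right s)"
      by (rule Lim_transform_eventually[OF tendsto_const])
    then show ?thesis using False by simp
  qed
  then show "((\<lambda>s. ennreal ((killed \<tau> D s w)\<^sup>2)) \<longlongrightarrow> ennreal ((killed \<tau> D s w)\<^sup>2)) (at_right s)"
    by (intro tendsto_ennrealI tendsto_power)
qed

lemma energy_expectation_swap: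
  assumes G: "(\<lambda>(s, w). G s w :: real) \<in> borel_measurable (borel \<Otimes>\<^sub>M M)"
  shows "expected_energy G t = (\<integral>\<^sup>+s\<in>{0..t}. (\<integral>\<^sup>+w. ennreal ((G s w)\<^sup>2) \<partial>M) \<partial>lborel)"
proof -
  interpret pair_sigma_finite lborel M by unfold_locales
  have [measurable]: "(\<lambda>x. G (fst x) (snd x)) \<in> borel_measurable (lborel \<Otimes>\<^sub>M M)"
    using G by (simp add: case_prod_beta' cong: measurable_cong_sets)
  have m: "case_prod (\<lambda>s w. ennreal ((G s w)\<^sup>2) * indicator {0..t} s) \<in> borel_measurable (lborel \<Otimes>\<^sub>M M)"
    unfolding case_prod_beta' by measurable
  have "expected_energy G t = (\<integral>\<^sup>+s. (\<integral>\<^sup>+w. ennreal ((G s w)\<^sup>2) * indicator {0..t} s \<partial>M) \<partial>lborel)"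
    by (rule Fubini'[OF m])
  also have "\<dots> = (\<integral>\<^sup>+s\<in>{0..t}. (\<integral>\<^sup>+w. ennreal ((G s w)\<^sup>2) \<partial>M) \<partial>lborel)"
    by (intro nn_integral_cong) (auto simp: indicator_def)
  finally show ?thesis .
qed

text \<open>What Gronwall needs at one time: the difference is governed by the stochastic integrals,
  the integrands are Lipschitz in it, and an a priori bound starts the iteration. Quantifying over
  every bound \<open>j\<close> lets the first clause be used with the supremum of the stopped
  integrals.\<close>

abbreviation controlled where
  "controlled \<epsilon> C B D H K IX IY s w \<equiv>
    (\<forall>j. (\<forall>r\<in>{0..s}. \<bar>IY r w - IX r w\<bar> \<le> j) \<longrightarrow> \<bar>D s w\<bar> \<le> 2 * j + \<epsilon>) \<and>
    \<bar>K s w - H s w\<bar> \<le> C * \<bar>D s w\<bar> \<and> \<bar>D s w\<bar> \<le> (B :: real)"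

text \<open>
  Applied with \<open>D = Y - X\<close> and constant \<open>\<tau>\<close> this gives the rate; with other choices of \<open>D\<close> and of the
  stopping time it confines the two processes to \<open>[0,1]\<close>.
\<close>

lemma gronwall_estimate:
  fixes D :: "real \<Rightarrow> 'a \<Rightarrow> real"
  assumes itoX: "ito T H IX" and itoY: "ito T K IY" and \<tau>: "is_stopping T \<tau>"
    and \<epsilon>: "0 \<le> \<epsilon>" and C: "0 \<le> C" and B: "0 \<le> B"
    and Dm: "\<And>s. 0 \<le> s \<Longrightarrow> D s \<in> borel_measurable M"
    and Dr: "\<And>w s. w \<in> space M \<Longrightarrow> 0 \<le> s \<Longrightarrow> ((\<lambda>s. D s w) \<longlongrightarrow> D s w) (at_right s)"
    and bounds: "AE w in M. \<forall>s. 0 \<le> s \<and> s < \<tau> w \<longrightarrow>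
      controlled \<epsilon> C B D H K IX IY s w"
    and t: "0 \<le> t" "t \<le> T"
  shows "expected_sup (killed \<tau> D) t \<le> ennreal (3 * \<epsilon>\<^sup>2 * exp (24 * C\<^sup>2 * t))"
proof (rule gronwall_nn_integral[where B = "B\<^sup>2" and T = T, OF _ _ _ _ _ t])
  note \<tau>m = is_stopping_measurable[OF \<tau>]
  note \<Phi>m = killed_sup_sq_measurable[of D \<tau>, OF Dm Dr \<tau>m]
  fix t assume t: "0 \<le> t" "t \<le> T"
  have "expected_sup (killed \<tau> D) t \<le> (\<integral>\<^sup>+w. ennreal (B\<^sup>2) \<partial>M)"
  proof (rule nn_integral_mono_AE)
    show "AE w in M. sup_sq (killed \<tau> D) t w \<le> ennreal (B\<^sup>2)"
      using bounds
    proof eventually_elim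
      case (elim w)
      show ?case
      proof (rule SUP_least)
        fix s assume s: "s \<in> {0..t}"
        show "ennreal ((killed \<tau> D s w)\<^sup>2) \<le> ennreal (B\<^sup>2)"
        proof (cases "s < \<tau> w")
          case True
          then have "\<bar>D s w\<bar> \<le> B" using elim s by auto
          from power_mono[OF this abs_ge_zero, of 2] show ?thesis using True by (simp add: ennreal_leI)
        qed simp
      qed
    qed
  qed
  then show "expected_sup (killed \<tau> D) t \<le> ennreal (B\<^sup>2)"
    by (simp add: emeasure_space_1)
  let ?G = "\<lambda>s w. if s \<le> \<tau> w then K s w - H s w else 0"
  let ?J = "\<lambda>s w. IY (min s (\<tau> w)) w - IX (min s (\<tau> w)) w"
  have itoJ: "ito t ?G ?J"
    by (rule ito_le_horizon[OF ito_stop[OF ito_diff[OF itoY itoX] \<tau>] t(2)])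
  have Jc: "continuous_on {0..} (\<lambda>s. ?J s w)" if "w \<in> space M" for w
    using itoJ that by (simp add: ito_def)
  have Jm: "?J s \<in> borel_measurable M" if "0 \<le> s" for s
    using itoJ that by (simp add: ito_def)
  have sup_meas: "sup_sq ?J t \<in> borel_measurable M"
    using Jm Jc by (rule sup_sq_measurable)
  have KH: "(\<lambda>(s, w). K s w - H s w) \<in> borel_measurable (borel \<Otimes>\<^sub>M M)"
    using ito_diff[OF itoY itoX] by (simp add: ito_def)
  let ?KH = "\<lambda>s w. K s w - H s w"
  have G': "(\<lambda>(s, w). killed \<tau> ?KH s w) \<in> borel_measurable (borel \<Otimes>\<^sub>M M)"
    by (rule strictly_stopped_integrand_measurable[OF KH \<tau>m])
  \<comment> \<open>Stopping keeps the time \<open>\<tau>\<close> itself and killing drops it; a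
    single point has Lebesgue measure zero.\<close>
  have "expected_energy ?G t = expected_energy (killed \<tau> ?KH) t"
  proof (rule nn_integral_cong, rule nn_integral_cong_AE)
    fix w
    show "AE s in lborel. ennreal ((?G s w)\<^sup>2) * indicator {0..t} s =
      ennreal ((killed \<tau> ?KH s w)\<^sup>2) * indicator {0..t} s"
      using AE_lborel_singleton[of "\<tau> w"] by eventually_elim auto
  qed
  also have "\<dots> = (\<integral>\<^sup>+s\<in>{0..t}. (\<integral>\<^sup>+w. ennreal ((killed \<tau> ?KH s w)\<^sup>2) \<partial>M) \<partial>lborel)"
    by (rule energy_expectation_swap[OF G'])
  also have "\<dots> \<le> (\<integral>\<^sup>+s. ennreal (C\<^sup>2) * (expected_sup (killed \<tau> D) s * indicator {0..t} s) \<partial>lborel)"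
  proof (rule nn_integral_mono)
    fix s :: real
    have "(\<integral>\<^sup>+w. ennreal ((killed \<tau> ?KH s w)\<^sup>2) \<partial>M)
      \<le> (\<integral>\<^sup>+w. ennreal (C\<^sup>2) * sup_sq (killed \<tau> D) s w \<partial>M)" if s: "s \<in> {0..t}"
    proof (rule nn_integral_mono_AE)
      show "AE w in M. ennreal ((killed \<tau> ?KH s w)\<^sup>2) \<le> ennreal (C\<^sup>2) * sup_sq (killed \<tau> D) s w"
        using bounds
      proof eventually_elim
        case (elim w)
        show ?case
        proof (cases "s < \<tau> w")
          case True
          then have "\<bar>K s w - H s w\<bar> \<le> C * \<bar>D s w\<bar>" using elim s by auto
          from power_mono[OF this abs_ge_zero, of 2]
          have "ennreal ((K s w - H s w)\<^sup>2) \<le> ennreal (C\<^sup>2) * ennreal ((D s w)\<^sup>2)"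
            by (simp add: ennreal_mult[symmetric] power_mult_distrib ennreal_leI)
          also have "\<dots> \<le> ennreal (C\<^sup>2) * sup_sq (killed \<tau> D) s w"
            using True s by (intro mult_left_mono SUP_upper2[of s]) auto
          finally show ?thesis using True by simp
        qed simp
      qed
    qed
    moreover have "(\<integral>\<^sup>+w. ennreal (C\<^sup>2) * sup_sq (killed \<tau> D) s w \<partial>M) = ennreal (C\<^sup>2) * expected_sup (killed \<tau> D) s"
      by (rule nn_integral_cmult[OF \<Phi>m])
    ultimately show "(\<integral>\<^sup>+w. ennreal ((killed \<tau> ?KH s w)\<^sup>2) \<partial>M) * indicator {0..t} s
      \<le> ennreal (C\<^sup>2) * (expected_sup (killed \<tau> D) s * indicator {0..t} s)"
      by (cases "s \<in> {0..t}") simp_all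
  qed
  also have "\<dots> \<le> ennreal (C\<^sup>2) * (\<integral>\<^sup>+s\<in>{0..t}. expected_sup (killed \<tau> D) s \<partial>lborel)"
  proof -
    let ?f = "\<lambda>s. expected_sup (killed \<tau> D) s"
    \<comment> \<open>Monotonicity in time yields the measurability needed to pull the constant out
      of the integral.\<close>
    have "mono ?f"
      by (intro monoI nn_integral_mono SUP_subset_mono) auto
    then have [measurable]: "?f \<in> borel_measurable borel" by (rule borel_measurable_mono_ennreal)
    show ?thesis by (subst nn_integral_cmult) auto
  qed
  finally have en: "expected_energy ?G t
    \<le> ennreal (C\<^sup>2) * (\<integral>\<^sup>+s\<in>{0..t}. expected_sup (killed \<tau> D) s \<partial>lborel)" .
  \<comment> \<open>Before \<open>\<tau>\<close> the stopped and unstopped integrals coincide, so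
    the supremum of the stopped one may serve as \<open>j\<close>.\<close>
  have "expected_sup (killed \<tau> D) t \<le> (\<integral>\<^sup>+w. 6 * sup_sq ?J t w + ennreal (3 * \<epsilon>\<^sup>2) \<partial>M)"
  proof (rule nn_integral_mono_AE)
    show "AE w in M. sup_sq (killed \<tau> D) t w \<le> 6 * sup_sq ?J t w + ennreal (3 * \<epsilon>\<^sup>2)"
      using bounds AE_space
    proof eventually_elim
      case (elim w)
      let ?j = "running_sup ?J t w"
      note bdd = bdd_above_continuous_path[of ?J, OF Jc[OF elim(2)], of t]
      note js = SUP_power2_eq_running_sup[of ?J, OF bdd t(1)]
      have "6 * sup_sq ?J t w + ennreal (3 * \<epsilon>\<^sup>2) = ennreal (6 * ?j\<^sup>2 + 3 * \<epsilon>\<^sup>2)"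
        unfolding js(1) by (simp add: ennreal_mult')
      moreover have "sup_sq (killed \<tau> D) t w \<le> ennreal (6 * ?j\<^sup>2 + 3 * \<epsilon>\<^sup>2)"
      proof (rule SUP_least)
        fix s assume s: "s \<in> {0..t}"
        show "ennreal ((killed \<tau> D s w)\<^sup>2) \<le> ennreal (6 * ?j\<^sup>2 + 3 * \<epsilon>\<^sup>2)"
        proof (cases "s < \<tau> w")
          case True
          have "\<bar>IY r w - IX r w\<bar> \<le> ?j" if "r \<in> {0..s}" for r
            using running_sup_upper[of ?J, OF bdd, of r] that s True by (simp add: min_absorb1)
          then have "\<bar>D s w\<bar> \<le> 2 * ?j + \<epsilon>" using elim(1) s True by auto
          from power_mono[OF this abs_ge_zero, of 2]
          have "(D s w)\<^sup>2 \<le> (2 * ?j + \<epsilon>)\<^sup>2" by simp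
          also have "\<dots> \<le> 6 * ?j\<^sup>2 + 3 * \<epsilon>\<^sup>2"
            using power2_le_weighted[of "1/2" "2 * ?j + \<epsilon>" "2 * ?j"] by (simp add: power_mult_distrib)
          finally show ?thesis using True by (simp add: ennreal_leI del: ennreal_plus)
        qed simp
      qed
      ultimately show ?case by simp
    qed
  qed
  also have "\<dots> = 6 * expected_sup ?J t + ennreal (3 * \<epsilon>\<^sup>2)"
    using sup_meas by (subst nn_integral_add) (auto simp: nn_integral_cmult emeasure_space_1)
  also have "\<dots> \<le> 6 * (4 * expected_energy ?G t) + ennreal (3 * \<epsilon>\<^sup>2)"
    by (intro add_right_mono mult_left_mono ito_doob[OF itoJ t(1)]) simp
  also have "\<dots> \<le> 6 * (4 * (ennreal (C\<^sup>2) * (\<integral>\<^sup>+s\<in>{0..t}. expected_sup (killed \<tau> D) s \<partial>lborel))) + ennreal (3 * \<epsilon>\<^sup>2)"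
    by (intro add_right_mono mult_left_mono en) auto
  also have "\<dots> = ennreal (3 * \<epsilon>\<^sup>2) + ennreal (24 * C\<^sup>2) * (\<integral>\<^sup>+s\<in>{0..t}. expected_sup (killed \<tau> D) s \<partial>lborel)"
    by (simp add: ennreal_mult' mult.assoc[symmetric] add.commute)
  finally show "expected_sup (killed \<tau> D) t \<le>
    ennreal (3 * \<epsilon>\<^sup>2) + ennreal (24 * C\<^sup>2) * (\<integral>\<^sup>+s\<in>{0..t}. expected_sup (killed \<tau> D) s \<partial>lborel)" .
qed (use \<epsilon> C B in auto)

end

section \<open>Confinement to the unit interval and the rate\<close>

text \<open>Skorokhod's representation with the Stieltjes measure eliminated: the last two clauses
  make \<open>A s w\<close> the maximum of \<open>-I\<close> over \<open>{0..s}\<close>.\<close>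

definition reflected_path :: "real \<Rightarrow> (real \<Rightarrow> 'a \<Rightarrow> real) \<Rightarrow> (real \<Rightarrow> 'a \<Rightarrow> real) \<Rightarrow> (real \<Rightarrow> 'a \<Rightarrow> real) \<Rightarrow> 'a \<Rightarrow> bool" where
  "reflected_path b X I A w \<longleftrightarrow> X 0 w = b \<and> (\<forall>s\<ge>0. b \<le> X s w \<and> 0 \<le> A s w \<and> X s w = b + I s w + A s w \<and>
      (\<forall>r. 0 \<le> r \<and> r \<le> s \<longrightarrow> - I r w \<le> A s w) \<and> (\<exists>r. 0 \<le> r \<and> r \<le> s \<and> A s w = - I r w))"

text \<open>The counter \<open>N\<close> is kept integer-valued, so that a regulator below
  \<epsilon> must vanish; this is how the absence of impulses before a given level is
  detected.\<close>

definition impulsed_path :: "real \<Rightarrow> real \<Rightarrow> (real \<Rightarrow> 'a \<Rightarrow> real) \<Rightarrow> (real \<Rightarrow> 'a \<Rightarrow> real) \<Rightarrow> (real \<Rightarrow> 'a \<Rightarrow> nat) \<Rightarrow> 'a \<Rightarrow> bool" where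
  "impulsed_path b \<epsilon> Y I N w \<longleftrightarrow> I 0 w = 0 \<and> (\<forall>s\<ge>0. b - \<epsilon> < Y s w \<and> Y s w < 1 \<and>
      Y s w = b + I s w + \<epsilon> * real (N s w) \<and>
      (\<forall>r. 0 \<le> r \<and> r \<le> s \<longrightarrow> - I r w - \<epsilon> \<le> \<epsilon> * real (N s w)) \<and>
      (\<epsilon> * real (N s w) = 0 \<or> (\<exists>r. 0 \<le> r \<and> r \<le> s \<and> \<epsilon> * real (N s w) = - I r w)))"

text \<open>The two comparisons with the regulators eliminated. The one with \<epsilon> drives the
  Gronwall argument, the one with \<open>i\<close> gives the bound that is linear in
  \<open>t\<close>.\<close>

definition close_paths :: "real \<Rightarrow> real \<Rightarrow> (real \<Rightarrow> 'a \<Rightarrow> real) \<Rightarrow> (real \<Rightarrow> 'a \<Rightarrow> real) \<Rightarrow> (real \<Rightarrow> 'a \<Rightarrow> real) \<Rightarrow> (real \<Rightarrow> 'a \<Rightarrow> real) \<Rightarrow> 'a \<Rightarrow> bool" where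
  "close_paths b \<epsilon> X Y IX IY w \<longleftrightarrow> (\<forall>s\<ge>0. b \<le> X s w \<and> b - \<epsilon> < Y s w \<and> Y s w < 1 \<and>
      (\<forall>j. (\<forall>r\<in>{0..s}. \<bar>IY r w - IX r w\<bar> \<le> j) \<longrightarrow> \<bar>Y s w - X s w\<bar> \<le> 2 * j + \<epsilon> \<and>
        (\<forall>i. (\<forall>r\<in>{0..s}. \<bar>IY r w\<bar> \<le> i) \<longrightarrow> \<bar>Y s w - X s w\<bar> \<le> 2 * j + i)))"

lemma logistic_diff: "y * (1 - y) - x * (1 - x) = (y - x) * (1 - (x + y))" for x y :: real
  by (simp add: algebra_simps)

lemma logistic_le_quarter: "x * (1 - x) \<le> 1 / 4" for x :: real
  using zero_le_power2[of "x - 1 / 2"] by (simp add: power2_eq_square algebra_simps)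

lemma left_limit_le:
  fixes f :: "real \<Rightarrow> real"
  assumes f: "continuous_on {0..} f" and t: "0 < t" and le: "\<And>r. 0 \<le> r \<Longrightarrow> r < t \<Longrightarrow> f r \<le> c"
  shows "f t \<le> c"
proof (rule tendsto_upperbound)
  have "isCont f t" using t by (intro continuous_on_interior[OF f]) auto
  then show "(f \<longlongrightarrow> f t) (at_left t)" by (auto simp: isCont_def intro: filterlim_mono at_le)
  show "\<forall>\<^sub>F r in at_left t. f r \<le> c"
    unfolding eventually_at_left_field using t le by (intro exI[of _ 0]) auto
qed simp

lemma killed_sup_sq_eq_0D:
  fixes Z :: "real \<Rightarrow> real"
  assumes "(SUP s\<in>{0..T}. ennreal ((Z s)\<^sup>2)) = 0" "0 \<le> s" "s \<le> T"
  shows "Z s = 0"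
proof -
  have "ennreal ((Z s)\<^sup>2) \<le> 0" unfolding assms(1)[symmetric] using assms(2,3) by (intro SUP_upper) auto
  then show ?thesis by simp
qed

section \<open>Path descriptions of both processes and the upper bound for the reflected one\<close>

context brownian_setting
begin

lemma hitting_value_eq:
  assumes c: "continuous_on {0..} (\<lambda>s. Z s w)" and T: "0 \<le> T" and less: "hitting Z a T w < T"
    and Z0: "Z 0 w \<le> a"
  shows "Z (hitting Z a T w) w = a"
proof (rule antisym)
  show "a \<le> Z (hitting Z a T w) w" by (rule hitting_value[of Z, OF c T less])
  show "Z (hitting Z a T w) w \<le> a"
  proof (cases "hitting Z a T w = 0")
    case False
    then have "0 < hitting Z a T w" using hitting_bounds(1)[OF T, of Z a w] by simp
    then show ?thesis
      using left_limit_le[OF c] hitting_less[of _ Z a T w] T by (meson less_imp_le)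
  qed (use Z0 in simp)
qed

lemma is_stopping_const: "0 \<le> T \<Longrightarrow> is_stopping T (\<lambda>_. T)"
  unfolding is_stopping_def
proof (intro conjI ballI allI impI)
  fix u
  show "{w \<in> space M. T \<le> u} \<in> sets (F u)"
    using sets.top[of "F u"] by (cases "T \<le> u") simp_all
qed auto

lemma reflected_process_regulator:
  assumes "reflected_process M F W b X"
  obtains I A where "is_ito_integral M F W (\<lambda>s w. X s w * (1 - X s w)) I"
    "AE w in M. reflected_path b X I A w"
proof -
  obtain I A where I: "is_ito_integral M F W (\<lambda>s w. X s w * (1 - X s w)) I"
    and Xc: "continuous_paths M X" and Ac: "continuous_paths M A"
    and X: "AE w in M. X 0 w = b \<and> (\<forall>t\<ge>0. b \<le> X t w)"
    and A: "AE w in M. A 0 w = 0 \<and> mono_on {0..} (\<lambda>t. A t w) \<and>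
           (\<integral>\<^sup>+s\<in>{0..}. ennreal (X s w - b) \<partial>interval_measure (\<lambda>s. A (max 0 s) w)) = 0 \<and>
           (\<forall>t\<ge>0. X t w = b + I t w + A t w)"
    using assms unfolding reflected_process_def by blast
  have "AE w in M. reflected_path b X I A w"
    using X A AE_space
  proof eventually_elim
    case (elim w)
    have c: "continuous_on {0..} (\<lambda>t. X t w)" "continuous_on {0..} (\<lambda>t. A t w)"
      using Xc Ac elim by (auto simp: continuous_paths_def)
    have nn: "0 \<le> A s w" if "0 \<le> s" for s
      using elim that mono_onD[of "{0..}" "\<lambda>t. A t w" 0 s] by simp
    note R = skorokhod_reflection[where X = "\<lambda>t. X t w" and A = "\<lambda>t. A t w" and I = "\<lambda>t. I t w" and b = b, OF c(1) _ _ c(2)]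
    show ?case using elim R nn by (simp add: reflected_path_def)
  qed
  with I that show ?thesis by blast
qed

lemma impulsed_process_regulator:
  assumes "impulsed_process M F W b \<epsilon> Y" and \<epsilon>: "0 < \<epsilon>"
  obtains I N where "is_ito_integral M F W (\<lambda>s w. Y s w * (1 - Y s w)) I"
    "AE w in M. impulsed_path b \<epsilon> Y I N w"
proof -
  let ?N = "\<lambda>s w. card (impulse_times Y (b - \<epsilon>) s w)"
  obtain I where I: "is_ito_integral M F W (\<lambda>s w. Y s w * (1 - Y s w)) I"
    and Y: "AE w in M. Y 0 w = b \<and> (\<forall>t\<ge>0. Y t w \<in> {b - \<epsilon><..<1})"
    and eq: "AE w in M. \<forall>t\<ge>0. finite (impulse_times Y (b - \<epsilon>) t w) \<and>
           Y t w = b + I t w + \<epsilon> * real (?N t w)"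
    using assms unfolding impulsed_process_def by blast
  have "AE w in M. impulsed_path b \<epsilon> Y I ?N w"
    using Y eq AE_space
  proof eventually_elim
    case (elim w)
    have c: "continuous_on {0..} (\<lambda>t. I t w)"
      using I elim by (auto simp: is_ito_integral_def continuous_paths_def)
    have "impulse_times Y (b - \<epsilon>) 0 w = {}" by (auto simp: impulse_times_def)
    moreover have "Y 0 w = b + I 0 w + \<epsilon> * real (?N 0 w)" using elim by simp
    ultimately have I0: "I 0 w = 0" using elim by simp
    note R = impulse_reflection[where Y = Y and w = w and I = "\<lambda>t. I t w" and b = b, OF \<epsilon> c]
    have R1: "- I r w - \<epsilon> \<le> \<epsilon> * real (?N s w)" if "0 \<le> s" "0 \<le> r" "r \<le> s" for r s
      by (rule R(1)) (use elim that in auto)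
    have R2: "\<epsilon> * real (?N s w) = 0 \<or> (\<exists>r. 0 \<le> r \<and> r \<le> s \<and> \<epsilon> * real (?N s w) = - I r w)" if "0 \<le> s" for s
      by (rule R(2)) (use elim that in auto)
    show ?case
      unfolding impulsed_path_def
    proof (intro conjI allI impI I0)
      fix s :: real assume s: "0 \<le> s"
      show "b - \<epsilon> < Y s w" "Y s w < 1" "Y s w = b + I s w + \<epsilon> * real (?N s w)" using elim s by auto
      show "\<epsilon> * real (?N s w) = 0 \<or> (\<exists>r. 0 \<le> r \<and> r \<le> s \<and> \<epsilon> * real (?N s w) = - I r w)" by (rule R2[OF s])
      show "- I r w - \<epsilon> \<le> \<epsilon> * real (?N s w)" if "0 \<le> r \<and> r \<le> s" for r using R1[OF s] that by blast
    qed
  qed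
  with I show ?thesis by (rule that)
qed

lemma process_difference:
  assumes X: "reflected_process M F W b X" and Y: "impulsed_process M F W b \<epsilon> Y" and \<epsilon>: "0 < \<epsilon>"
  obtains IX IY where "is_ito_integral M F W (\<lambda>s w. X s w * (1 - X s w)) IX"
    "is_ito_integral M F W (\<lambda>s w. Y s w * (1 - Y s w)) IY"
    "AE w in M. close_paths b \<epsilon> X Y IX IY w"
proof -
  obtain IX A where IX: "is_ito_integral M F W (\<lambda>s w. X s w * (1 - X s w)) IX"
    and A: "AE w in M. reflected_path b X IX A w"
    by (rule reflected_process_regulator[OF X])
  obtain IY N where IY: "is_ito_integral M F W (\<lambda>s w. Y s w * (1 - Y s w)) IY"
    and N: "AE w in M. impulsed_path b \<epsilon> Y IY N w"
    by (rule impulsed_process_regulator[OF Y \<epsilon>])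
  have "AE w in M. close_paths b \<epsilon> X Y IX IY w"
    using A N
  proof eventually_elim
    case (elim w)
    note elim = elim[unfolded reflected_path_def impulsed_path_def]
    show ?case
      unfolding close_paths_def
    proof (intro allI impI)
      fix s :: real assume s: "0 \<le> s"
      from elim(1) s have a: "b \<le> X s w" "0 \<le> A s w" "X s w = b + IX s w + A s w"
        "\<And>r. 0 \<le> r \<Longrightarrow> r \<le> s \<Longrightarrow> - IX r w \<le> A s w" "\<exists>r. 0 \<le> r \<and> r \<le> s \<and> A s w = - IX r w" by blast+
      from elim(2) s have y: "b - \<epsilon> < Y s w" "Y s w < 1" "Y s w = b + IY s w + \<epsilon> * real (N s w)"
        "\<And>r. 0 \<le> r \<Longrightarrow> r \<le> s \<Longrightarrow> - IY r w - \<epsilon> \<le> \<epsilon> * real (N s w)"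
        "\<epsilon> * real (N s w) = 0 \<or> (\<exists>r. 0 \<le> r \<and> r \<le> s \<and> \<epsilon> * real (N s w) = - IY r w)" by blast+
      note R = regulator_comparison[where IX = "\<lambda>r. IX r w" and IY = "\<lambda>r. IY r w" and b = b, OF s a(4,5,2) y(4,5)]
      show "b \<le> X s w \<and> b - \<epsilon> < Y s w \<and> Y s w < 1 \<and>
        (\<forall>j. (\<forall>r\<in>{0..s}. \<bar>IY r w - IX r w\<bar> \<le> j) \<longrightarrow> \<bar>Y s w - X s w\<bar> \<le> 2 * j + \<epsilon> \<and>
          (\<forall>i. (\<forall>r\<in>{0..s}. \<bar>IY r w\<bar> \<le> i) \<longrightarrow> \<bar>Y s w - X s w\<bar> \<le> 2 * j + i))"
      proof (intro conjI allI impI)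
        fix j i
        assume j: "\<forall>r\<in>{0..s}. \<bar>IY r w - IX r w\<bar> \<le> j"
        show "\<bar>Y s w - X s w\<bar> \<le> 2 * j + \<epsilon>" unfolding a(3) y(3) by (rule R(1)) (use j \<epsilon> in auto)
        assume i: "\<forall>r\<in>{0..s}. \<bar>IY r w\<bar> \<le> i"
        show "\<bar>Y s w - X s w\<bar> \<le> 2 * j + i" unfolding a(3) y(3) by (rule R(2)) (use i j \<epsilon> in auto)
      qed (use a y in auto)
    qed
  qed
  with IX IY show ?thesis by (rule that)
qed

lemma difference_regularity:
  assumes X: "reflected_process M F W b X" and Y: "impulsed_process M F W b \<epsilon> Y"
  shows "0 \<le> s \<Longrightarrow> (\<lambda>w. Y s w - X s w) \<in> borel_measurable M"
    and "w \<in> space M \<Longrightarrow> 0 \<le> s \<Longrightarrow> ((\<lambda>s. Y s w - X s w) \<longlongrightarrow> Y s w - X s w) (at_right s)"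
    and "w \<in> space M \<Longrightarrow> 0 \<le> s \<Longrightarrow> bdd_above ((\<lambda>r. \<bar>Y r w - X r w\<bar>) ` {0..s})"
proof -
  have Xm: "X s \<in> borel_measurable M" and Ym: "Y s \<in> borel_measurable M" if "0 \<le> s" for s
    using X Y that measurable_F_M[of "X s" s] measurable_F_M[of "Y s" s]
    by (auto simp: reflected_process_def impulsed_process_def adapted_def)
  then show "(\<lambda>w. Y s w - X s w) \<in> borel_measurable M" if "0 \<le> s" for s using that by simp
  have Xc: "continuous_on {0..} (\<lambda>s. X s w)" if "w \<in> space M" for w
    using X that by (auto simp: reflected_process_def continuous_paths_def)
  have Yr: "((\<lambda>s. Y s w) \<longlongrightarrow> Y s w) (at_right s)" if "w \<in> space M" "0 \<le> s" for w s
    using Y that by (auto simp: impulsed_process_def cadlag_paths_def continuous_within)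
  show r: "((\<lambda>s. Y s w - X s w) \<longlongrightarrow> Y s w - X s w) (at_right s)" if "w \<in> space M" "0 \<le> s" for w s
    by (intro tendsto_diff Yr that continuous_on_imp_tendsto_at_right[OF Xc])
  show "bdd_above ((\<lambda>r. \<bar>Y r w - X r w\<bar>) ` {0..s})" if w: "w \<in> space M" and s: "0 \<le> s" for w s
  proof (rule bdd_above_cadlag_path[OF r[OF w] _ s])
    fix t :: real assume t: "0 < t"
    obtain l where "((\<lambda>s. Y s w) \<longlongrightarrow> l) (at_left t)"
      using Y w t unfolding impulsed_process_def cadlag_paths_def by blast
    moreover have "((\<lambda>s. X s w) \<longlongrightarrow> X t w) (at_left t)"
    proof -
      have "isCont (\<lambda>s. X s w) t" using t by (intro continuous_on_interior[OF Xc[OF w]]) auto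
      then show ?thesis by (auto simp: isCont_def intro: filterlim_mono at_le)
    qed
    ultimately have "((\<lambda>s. Y s w - X s w) \<longlongrightarrow> l - X t w) (at_left t)" by (rule tendsto_diff)
    then show "\<exists>l. ((\<lambda>s. Y s w - X s w) \<longlongrightarrow> l) (at_left t)" by blast
  qed
qed

text \<open>
  The impulsed processes stay below \<open>1\<close> by assumption, and they converge to \<open>X\<close> as long as \<open>X < 2\<close>.
\<close>

lemma reflected_process_le_1:
  assumes X: "reflected_process M F W b X" and b: "0 < b" "b < 1"
    and Y: "\<forall>\<epsilon>>0. impulsed_process M F W b \<epsilon> (Y \<epsilon>)" and T: "0 < T"
  shows "AE w in M. \<forall>s. 0 \<le> s \<and> s < T \<longrightarrow> X s w \<le> 1"
proof -
  have T0: "0 \<le> T" using T by simp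
  have Xc: "continuous_on {0..} (\<lambda>s. X s w)" if "w \<in> space M" for w
    using X that by (auto simp: reflected_process_def continuous_paths_def)
  have XF: "X s \<in> borel_measurable (F s)" if "0 \<le> s" for s
    using X that by (auto simp: reflected_process_def adapted_def)
  \<comment> \<open>A level above 1 leaves a gap for the contradiction at the end. Below 2, and with
    the impulsed path between 0 and 1, the factor \<open>\<bar>1 - (x + y)\<bar>\<close> is at most
    2, which is the Lipschitz constant used.\<close>
  define \<tau> where "\<tau> = hitting X 2 T"
  have \<tau>: "is_stopping T \<tau>" unfolding \<tau>_def by (rule is_stopping_hitting[OF XF Xc T0])
  have \<tau>T: "\<tau> w \<le> T" for w unfolding \<tau>_def by (rule hitting_bounds[OF T0])
  \<comment> \<open>The excess of \<open>X\<close> over 1 is at most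
    \<open>\<bar>Y - X\<bar>\<close> for every impulsed process, and it does not depend on
    \<epsilon>.\<close>
  let ?E = "\<lambda>s w. max 0 (X s w - 1)"
  have \<Psi>m: "sup_sq (killed \<tau> ?E) T \<in> borel_measurable M"
    by (rule killed_sup_sq_measurable[OF _ _ is_stopping_measurable[OF \<tau>]])
      (use XF[THEN measurable_F_M] in \<open>auto intro!: tendsto_max tendsto_diff continuous_on_imp_tendsto_at_right[OF Xc]\<close>)
  \<comment> \<open>For \<open>\<epsilon> \<le> b\<close> the impulse level is nonnegative, so
    \<open>Y\<close> is positive outright.\<close>
  have bound: "expected_sup (killed \<tau> ?E) T \<le> ennreal (3 * \<epsilon>\<^sup>2 * exp (24 * 2\<^sup>2 * T))"
    if \<epsilon>: "0 < \<epsilon>" "\<epsilon> \<le> b" for \<epsilon>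
  proof -
    note Y\<epsilon> = Y[rule_format, OF \<epsilon>(1)]
    obtain IX IY where IX: "is_ito_integral M F W (\<lambda>s w. X s w * (1 - X s w)) IX"
      and IY: "is_ito_integral M F W (\<lambda>s w. Y \<epsilon> s w * (1 - Y \<epsilon> s w)) IY"
      and D: "AE w in M. close_paths b \<epsilon> X (Y \<epsilon>) IX IY w"
      by (rule process_difference[OF X Y\<epsilon> \<epsilon>(1)])
    let ?D = "\<lambda>s w. Y \<epsilon> s w - X s w"
    let ?H = "\<lambda>s w. X s w * (1 - X s w) * indicator {0..T} s"
    let ?K = "\<lambda>s w. Y \<epsilon> s w * (1 - Y \<epsilon> s w) * indicator {0..T} s"
    have "expected_sup (killed \<tau> ?E) T \<le> expected_sup (killed \<tau> ?D) T"
    proof (rule nn_integral_mono_AE)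
      show "AE w in M. sup_sq (killed \<tau> ?E) T w \<le> sup_sq (killed \<tau> ?D) T w"
        using D
      proof eventually_elim
        case (elim w)
        note elim = elim[unfolded close_paths_def]
        show ?case
        proof (rule SUP_mono)
          fix s assume s: "s \<in> {0..T}"
          have "?E s w \<le> \<bar>?D s w\<bar>" using elim s by (auto simp: max_def)
          from power_mono[OF this, of 2]
          have "ennreal ((killed \<tau> ?E s w)\<^sup>2) \<le> ennreal ((killed \<tau> ?D s w)\<^sup>2)"
            by (auto intro!: ennreal_leI)
          with s show "\<exists>r\<in>{0..T}. ennreal ((killed \<tau> ?E s w)\<^sup>2) \<le> ennreal ((killed \<tau> ?D r w)\<^sup>2)"
            by blast
        qed
      qed
    qed
    also have "\<dots> \<le> ennreal (3 * \<epsilon>\<^sup>2 * exp (24 * 2\<^sup>2 * T))"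
    proof (rule gronwall_estimate[OF ito_of_is_ito_integral[OF IX T0] ito_of_is_ito_integral[OF IY T0] \<tau>,
          where B = 2 and \<epsilon> = \<epsilon> and D = ?D])
      show "AE w in M. \<forall>s. 0 \<le> s \<and> s < \<tau> w \<longrightarrow>
        controlled \<epsilon> 2 2 ?D ?H ?K IX IY s w"
        using D
      proof eventually_elim
        case (elim w)
        note elim = elim[unfolded close_paths_def]
        show ?case
        proof (intro allI impI)
          fix s assume s: "0 \<le> s \<and> s < \<tau> w"
          have x: "b \<le> X s w" "b - \<epsilon> < Y \<epsilon> s w" "Y \<epsilon> s w < 1" using elim s by auto
          have x2: "X s w < 2" using s T0 unfolding \<tau>_def by (auto intro: hitting_less)
          have "\<bar>1 - (X s w + Y \<epsilon> s w)\<bar> \<le> 2" using x x2 \<epsilon> b by auto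
          then have "\<bar>?D s w\<bar> * \<bar>1 - (X s w + Y \<epsilon> s w)\<bar> \<le> \<bar>?D s w\<bar> * 2"
            by (intro mult_left_mono) auto
          moreover have "s \<in> {0..T}" using s \<tau>T[of w] by auto
          ultimately have "\<bar>?K s w - ?H s w\<bar> \<le> 2 * \<bar>?D s w\<bar>"
            by (simp add: logistic_diff abs_mult)
          moreover have "\<bar>?D s w\<bar> \<le> 2" using x x2 \<epsilon> b by auto
          ultimately show "controlled \<epsilon> 2 2 ?D ?H ?K IX IY s w"
            using elim s by blast
        qed
      qed
    qed (use \<epsilon> T0 difference_regularity(1,2)[OF X Y\<epsilon>] in auto)
    finally show ?thesis .
  qed
  have "expected_sup (killed \<tau> ?E) T \<le> 0"
  proof (rule LIMSEQ_le_const)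
    let ?e = "\<lambda>n. b * (1 / real (Suc n))"
    have "(\<lambda>n. ennreal (3 * (?e n)\<^sup>2 * exp (24 * 2\<^sup>2 * T))) \<longlonglongrightarrow> ennreal (3 * (b * 0)\<^sup>2 * exp (24 * 2\<^sup>2 * T))"
      by (intro tendsto_ennrealI tendsto_mult tendsto_power tendsto_const LIMSEQ_Suc[OF lim_1_over_n])
    then show "(\<lambda>n. ennreal (3 * (?e n)\<^sup>2 * exp (24 * 2\<^sup>2 * T))) \<longlonglongrightarrow> 0" by simp
    have "0 < ?e n \<and> ?e n \<le> b" for n
      using b mult_left_mono[of "1 / real (Suc n)" 1 b] by simp
    then show "\<exists>N. \<forall>n\<ge>N. expected_sup (killed \<tau> ?E) T \<le> ennreal (3 * (?e n)\<^sup>2 * exp (24 * 2\<^sup>2 * T))"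
      using bound by blast
  qed
  then have "AE w in M. sup_sq (killed \<tau> ?E) T w = 0"
    using nn_integral_0_iff_AE[OF \<Psi>m] by simp
  moreover obtain A I where "AE w in M. reflected_path b X I A w"
    by (rule reflected_process_regulator[OF X])
  ultimately show ?thesis
    using AE_space
  proof eventually_elim
    case (elim w)
    note elim = elim[unfolded reflected_path_def]
    have X0: "X 0 w = b" using elim(2) by blast
    have le: "X s w \<le> 1" if "0 \<le> s" "s < \<tau> w" for s
      using killed_sup_sq_eq_0D[of "\<lambda>s. killed \<tau> ?E s w", OF elim(1), of s] that \<tau>T[of w] by (auto simp: max_def split: if_splits)
    \<comment> \<open>The path is at most 1 before \<open>\<tau>\<close>, hence by continuity at
      \<open>\<tau>\<close>, whereas there it would have to equal 2.\<close>
    have "\<not> \<tau> w < T"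
    proof
      assume less: "\<tau> w < T"
      have X\<tau>: "X (\<tau> w) w = 2"
        using hitting_value_eq[of X w T 2, OF Xc[OF elim(3)] T0] less X0 b unfolding \<tau>_def by simp
      then have "\<tau> w \<noteq> 0" using X0 b by auto
      then have "0 < \<tau> w" using hitting_bounds(1)[OF T0, of X 2 w] unfolding \<tau>_def by simp
      from left_limit_le[OF Xc[OF elim(3)] this le] X\<tau> show False by simp
    qed
    then show ?case using le by auto
  qed
qed

end

context brownian_setting
begin

text \<open>
  If \<open>b < \<epsilon>\<close>, stop \<open>Y\<close> when it reaches \<open>0\<close>: the stopped path solves the same equation, hence is \<open>Y\<close>.
  The level \<open>b - \<epsilon> < 0\<close> is then never reached.
\<close>

lemma impulsed_process_nonneg:
  assumes Y: "impulsed_process M F W b \<epsilon> Y" and b: "0 < b" and \<epsilon>: "0 < \<epsilon>" and T: "0 < T"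
  shows "AE w in M. \<forall>s. 0 \<le> s \<and> s < T \<longrightarrow> 0 \<le> Y s w"
proof -
  have T0: "0 \<le> T" using T by simp
  obtain I N where I: "is_ito_integral M F W (\<lambda>s w. Y s w * (1 - Y s w)) I"
    and N: "AE w in M. impulsed_path b \<epsilon> Y I N w"
    by (rule impulsed_process_regulator[OF Y \<epsilon>])
  show ?thesis
  proof (cases "\<epsilon> \<le> b")
    case True
    show ?thesis
      using N
    proof eventually_elim
      case (elim w)
      note elim = elim[unfolded impulsed_path_def]
      show ?case
      proof (intro allI impI)
        fix s assume "0 \<le> s \<and> s < T"
        then have "b - \<epsilon> < Y s w" using elim by blast
        with True show "0 \<le> Y s w" by simp
      qed
    qed
  next
    case False
    let ?Z = "\<lambda>s w. - I s w"
    have Zc: "continuous_on {0..} (\<lambda>s. ?Z s w)" if "w \<in> space M" for w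
      using I that by (auto simp: is_ito_integral_def continuous_paths_def intro!: continuous_on_minus)
    have ZF: "?Z s \<in> borel_measurable (F s)" if "0 \<le> s" for s
      using I that by (auto simp: is_ito_integral_def adapted_def)
    \<comment> \<open>As long as no impulse occurs, \<open>Y = b + I\<close>. So \<open>-I\<close>
      reaches \<open>b\<close> when \<open>Y\<close> reaches 0, and reaches \<epsilon> when
      \<open>Y\<close> reaches the impulse level. Both are upward passages of a continuous
      process.\<close>
    define \<sigma> where "\<sigma> = hitting ?Z b T"
    define \<tau> where "\<tau> = hitting ?Z \<epsilon> T"
    have \<sigma>: "is_stopping T \<sigma>" unfolding \<sigma>_def by (rule is_stopping_hitting[OF ZF Zc T0])
    have \<tau>: "is_stopping T \<tau>" unfolding \<tau>_def by (rule is_stopping_hitting[OF ZF Zc T0])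
    have \<sigma>0: "0 \<le> \<sigma> w" and \<tau>0: "0 \<le> \<tau> w" and \<tau>T: "\<tau> w \<le> T" for w
      unfolding \<tau>_def \<sigma>_def by (rule hitting_bounds[OF T0])+
    let ?K = "\<lambda>s w. Y s w * (1 - Y s w) * indicator {0..T} s"
    \<comment> \<open>The motion of the integral after \<open>\<sigma>\<close>. Its integrand is
      \<open>?K\<close> after \<open>\<sigma>\<close> and zero before, so it is the difference of
      two integrals to which Gronwall applies.\<close>
    let ?D = "\<lambda>s w. I s w - I (min s (\<sigma> w)) w"
    note itoK = ito_of_is_ito_integral[OF I T0]
    note ito\<sigma> = ito_stop[OF itoK \<sigma>]
    have Dm: "?D s \<in> borel_measurable M" if "0 \<le> s" for s
      using ito_measurable[OF itoK that] ito_measurable[OF ito\<sigma> that] by (rule borel_measurable_diff)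
    have Dc: "continuous_on {0..} (\<lambda>s. ?D s w)" if "w \<in> space M" for w
      using ito_continuous[OF itoK that] ito_continuous[OF ito\<sigma> that] by (rule continuous_on_diff)
    have Dr: "((\<lambda>s. ?D s w) \<longlongrightarrow> ?D s w) (at_right s)" if "w \<in> space M" "0 \<le> s" for w s
      by (rule continuous_on_imp_tendsto_at_right[OF Dc[OF that(1)] that(2)])
    \<comment> \<open>Before \<open>\<tau>\<close> the regulator is zero or a value of
      \<open>-I\<close>, hence below \<epsilon>; being a multiple of \<epsilon>, it is zero.\<close>
    have no_impulse: "Y s w = b + I s w \<and> - \<epsilon> < I s w \<and> I s w < 1"
      if path: "impulsed_path b \<epsilon> Y I N w"
        and s: "0 \<le> s" "s < \<tau> w" for s w
    proof -
      note n = path[unfolded impulsed_path_def]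
      have lt: "- I r w < \<epsilon>" if "0 \<le> r" "r \<le> s" for r
        using hitting_less[of r ?Z \<epsilon> T w] that s T0 by (simp add: \<tau>_def)
      have "\<epsilon> * real (N s w) = 0 \<or> (\<exists>r. 0 \<le> r \<and> r \<le> s \<and> \<epsilon> * real (N s w) = - I r w)"
        using n s by blast
      then have "\<epsilon> * real (N s w) < \<epsilon> * 1"
      proof (elim disjE exE conjE)
        fix r assume "0 \<le> r" "r \<le> s" "\<epsilon> * real (N s w) = - I r w"
        then show ?thesis using lt[of r] by (simp only: mult_1_right)
      qed (use \<epsilon> in simp)
      then have "N s w = 0" using \<epsilon> by simp
      moreover have "Y s w = b + I s w + \<epsilon> * real (N s w)" "Y s w < 1" using n s by blast+
      ultimately show ?thesis using lt[of s] s b by simp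
    qed
    have at_\<sigma>: "I (\<sigma> w) w = - b" if "w \<in> space M" "I 0 w = 0" "\<sigma> w < T" for w
      using hitting_value_eq[of ?Z w T b, OF Zc[OF that(1)] T0] that b unfolding \<sigma>_def by simp
    \<comment> \<open>Here the difference of the integrals is \<open>?D\<close> itself, so the
      comparison holds with error 0 and Gronwall forces \<open>?D\<close> to vanish before
      \<open>\<tau>\<close>.\<close>
    have "expected_sup (killed \<tau> ?D) T \<le> ennreal (3 * 0\<^sup>2 * exp (24 * (1 + \<epsilon>)\<^sup>2 * T))"
    proof (rule gronwall_estimate[OF ito\<sigma> itoK \<tau>, where B = "1 + \<epsilon>" and D = ?D])
      show "AE w in M. \<forall>s. 0 \<le> s \<and> s < \<tau> w \<longrightarrow>
        (\<forall>j. (\<forall>r\<in>{0..s}. \<bar>?D r w\<bar> \<le> j) \<longrightarrow> \<bar>?D s w\<bar> \<le> 2 * j + 0) \<and>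
        \<bar>?K s w - (if s \<le> \<sigma> w then ?K s w else 0)\<bar> \<le> (1 + \<epsilon>) * \<bar>?D s w\<bar> \<and> \<bar>?D s w\<bar> \<le> 1 + \<epsilon>"
        using N AE_space
      proof eventually_elim
        case (elim w)
        note path = elim(1)
        note elim = elim[unfolded impulsed_path_def]
        have I0: "I 0 w = 0" using elim(1) by blast
        show ?case
        proof (intro allI impI conjI)
          fix s j assume s: "0 \<le> s \<and> s < \<tau> w"
          then have sT: "s < T" using \<tau>T[of w] by simp
          note n = no_impulse[OF path]
          have n1: "Y s w = b + I s w" "- \<epsilon> < I s w" "I s w < 1" using n[of s] s by auto
          show "\<bar>?D s w\<bar> \<le> 2 * j + 0" if "\<forall>r\<in>{0..s}. \<bar>?D r w\<bar> \<le> j"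
          proof -
            have "\<bar>?D s w\<bar> \<le> j" using that s by simp
            then show ?thesis by linarith
          qed
          have "0 \<le> min s (\<sigma> w)" "min s (\<sigma> w) < \<tau> w" using s \<sigma>0[of w] by auto
          from n[OF this] n1 show "\<bar>?D s w\<bar> \<le> 1 + \<epsilon>" by auto
          show "\<bar>?K s w - (if s \<le> \<sigma> w then ?K s w else 0)\<bar> \<le> (1 + \<epsilon>) * \<bar>?D s w\<bar>"
          proof (cases "s \<le> \<sigma> w")
            case True
            then show ?thesis using \<epsilon> by simp
          next
            case after: False
            \<comment> \<open>After \<open>\<sigma>\<close> the stopped value is \<open>-b\<close>,
              so \<open>?D = I + b = Y\<close>. This closes the inequality: the logistic integrand
              vanishes at 0 and is Lipschitz there with constant
              \<open>1 + \<epsilon>\<close>.\<close>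
            have D: "?D s w = Y s w" using at_\<sigma>[OF elim(2) I0] after sT n1(1) by simp
            have "b - \<epsilon> < Y s w" "Y s w < 1" using elim(1) s by blast+
            then have "\<bar>1 - Y s w\<bar> \<le> 1 + \<epsilon>" using b by auto
            then have "\<bar>Y s w\<bar> * \<bar>1 - Y s w\<bar> \<le> \<bar>Y s w\<bar> * (1 + \<epsilon>)" by (intro mult_left_mono) auto
            then show ?thesis using after s sT unfolding D by (simp add: abs_mult mult.commute)
          qed
        qed
      qed
    qed (use \<epsilon> T0 Dm Dr in auto)
    then have "AE w in M. sup_sq (killed \<tau> ?D) T w = 0"
      using nn_integral_0_iff_AE[OF killed_sup_sq_measurable[of ?D \<tau>, OF Dm Dr is_stopping_measurable[OF \<tau>]]] by simp
    then show ?thesis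
      using N AE_space
    proof eventually_elim
      case (elim w)
      note path = elim(2)
      note elim = elim[unfolded impulsed_path_def]
      have I0: "I 0 w = 0" using elim(2) by blast
      have D0: "?D s w = 0" if "0 \<le> s" "s < \<tau> w" for s
        using killed_sup_sq_eq_0D[of "\<lambda>s. killed \<tau> ?D s w", OF elim(1), of s] that \<tau>T[of w] by simp
      \<comment> \<open>Reaching the impulse level would make \<open>?D\<close> jump to
        \<open>b - \<epsilon> < 0\<close> at \<open>\<tau>\<close>, although it is continuous and
        zero before.\<close>
      have "\<not> \<tau> w < T"
      proof
        assume less: "\<tau> w < T"
        have I\<tau>: "I (\<tau> w) w = - \<epsilon>"
          using hitting_value_eq[of ?Z w T \<epsilon>, OF Zc[OF elim(3)] T0] less I0 \<epsilon> unfolding \<tau>_def by simp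
        then have "\<tau> w \<noteq> 0" using I0 \<epsilon> by auto
        then have pos: "0 < \<tau> w" using \<tau>0[of w] by simp
        have "\<sigma> w \<le> \<tau> w"
        proof (rule ccontr)
          assume "\<not> \<sigma> w \<le> \<tau> w"
          then have "- I (\<tau> w) w < b" using hitting_less[of "\<tau> w" ?Z b T w] T0 \<tau>0 by (simp add: \<sigma>_def)
          with I\<tau> False show False by simp
        qed
        then have "?D (\<tau> w) w = - \<epsilon> + b" using I\<tau> at_\<sigma>[OF elim(3) I0] less by simp
        moreover have "- ?D (\<tau> w) w \<le> 0"
          by (rule left_limit_le[OF continuous_on_minus[OF Dc[OF elim(3)]] pos]) (use D0 in simp)
        ultimately show False using False by simp
      qed
      then have \<tau>_eq: "\<tau> w = T" using \<tau>T[of w] by simp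
      show ?case
      proof (intro allI impI)
        fix s assume s: "0 \<le> s \<and> s < T"
        have Ys: "Y s w = b + I s w" using no_impulse[OF path, of s] s \<tau>_eq by simp
        have D: "I s w = I (min s (\<sigma> w)) w" using D0[of s] s \<tau>_eq by simp
        show "0 \<le> Y s w"
        proof (cases "s < \<sigma> w")
          case True
          then have "- I s w < b" using hitting_less[of s ?Z b T w] T0 s by (simp add: \<sigma>_def)
          then show ?thesis using Ys by simp
        next
          case after: False
          then show ?thesis using Ys D at_\<sigma>[OF elim(3) I0] s by simp
        qed
      qed
    qed
  qed
qed

text \<open>On the unit interval \<open>\<bar>1 - (x + y)\<bar> \<le> 1\<close>, so Gronwall applies
  with Lipschitz constant 1 and a priori bound 1. The bound linear in \<open>t\<close> comes from
  Doob alone, through the comparison without \<epsilon>.\<close>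

lemma convergence_rate:
  assumes X: "reflected_process M F W b X" and b: "0 < b" "b < 1"
    and Y: "\<forall>\<epsilon>>0. impulsed_process M F W b \<epsilon> (Y \<epsilon>)" and \<epsilon>: "0 < \<epsilon>" and t: "0 \<le> t"
  defines "D \<equiv> \<lambda>s w. Y \<epsilon> s w - X s w"
  shows "sup_sq D t \<in> borel_measurable M"
    and "expected_sup D t \<le> ennreal (9 / 4 * t)"
    and "expected_sup D t \<le> ennreal (3 * \<epsilon>\<^sup>2 * exp (24 * t))"
proof -
  \<comment> \<open>Confinement and killing concern times strictly below the horizon;
    \<open>t + 1\<close> puts all of \<open>{0..t}\<close> there.\<close>
  define T where "T = t + 1"
  have T: "0 < T" "0 \<le> T" "t \<le> T" "t < T" using t by (auto simp: T_def)
  note Y\<epsilon> = Y[rule_format, OF \<epsilon>]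
  have Dm: "D s \<in> borel_measurable M" if "0 \<le> s" for s
    using difference_regularity(1)[OF X Y\<epsilon> that] by (simp add: D_def)
  have Dr: "((\<lambda>s. D s w) \<longlongrightarrow> D s w) (at_right s)" if "w \<in> space M" "0 \<le> s" for w s
    using difference_regularity(2)[OF X Y\<epsilon> that] by (simp add: D_def)
  note st = is_stopping_const[OF T(2)]
  have killed_eq: "sup_sq (killed (\<lambda>_. T) D) t = sup_sq D t"
    by (intro ext SUP_cong) (use T in auto)
  show "sup_sq D t \<in> borel_measurable M"
    using killed_sup_sq_measurable[of D "\<lambda>_. T" t, OF Dm Dr is_stopping_measurable[OF st]] unfolding killed_eq .
  obtain IX IY where IX: "is_ito_integral M F W (\<lambda>s w. X s w * (1 - X s w)) IX"
    and IY: "is_ito_integral M F W (\<lambda>s w. Y \<epsilon> s w * (1 - Y \<epsilon> s w)) IY"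
    and D: "AE w in M. close_paths b \<epsilon> X (Y \<epsilon>) IX IY w"
    by (rule process_difference[OF X Y\<epsilon> \<epsilon>])
  let ?H = "\<lambda>s w. X s w * (1 - X s w) * indicator {0..T} s"
  let ?K = "\<lambda>s w. Y \<epsilon> s w * (1 - Y \<epsilon> s w) * indicator {0..T} s"
  note itoX = ito_of_is_ito_integral[OF IX T(2)] and itoY = ito_of_is_ito_integral[OF IY T(2)]
  have unit: "AE w in M. \<forall>s. 0 \<le> s \<and> s < T \<longrightarrow> 0 \<le> X s w \<and> X s w \<le> 1 \<and> 0 \<le> Y \<epsilon> s w \<and> Y \<epsilon> s w \<le> 1"
    using D reflected_process_le_1[OF X b Y T(1)] impulsed_process_nonneg[OF Y\<epsilon> b(1) \<epsilon> T(1)]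
  proof eventually_elim
    case (elim w)
    note elim = elim[unfolded close_paths_def]
    show ?case
    proof (intro allI impI)
      fix s assume s: "0 \<le> s \<and> s < T"
      then have "b \<le> X s w" "Y \<epsilon> s w < 1" using elim(1) by blast+
      with elim(2,3) s b show "0 \<le> X s w \<and> X s w \<le> 1 \<and> 0 \<le> Y \<epsilon> s w \<and> Y \<epsilon> s w \<le> 1" by force
    qed
  qed
  have "expected_sup (killed (\<lambda>_. T) D) t \<le> ennreal (3 * \<epsilon>\<^sup>2 * exp (24 * 1\<^sup>2 * t))"
  proof (rule gronwall_estimate[OF itoX itoY st, where B = 1])
    show "AE w in M. \<forall>s. 0 \<le> s \<and> s < T \<longrightarrow>
      controlled \<epsilon> 1 1 D ?H ?K IX IY s w"
      using D unit
    proof eventually_elim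
      case (elim w)
      note elim = elim[unfolded close_paths_def]
      show ?case
      proof (intro allI impI)
        fix s assume s: "0 \<le> s \<and> s < T"
        have u: "0 \<le> X s w" "X s w \<le> 1" "0 \<le> Y \<epsilon> s w" "Y \<epsilon> s w \<le> 1" using elim(2) s by blast+
        then have "\<bar>1 - (X s w + Y \<epsilon> s w)\<bar> \<le> 1" by auto
        then have "\<bar>D s w\<bar> * \<bar>1 - (X s w + Y \<epsilon> s w)\<bar> \<le> \<bar>D s w\<bar> * 1" by (intro mult_left_mono) auto
        then have "\<bar>?K s w - ?H s w\<bar> \<le> 1 * \<bar>D s w\<bar>" using s by (simp add: logistic_diff abs_mult D_def)
        moreover have "\<bar>D s w\<bar> \<le> 1" using u by (auto simp: D_def)
        ultimately show "controlled \<epsilon> 1 1 D ?H ?K IX IY s w"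
          using elim(1) s unfolding D_def by blast
      qed
    qed
  qed (use \<epsilon> t T Dm Dr in auto)
  then show "expected_sup D t \<le> ennreal (3 * \<epsilon>\<^sup>2 * exp (24 * t))"
    by (simp only: killed_eq[symmetric]) simp
  \<comment> \<open>Doob with energy at most t/16. It applies to \<open>\<sigma>(Y)\<close> and to
    the difference as well, since two numbers in [0,1/4] differ by at most 1/4.\<close>
  have quarter: "expected_sup Z t \<le> ennreal (t / 4)"
    if ito: "ito T G Z" and G: "AE w in M. \<forall>s\<in>{0..t}. \<bar>G s w\<bar> \<le> 1 / 4" for G Z
  proof -
    have "expected_energy G t \<le> (\<integral>\<^sup>+w. ennreal (t / 16) \<partial>M)"
    proof (rule nn_integral_mono_AE)
      show "AE w in M. energy G t w \<le> ennreal (t / 16)"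
        using G
      proof eventually_elim
        case (elim w)
        have "energy G t w \<le> (\<integral>\<^sup>+s. ennreal (1 / 16) * indicator {0..t} s \<partial>lborel)"
        proof (rule nn_integral_mono)
          fix s
          have "(G s w)\<^sup>2 \<le> 1 / 16" if "s \<in> {0..t}"
            using power_mono[OF bspec[OF elim that] abs_ge_zero, of 2] by (simp add: power2_eq_square)
          then show "ennreal ((G s w)\<^sup>2) * indicator {0..t} s \<le> ennreal (1 / 16) * indicator {0..t} s"
            by (cases "s \<in> {0..t}") (simp_all add: ennreal_leI)
        qed
        also have "\<dots> = ennreal (t / 16)"
          using t by (subst nn_integral_cmult_indicator) (auto simp: ennreal_mult[symmetric])
        finally show ?case .
      qed
    qed
    also have "\<dots> = ennreal (t / 16)" by (simp add: emeasure_space_1)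
    finally have "4 * expected_energy G t \<le> 4 * ennreal (t / 16)" by (rule mult_left_mono) simp
    also have "\<dots> = ennreal (t / 4)" by (simp add: ennreal_mult'[symmetric, of 4, simplified])
    finally show ?thesis using ito_doob[OF ito_le_horizon[OF ito T(3)] t] by (rule order_trans[rotated])
  qed
  let ?J = "\<lambda>s w. IY s w - IX s w"
  note itoJ = ito_diff[OF itoY itoX]
  have J: "expected_sup ?J t \<le> ennreal (t / 4)"
  proof (rule quarter[OF itoJ])
    show "AE w in M. \<forall>s\<in>{0..t}. \<bar>?K s w - ?H s w\<bar> \<le> 1 / 4"
      using unit
    proof eventually_elim
      case (elim w)
      show ?case
      proof
        fix s assume s: "s \<in> {0..t}"
        have u: "0 \<le> X s w" "X s w \<le> 1" "0 \<le> Y \<epsilon> s w" "Y \<epsilon> s w \<le> 1" using elim s T by auto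
        then have "0 \<le> X s w * (1 - X s w)" "0 \<le> Y \<epsilon> s w * (1 - Y \<epsilon> s w)" by auto
        with logistic_le_quarter[of "X s w"] logistic_le_quarter[of "Y \<epsilon> s w"]
        have "\<bar>Y \<epsilon> s w * (1 - Y \<epsilon> s w) - X s w * (1 - X s w)\<bar> \<le> 1 / 4" by linarith
        then show "\<bar>?K s w - ?H s w\<bar> \<le> 1 / 4" using s T by simp
      qed
    qed
  qed
  have IYs: "expected_sup IY t \<le> ennreal (t / 4)"
  proof (rule quarter[OF itoY])
    show "AE w in M. \<forall>s\<in>{0..t}. \<bar>?K s w\<bar> \<le> 1 / 4"
      using unit
    proof eventually_elim
      case (elim w)
      show ?case
      proof
        fix s assume s: "s \<in> {0..t}"
        have u: "0 \<le> Y \<epsilon> s w" "Y \<epsilon> s w \<le> 1" using elim s T by auto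
        then have "0 \<le> Y \<epsilon> s w * (1 - Y \<epsilon> s w)" by auto
        with logistic_le_quarter[of "Y \<epsilon> s w"]
        have "\<bar>Y \<epsilon> s w * (1 - Y \<epsilon> s w)\<bar> \<le> 1 / 4" by linarith
        then show "\<bar>?K s w\<bar> \<le> 1 / 4" using s T by simp
      qed
    qed
  qed
  have Jc: "continuous_on {0..} (\<lambda>s. ?J s w)" and IYc: "continuous_on {0..} (\<lambda>s. IY s w)" if "w \<in> space M" for w
    using ito_continuous[OF itoJ that] ito_continuous[OF itoY that] by simp_all
  have [measurable]: "sup_sq ?J t \<in> borel_measurable M" "sup_sq IY t \<in> borel_measurable M"
    by (rule sup_sq_measurable[OF ito_measurable[OF itoJ] ito_continuous[OF itoJ]], simp_all)
      (rule sup_sq_measurable[OF ito_measurable[OF itoY] ito_continuous[OF itoY]], simp_all)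
  \<comment> \<open>Again (2j + i)^2 \<le> 6 j^2 + 3 i^2, now with the running supremum of
    \<open>IY\<close> in place of \<epsilon>.\<close>
  have "expected_sup D t \<le> (\<integral>\<^sup>+w. 6 * sup_sq ?J t w + 3 * sup_sq IY t w \<partial>M)"
  proof (rule nn_integral_mono_AE)
    show "AE w in M. sup_sq D t w \<le> 6 * sup_sq ?J t w + 3 * sup_sq IY t w"
      using D AE_space
    proof eventually_elim
      case (elim w)
      note elim = elim[unfolded close_paths_def]
      let ?j = "running_sup ?J t w" and ?i = "running_sup IY t w"
      note bJ = bdd_above_continuous_path[of ?J, OF Jc[OF elim(2)], of t]
      note bI = bdd_above_continuous_path[of IY, OF IYc[OF elim(2)], of t]
      note jJ = SUP_power2_eq_running_sup[of ?J, OF bJ t] and iI = SUP_power2_eq_running_sup[of IY, OF bI t]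
      have "6 * sup_sq ?J t w + 3 * sup_sq IY t w = ennreal (6 * ?j\<^sup>2 + 3 * ?i\<^sup>2)"
        unfolding jJ(1) iI(1) by (simp add: ennreal_mult')
      moreover have "sup_sq D t w \<le> ennreal (6 * ?j\<^sup>2 + 3 * ?i\<^sup>2)"
      proof (rule SUP_least)
        fix s assume s: "s \<in> {0..t}"
        have "\<forall>r\<in>{0..s}. \<bar>?J r w\<bar> \<le> ?j" "\<forall>r\<in>{0..s}. \<bar>IY r w\<bar> \<le> ?i"
          using running_sup_upper[of ?J, OF bJ] running_sup_upper[of IY, OF bI] s by auto
        then have "\<bar>D s w\<bar> \<le> 2 * ?j + ?i" using elim(1) s unfolding D_def by simp
        from power_mono[OF this abs_ge_zero, of 2]
        have "(D s w)\<^sup>2 \<le> (2 * ?j + ?i)\<^sup>2" by simp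
        also have "\<dots> \<le> 6 * ?j\<^sup>2 + 3 * ?i\<^sup>2"
          using power2_le_weighted[of "1/2" "2 * ?j + ?i" "2 * ?j"] by (simp add: power_mult_distrib)
        finally show "ennreal ((D s w)\<^sup>2) \<le> ennreal (6 * ?j\<^sup>2 + 3 * ?i\<^sup>2)" by (rule ennreal_leI)
      qed
      ultimately show ?case by simp
    qed
  qed
  also have "\<dots> = 6 * expected_sup ?J t + 3 * expected_sup IY t"
    by (subst nn_integral_add) (auto simp: nn_integral_cmult)
  also have "\<dots> \<le> 6 * ennreal (t / 4) + 3 * ennreal (t / 4)"
    by (intro add_mono mult_left_mono J IYs) auto
  also have "\<dots> = ennreal (9 / 4 * t)"
  proof -
    have "6 * ennreal (t / 4) + 3 * ennreal (t / 4) = ennreal (6 * (t / 4)) + ennreal (3 * (t / 4))"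
      by (simp add: ennreal_mult' del: times_divide_eq_right)
    also have "\<dots> = ennreal (6 * (t / 4) + 3 * (t / 4))" using t by (intro ennreal_plus[symmetric]) auto
    finally show ?thesis by simp
  qed
  finally show "expected_sup D t \<le> ennreal (9 / 4 * t)" .
qed

lemma expected_running_sup_bound:
  assumes X: "reflected_process M F W b X" and b: "0 < b" "b < 1"
    and Y: "\<forall>\<epsilon>>0. impulsed_process M F W b \<epsilon> (Y \<epsilon>)" and \<epsilon>: "0 < \<epsilon>" and t: "0 \<le> t"
  shows "integrable M (\<lambda>w. (running_sup (\<lambda>s w. Y \<epsilon> s w - X s w) t w)\<^sup>2)"
    and "(\<integral>w. (running_sup (\<lambda>s w. Y \<epsilon> s w - X s w) t w)\<^sup>2 \<partial>M) \<le> 16 * t * exp (32 * t) * \<epsilon>\<^sup>2 + \<epsilon>"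
proof -
  let ?D = "\<lambda>s w. Y \<epsilon> s w - X s w"
  let ?R = "\<lambda>w. (running_sup ?D t w)\<^sup>2"
  note R = convergence_rate[OF X b Y \<epsilon> t]
  have eq: "sup_sq ?D t w = ennreal (?R w)" if "w \<in> space M" for w
    by (rule SUP_power2_eq_running_sup[of ?D, OF difference_regularity(3)[OF X Y[rule_format, OF \<epsilon>] that t] t])
  have "(\<lambda>w. enn2real (sup_sq ?D t w)) \<in> borel_measurable M"
    using R(1) by (intro borel_measurable_enn2real) auto
  then have m: "?R \<in> borel_measurable M"
    by (rule measurable_cong[THEN iffD1, rotated]) (simp add: eq)
  have nn: "(\<integral>\<^sup>+w. ennreal (?R w) \<partial>M) = expected_sup ?D t"
    by (intro nn_integral_cong) (simp add: eq)
  have b1: "(\<integral>\<^sup>+w. ennreal (?R w) \<partial>M) \<le> ennreal (9 / 4 * t)"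
    and b2: "(\<integral>\<^sup>+w. ennreal (?R w) \<partial>M) \<le> ennreal (3 * \<epsilon>\<^sup>2 * exp (24 * t))"
    unfolding nn by (rule R)+
  show int: "integrable M ?R"
  proof (rule integrableI_nonneg[OF m])
    show "(\<integral>\<^sup>+w. ennreal (?R w) \<partial>M) < \<infinity>"
      using b1 by (rule order_le_less_trans) simp
  qed simp
  have E: "(\<integral>\<^sup>+w. ennreal (?R w) \<partial>M) = ennreal (\<integral>w. ?R w \<partial>M)"
    by (rule nn_integral_eq_integral[OF int]) simp
  have "(\<integral>w. ?R w \<partial>M) \<le> 9 / 4 * t"
    by (rule ennreal_le_iff[THEN iffD1, OF _ b1[unfolded E]]) (use t in simp)
  moreover have "(\<integral>w. ?R w \<partial>M) \<le> 3 * \<epsilon>\<^sup>2 * exp (24 * t)"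
    by (rule ennreal_le_iff[THEN iffD1, OF _ b2[unfolded E]]) simp
  ultimately show "(\<integral>w. ?R w \<partial>M) \<le> 16 * t * exp (32 * t) * \<epsilon>\<^sup>2 + \<epsilon>"
    by (rule combined_bound[OF t \<epsilon>])
qed

end

theorem corollary4p4:
  fixes M :: "'a measure" and F :: "real \<Rightarrow> 'a measure"
    and W \<pi>r :: "real \<Rightarrow> 'a \<Rightarrow> real" and \<pi>i :: "real \<Rightarrow> real \<Rightarrow> 'a \<Rightarrow> real"
    and \<pi>hat :: real
  assumes "prob_space M" and "filtration_of M F" and "brownian_motion M F W"
    and "0 < \<pi>hat" and "\<pi>hat < 1"
    and "reflected_process M F W \<pi>hat \<pi>r"
    and "\<And>\<epsilon>. \<epsilon> > 0 \<Longrightarrow> impulsed_process M F W \<pi>hat \<epsilon> (\<pi>i \<epsilon>)"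
  shows "(\<forall>t\<ge>0. \<forall>\<epsilon>>0.
            integrable M (\<lambda>\<omega>. (running_sup (\<lambda>s \<omega>. \<pi>i \<epsilon> s \<omega> - \<pi>r s \<omega>) t \<omega>)\<^sup>2) \<and>
            (\<integral>\<omega>. (running_sup (\<lambda>s \<omega>. \<pi>i \<epsilon> s \<omega> - \<pi>r s \<omega>) t \<omega>)\<^sup>2 \<partial>M)
              \<le> 16 * t * exp (32 * t) * \<epsilon>\<^sup>2 + \<epsilon>) \<and>
         (\<forall>t\<ge>0.
            ((\<lambda>\<epsilon>. \<integral>\<omega>. (running_sup (\<lambda>s \<omega>. \<pi>i \<epsilon> s \<omega> - \<pi>r s \<omega>) t \<omega>)\<^sup>2 \<partial>M) \<longlongrightarrow> 0) (at_right 0))"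
proof -
  interpret brownian_setting M F W
    using assms by (intro brownian_setting.intro brownian_setting_axioms.intro)
  have "\<forall>\<epsilon>>0. impulsed_process M F W \<pi>hat \<epsilon> (\<pi>i \<epsilon>)" using assms(7) by blast
  note bound = expected_running_sup_bound[OF assms(6,4,5) this]
  show ?thesis
  proof (intro conjI allI impI)
    fix t :: real assume t: "0 \<le> t"
    show "((\<lambda>\<epsilon>. \<integral>\<omega>. (running_sup (\<lambda>s \<omega>. \<pi>i \<epsilon> s \<omega> - \<pi>r s \<omega>) t \<omega>)\<^sup>2 \<partial>M) \<longlongrightarrow> 0) (at_right 0)"
    proof (rule tendsto_sandwich[OF _ _ tendsto_const])
      show "\<forall>\<^sub>F \<epsilon> in at_right 0. 0 \<le> (\<integral>\<omega>. (running_sup (\<lambda>s \<omega>. \<pi>i \<epsilon> s \<omega> - \<pi>r s \<omega>) t \<omega>)\<^sup>2 \<partial>M)"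
        by (intro always_eventually allI integral_nonneg_AE) auto
      show "\<forall>\<^sub>F \<epsilon> in at_right 0. (\<integral>\<omega>. (running_sup (\<lambda>s \<omega>. \<pi>i \<epsilon> s \<omega> - \<pi>r s \<omega>) t \<omega>)\<^sup>2 \<partial>M)
          \<le> 16 * t * exp (32 * t) * \<epsilon>\<^sup>2 + \<epsilon>"
        using eventually_at_right_less[of "0::real"] by eventually_elim (rule bound(2)[OF _ t])
      have "((\<lambda>\<epsilon>::real. 16 * t * exp (32 * t) * \<epsilon>\<^sup>2 + \<epsilon>) \<longlongrightarrow> 16 * t * exp (32 * t) * 0\<^sup>2 + 0) (at_right 0)"
        by (intro tendsto_intros)
      then show "((\<lambda>\<epsilon>::real. 16 * t * exp (32 * t) * \<epsilon>\<^sup>2 + \<epsilon>) \<longlongrightarrow> 0) (at_right 0)" by simp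
    qed
  qed (use bound in blast)+
qed

end
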